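(* Let $\Gamma$ be a discrete subgroup of $\mathrm{PSL}(2,\mathbb{R})$ acting freely on $\mathbb{H}^2$ with $\Gamma\backslash\mathbb{H}^2$ compact. Then the horocycle flow $(\theta^{\mathcal X}_t)_{t\in\mathbb{R}}$ on $\mathcal X=T^1(\Gamma\backslash\mathbb{H}^2)$ is positive strong kinematic expansive and negative strong kinematic expansive.
   Context: Setting: $\mathbb{H}^2=\{z=x+iy\in\mathbb{C}: y>0\}$ is the hyperbolic plane with metric $ds^2=(dx^2+dy^2)/y^2$, on which $G=\mathrm{PSL}(2,\mathbb{R})=\mathrm{SL}(2,\mathbb{R})/\{\pm E_2\}$ acts by Möbius transformations. $X=\Gamma\backslash \mathrm{PSL}(2,\mathbb{R})=\{\Gamma g: g\in \mathrm{PSL}(2,\mathbb{R})\}$. $G$ carries a distance $d_G$ induced by a natural left-invariant Riemannian metric (normalized so that the class $a_t$ of $\mathrm{diag}(e^{t/2},e^{-t/2})$ satisfies $d_G(a_t,e)=|t|/\sqrt2$), and $X$ carries the distance $d_X(\Gamma g_1,\Gamma g_2)=\inf_{\gamma\in\Gamma}d_G(g_1,\gamma g_2)$. The unit tangent bundle $\mathcal X=T^1(\Gamma\backslash\mathbb{H}^2)$ is identified with $X$ by the standard bijection $\Xi:\mathcal X\to X$, whose inverse sends $\Gamma g$ to the image in $\mathcal X$ of the vertical unit vector at $i\in\mathbb{H}^2$ moved by $g$; the distance on $\mathcal X$ is the one making $\Xi$ an isometry. Horocycle flow: "the horocycle flow" means the stable one. Let $b_t\in\mathrm{PSL}(2,\mathbb{R})$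 be the class of $\begin{pmatrix}1&t\\0&1\end{pmatrix}$. Put $\theta_t(\Gamma g)=\Gamma g b_t$ on $X$; the horocycle flow on $\mathcal X$ is $\theta^{\mathcal X}_t=\Xi^{-1}\circ\theta_t\circ\Xi$. Positive (resp. negative) kinematic expansive: a continuous flow $\phi:\mathbb{R}\times M\to M$ on a compact metric space $(M,d)$ is positive (resp. negative) kinematic expansive if for each $\varepsilon>0$ there exists $\delta>0$ such that, for all $x,y\in M$, if $d(\phi_t(x),\phi_t(y))<\delta$ for all $t\in[0,\infty)$ (resp. for all $t\in(-\infty,0]$), then $y=\phi_\tau(x)$ for some $\tau\in(-\varepsilon,\varepsilon)$. Time change: for continuous flows $\phi,\psi:\mathbb{R}\times M\to M$ on a metric space, $\psi$ is a time change of $\phi$ if for every $x\in M$ the orbits $\phi_{\mathbb{R}}(x)$ and $\psi_{\mathbb{R}}(x)$ and their orientations coincide (same set, traversed in the same direction). Positive (resp. negative) strong kinematic expansive: every time change of the flow is positive (resp. negative) kinematic expansive. *)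

theory Defs
  imports "HOL-Analysis.Analysis" "HOL-Algebra.Coset"
begin

section \<open>Flows and kinematic expansivity\<close>

definition continuous_flow :: "'a set \<Rightarrow> ('a \<Rightarrow> 'a \<Rightarrow> real) \<Rightarrow> (real \<Rightarrow> 'a \<Rightarrow> 'a) \<Rightarrow> bool" where
  "continuous_flow M d \<phi> \<longleftrightarrow>
     Metric_space M d \<and>
     (\<forall>t. \<forall>x\<in>M. \<phi> t x \<in> M) \<and>
     (\<forall>x\<in>M. \<phi> 0 x = x) \<and>
     (\<forall>s t. \<forall>x\<in>M. \<phi> (s + t) x = \<phi> s (\<phi> t x)) \<and>
     continuous_map (prod_topology euclideanreal (Metric_space.mtopology M d))
       (Metric_space.mtopology M d) (\<lambda>(t, x). \<phi> t x)"

definition positive_kinematic_expansive ::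
  "'a set \<Rightarrow> ('a \<Rightarrow> 'a \<Rightarrow> real) \<Rightarrow> (real \<Rightarrow> 'a \<Rightarrow> 'a) \<Rightarrow> bool" where
  "positive_kinematic_expansive M d \<phi> \<longleftrightarrow>
     continuous_flow M d \<phi> \<and> compact_space (Metric_space.mtopology M d) \<and>
     (\<forall>\<epsilon>>0. \<exists>\<delta>>0. \<forall>x\<in>M. \<forall>y\<in>M.
        (\<forall>t\<in>{0..}. d (\<phi> t x) (\<phi> t y) < \<delta>) \<longrightarrow> (\<exists>\<tau>\<in>{-\<epsilon><..<\<epsilon>}. y = \<phi> \<tau> x))"

definition negative_kinematic_expansive ::
  "'a set \<Rightarrow> ('a \<Rightarrow> 'a \<Rightarrow> real) \<Rightarrow> (real \<Rightarrow> 'a \<Rightarrow> 'a) \<Rightarrow> bool" where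
  "negative_kinematic_expansive M d \<phi> \<longleftrightarrow>
     continuous_flow M d \<phi> \<and> compact_space (Metric_space.mtopology M d) \<and>
     (\<forall>\<epsilon>>0. \<exists>\<delta>>0. \<forall>x\<in>M. \<forall>y\<in>M.
        (\<forall>t\<in>{..0}. d (\<phi> t x) (\<phi> t y) < \<delta>) \<longrightarrow> (\<exists>\<tau>\<in>{-\<epsilon><..<\<epsilon>}. y = \<phi> \<tau> x))"

text \<open>
  \<open>\<psi>\<close> is a time change of \<open>\<phi>\<close>: the orbits of every point agree as sets, and moving forward
  along the \<open>\<psi>\<close>-orbit means moving forward along the \<open>\<phi>\<close>-orbit, i.e. \<open>\<psi>\<close> follows the \<open>\<phi>\<close>-orbit
  through an increasing parameter. The parameter depends on the point; neither its continuity
  nor its dependence on the point is restricted.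
\<close>

definition time_change ::
  "'a set \<Rightarrow> ('a \<Rightarrow> 'a \<Rightarrow> real) \<Rightarrow> (real \<Rightarrow> 'a \<Rightarrow> 'a) \<Rightarrow> (real \<Rightarrow> 'a \<Rightarrow> 'a) \<Rightarrow> bool" where
  "time_change M d \<phi> \<psi> \<longleftrightarrow>
     continuous_flow M d \<phi> \<and> continuous_flow M d \<psi> \<and>
     (\<forall>x\<in>M. range (\<lambda>t. \<phi> t x) = range (\<lambda>t. \<psi> t x) \<and>
        (\<exists>s::real \<Rightarrow> real. strict_mono s \<and> s 0 = 0 \<and> (\<forall>t. \<psi> t x = \<phi> (s t) x)))"

text \<open>
  The conjunct \<open>continuous_flow\<close> excludes that the quantification over time changes is vacuous:
  every continuous flow is a time change of itself.
\<close>

definition positive_strong_kinematic_expansive ::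
  "'a set \<Rightarrow> ('a \<Rightarrow> 'a \<Rightarrow> real) \<Rightarrow> (real \<Rightarrow> 'a \<Rightarrow> 'a) \<Rightarrow> bool" where
  "positive_strong_kinematic_expansive M d \<phi> \<longleftrightarrow>
     continuous_flow M d \<phi> \<and>
     (\<forall>\<psi>. time_change M d \<phi> \<psi> \<longrightarrow> positive_kinematic_expansive M d \<psi>)"

definition negative_strong_kinematic_expansive ::
  "'a set \<Rightarrow> ('a \<Rightarrow> 'a \<Rightarrow> real) \<Rightarrow> (real \<Rightarrow> 'a \<Rightarrow> 'a) \<Rightarrow> bool" where
  "negative_strong_kinematic_expansive M d \<phi> \<longleftrightarrow>
     continuous_flow M d \<phi> \<and>
     (\<forall>\<psi>. time_change M d \<phi> \<psi> \<longrightarrow> negative_kinematic_expansive M d \<psi>)"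


section \<open>The group \<open>PSL(2,\<real>)\<close>\<close>

definition SL2 :: "(real^2^2) monoid" where
  "SL2 = \<lparr>carrier = {A. det A = 1}, mult = (**), one = mat 1\<rparr>"

definition pm_E2 :: "(real^2^2) set" where
  "pm_E2 = {mat 1, - mat 1}"

definition PSL2 :: "(real^2^2) set monoid" where
  "PSL2 = SL2 Mod pm_E2"

definition psl_class :: "real^2^2 \<Rightarrow> (real^2^2) set" where
  "psl_class A = pm_E2 #>\<^bsub>SL2\<^esub> A"

definition b_elem :: "real \<Rightarrow> (real^2^2) set" where
  "b_elem t = psl_class (vector [vector [1, t], vector [0, 1]])"

text \<open>
  The left-invariant Riemannian metric is the one given on the Lie algebra of trace-free matrices
  by the inner product \<open>\<langle>A, B\<rangle> = tr (A\<^sup>T B)\<close>, whose norm is the Frobenius norm; this is the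
  library norm on \<^typ>\<open>real^2^2\<close>. The generator \<open>diag(1/2, -1/2)\<close> of \<open>a\<^sub>t\<close> has norm \<open>1/sqrt 2\<close>,
  in accordance with the normalization \<open>d\<^sub>G(a\<^sub>t, e) = \<bar>t\<bar>/sqrt 2\<close>.
\<close>

definition left_invariant_speed :: "(real \<Rightarrow> real^2^2) \<Rightarrow> real \<Rightarrow> real" where
  "left_invariant_speed c t = norm (matrix_inv (c t) ** vector_derivative c (at t))"

text \<open>
  The derivative of a \<^const>\<open>valid_path\<close> may be unbounded near the finitely many exceptional
  parameters. Integrability of the speed has to be required: a curve of infinite length would
  otherwise get length 0, the value of \<^const>\<open>integral\<close> at functions that are not integrable.
\<close>

definition SL2_curve :: "(real \<Rightarrow> real^2^2) \<Rightarrow> bool" where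
  "SL2_curve c \<longleftrightarrow>
     valid_path c \<and> path_image c \<subseteq> carrier SL2 \<and> left_invariant_speed c integrable_on {0..1}"

definition left_invariant_length :: "(real \<Rightarrow> real^2^2) \<Rightarrow> real" where
  "left_invariant_length c = integral {0..1} (left_invariant_speed c)"

text \<open>
  Since \<open>SL(2,\<real>) \<rightarrow> PSL(2,\<real>)\<close> is a Riemannian covering, the piecewise \<open>C\<^sup>1\<close> curves in
  \<open>PSL(2,\<real>)\<close> from \<open>p\<close> to \<open>q\<close> are the images of such curves in \<open>SL(2,\<real>)\<close> from a representative
  of \<open>p\<close> to a representative of \<open>q\<close>, with the same length. In this and the other distances the
  value 0 off the carrier is needed because \<^locale>\<open>Metric_space\<close> demands symmetry and
  nonnegativity for all arguments.
\<close>

definition d_G :: "(real^2^2) set \<Rightarrow> (real^2^2) set \<Rightarrow> real" where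
  "d_G p q =
     (if p \<in> carrier PSL2 \<and> q \<in> carrier PSL2
      then Inf {left_invariant_length c | c. SL2_curve c \<and> pathstart c \<in> p \<and> pathfinish c \<in> q}
      else 0)"


section \<open>Action on the hyperbolic plane and its unit tangent bundle\<close>

definition upper_half_plane :: "complex set" where
  "upper_half_plane = {z. Im z > 0}"

definition mobius :: "real^2^2 \<Rightarrow> complex \<Rightarrow> complex" where
  "mobius A z = (of_real (A$1$1) * z + of_real (A$1$2)) / (of_real (A$2$1) * z + of_real (A$2$2))"

text \<open>The choice of representative is immaterial, as \<open>A\<close> and \<open>-A\<close> act in the same way.\<close>

definition psl_mobius :: "(real^2^2) set \<Rightarrow> complex \<Rightarrow> complex" where
  "psl_mobius p = mobius (SOME A. A \<in> p)"

text \<open>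
  A tangent vector is a pair of base point and complex number; its hyperbolic length at \<open>z\<close> is
  \<open>\<bar>v\<bar> / Im z\<close>.
\<close>

definition unit_tangent_H :: "(complex \<times> complex) set" where
  "unit_tangent_H = {(z, v). z \<in> upper_half_plane \<and> cmod v / Im z = 1}"

definition psl_tangent :: "(real^2^2) set \<Rightarrow> complex \<times> complex \<Rightarrow> complex \<times> complex" where
  "psl_tangent p = (\<lambda>(z, v). (psl_mobius p z, deriv (psl_mobius p) z * v))"

definition discrete_subgroup :: "(real^2^2) set set \<Rightarrow> bool" where
  "discrete_subgroup \<Gamma> \<longleftrightarrow>
     subgroup \<Gamma> PSL2 \<and>
     subtopology (Metric_space.mtopology (carrier PSL2) d_G) \<Gamma> = discrete_topology \<Gamma>"

definition acts_freely :: "(real^2^2) set set \<Rightarrow> bool" where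
  "acts_freely \<Gamma> \<longleftrightarrow>
     (\<forall>\<gamma>\<in>\<Gamma>. \<forall>z\<in>upper_half_plane. psl_mobius \<gamma> z = z \<longrightarrow> \<gamma> = \<one>\<^bsub>PSL2\<^esub>)"

definition point_orbit :: "(real^2^2) set set \<Rightarrow> complex \<Rightarrow> complex set" where
  "point_orbit \<Gamma> z = (\<lambda>\<gamma>. psl_mobius \<gamma> z) ` \<Gamma>"

text \<open>The quotient of the hyperbolic plane by \<open>\<Gamma>\<close>, with the quotient topology.\<close>

definition quotient_surface :: "(real^2^2) set set \<Rightarrow> complex set topology" where
  "quotient_surface \<Gamma> =
     topology (\<lambda>U. U \<subseteq> point_orbit \<Gamma> ` upper_half_plane \<and>
       openin (top_of_set upper_half_plane) {z \<in> upper_half_plane. point_orbit \<Gamma> z \<in> U})"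


section \<open>The space \<open>X\<close> of cosets and the unit tangent bundle of the quotient\<close>

definition X_space :: "(real^2^2) set set \<Rightarrow> (real^2^2) set set set" where
  "X_space \<Gamma> = rcosets\<^bsub>PSL2\<^esub> \<Gamma>"

text \<open>The infimum does not depend on the chosen representatives, by left invariance of \<^const>\<open>d_G\<close>.\<close>

definition d_X :: "(real^2^2) set set \<Rightarrow> (real^2^2) set set \<Rightarrow> (real^2^2) set set \<Rightarrow> real" where
  "d_X \<Gamma> S T =
     (if S \<in> X_space \<Gamma> \<and> T \<in> X_space \<Gamma>
      then INF \<gamma>\<in>\<Gamma>. d_G (SOME g. g \<in> S) (\<gamma> \<otimes>\<^bsub>PSL2\<^esub> (SOME g. g \<in> T))
      else 0)"

definition horocycle_X :: "real \<Rightarrow> (real^2^2) set set \<Rightarrow> (real^2^2) set set" where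
  "horocycle_X t S = S #>\<^bsub>PSL2\<^esub> b_elem t"

text \<open>
  As \<open>\<Gamma>\<close> is discrete and acts freely, the unit tangent vectors of the quotient surface are the
  \<open>\<Gamma>\<close>-orbits of unit tangent vectors of the hyperbolic plane.
\<close>

definition unit_tangent_quotient :: "(real^2^2) set set \<Rightarrow> (complex \<times> complex) set set" where
  "unit_tangent_quotient \<Gamma> = (\<lambda>w. (\<lambda>\<gamma>. psl_tangent \<gamma> w) ` \<Gamma>) ` unit_tangent_H"

text \<open>
  The inverse of the identification \<open>\<Xi>\<close>. The vertical unit vector at \<open>\<i>\<close> is \<open>(\<i>, \<i>)\<close>, and the
  image of the coset \<open>\<Gamma>g\<close> under \<open>h \<mapsto> h \<cdot> (\<i>, \<i>)\<close> is the \<open>\<Gamma>\<close>-orbit of \<open>g \<cdot> (\<i>, \<i>)\<close>.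
\<close>

definition Xi_inv :: "(real^2^2) set set \<Rightarrow> (complex \<times> complex) set" where
  "Xi_inv S = (\<lambda>h. psl_tangent h (\<i>, \<i>)) ` S"

definition Xi :: "(real^2^2) set set \<Rightarrow> (complex \<times> complex) set \<Rightarrow> (real^2^2) set set" where
  "Xi \<Gamma> = inv_into (X_space \<Gamma>) Xi_inv"

definition d_unit_tangent ::
  "(real^2^2) set set \<Rightarrow> (complex \<times> complex) set \<Rightarrow> (complex \<times> complex) set \<Rightarrow> real" where
  "d_unit_tangent \<Gamma> v w =
     (if v \<in> unit_tangent_quotient \<Gamma> \<and> w \<in> unit_tangent_quotient \<Gamma>
      then d_X \<Gamma> (Xi \<Gamma> v) (Xi \<Gamma> w) else 0)"

definition horocycle_flow ::
  "(real^2^2) set set \<Rightarrow> real \<Rightarrow> (complex \<times> complex) set \<Rightarrow> (complex \<times> complex) set" where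
  "horocycle_flow \<Gamma> t = Xi_inv \<circ> horocycle_X t \<circ> Xi \<Gamma>"

end

theory Submission
  imports Defs
begin

text \<open>
  Lift a pair of points shadowing each other under a time change of the horocycle flow to
  \<open>SL(2,\<real>)\<close>: the relative position of the lifts must stay bounded along both orbits, which forces it
  to be upper triangular, with diagonal \<open>(a, 1/a)\<close>. If \<open>a = 1\<close>, the points lie on one short orbit
  segment. If \<open>a \<noteq> 1\<close>, the clocks \<open>\<tau>\<close> of the time change on the orbits of \<open>x\<close> and of \<open>x diag(a, 1/a)\<close>
  agree up to a bounded error after rescaling by \<open>a\<^sup>2\<close>, and by continuity this persists on the closure of
  the forward orbit of \<open>x\<close>. A minimal subset of this closure is invariant under the whole diagonal
  group, by the polynomial divergence of nearby horocycles, so the comparison can be iterated along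
  the powers of \<open>diag(a, 1/a)\<close>. A clock would then advance linearly in \<open>n\<close> during a horocycle time
  which is exponential in \<open>n\<close>, whereas by compactness it advances at least linearly in horocycle
  time. No unique ergodicity is needed.
\<close>

section \<open>Real two by two matrices\<close>

text \<open>The obstacle is that a time change has no regularity beyond the continuity of both
  flows, and that it might undo the only visible divergence between \<open>x\<close> and its
  translate by diag(a, 1/a). The horocycle flow carries these two points along parallel horocycles
  with times in the ratio a^2, and clocks that run differently on the two orbits could keep them
  synchronized for ever. For the flow itself this drift contradicts shadowing at once; for arbitrary
  clocks it has to be excluded globally, which is why minimal sets and the diagonal group enter. The
  lower left entry of the relative position is easy by comparison: it makes the lower right entry
  grow linearly in horocycle time, whatever the clocks do, because each clock runs through all
  horocycle times. The negative statement is reduced to the positive one: conjugation by diag(1, -1)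
  reverses the direction of the horocycles and preserves the norm.\<close>

definition mat2 :: "real \<Rightarrow> real \<Rightarrow> real \<Rightarrow> real \<Rightarrow> real^2^2" where
  "mat2 a b c d = vector [vector [a, b], vector [c, d]]"

lemma mat2_nth [simp]:
  "mat2 a b c d $ 1 $ 1 = a" "mat2 a b c d $ 1 $ 2 = b"
  "mat2 a b c d $ 2 $ 1 = c" "mat2 a b c d $ 2 $ 2 = d"
  by (simp_all add: mat2_def)

lemma mat2_eqI:
  fixes A B :: "real^2^2"
  assumes "A$1$1 = B$1$1" "A$1$2 = B$1$2" "A$2$1 = B$2$1" "A$2$2 = B$2$2"
  shows "A = B"
  using assms by (simp add: vec_eq_iff forall_2)

lemma mat2_collapse: "mat2 (A$1$1) (A$1$2) (A$2$1) (A$2$2) = A"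
  by (rule mat2_eqI) simp_all

lemma mat2_eq_iff [simp]: "mat2 a b c d = mat2 a' b' c' d' \<longleftrightarrow> a = a' \<and> b = b' \<and> c = c' \<and> d = d'"
  by (metis mat2_nth)

lemma mat2_cases: obtains a b c d where "A = mat2 a b c d"
  using mat2_collapse by metis

lemma mat2_mult [simp]:
  "mat2 a b c d ** mat2 a' b' c' d' =
   mat2 (a * a' + b * c') (a * b' + b * d') (c * a' + d * c') (c * b' + d * d')"
  by (rule mat2_eqI) (simp_all add: matrix_matrix_mult_def sum_2)

lemma mat2_arith [simp]:
  "mat2 a b c d + mat2 a' b' c' d' = mat2 (a + a') (b + b') (c + c') (d + d')"
  "mat2 a b c d - mat2 a' b' c' d' = mat2 (a - a') (b - b') (c - c') (d - d')"
  "- mat2 a b c d = mat2 (-a) (-b) (-c) (-d)"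
  "r *\<^sub>R mat2 a b c d = mat2 (r * a) (r * b) (r * c) (r * d)"
  by (rule mat2_eqI; simp)+

lemma mat_1_mat2: "(mat 1 :: real^2^2) = mat2 1 0 0 1"
  by (rule mat2_eqI) (simp_all add: mat_def)

lemma det_mat2 [simp]: "det (mat2 a b c d) = a * d - b * c"
  by (simp add: det_2)

lemma norm_mat2: "norm (mat2 a b c d) = sqrt (a\<^sup>2 + b\<^sup>2 + c\<^sup>2 + d\<^sup>2)"
  by (simp add: norm_vec_def L2_set_def sum_2 add_ac)

lemma norm_mat2_power2: "(norm (mat2 a b c d))\<^sup>2 = a\<^sup>2 + b\<^sup>2 + c\<^sup>2 + d\<^sup>2"
  by (simp add: norm_mat2)

lemma norm_mat2_le: "norm (mat2 a b c d) \<le> \<bar>a\<bar> + \<bar>b\<bar> + \<bar>c\<bar> + \<bar>d\<bar>"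
proof -
  have "(norm (mat2 a b c d))\<^sup>2 \<le> (\<bar>a\<bar> + \<bar>b\<bar> + \<bar>c\<bar> + \<bar>d\<bar>)\<^sup>2"
    unfolding norm_mat2_power2
    by (simp add: power2_eq_square distrib_left distrib_right add_increasing add_increasing2)
  then show ?thesis
    by (rule power2_le_imp_le) simp
qed

lemma abs_entry_le_norm:
  fixes A :: "real^2^2"
  shows "\<bar>A $ i $ j\<bar> \<le> norm A"
  by (metis Finite_Cartesian_Product.norm_nth_le order_trans real_norm_def)

text \<open>Cauchy-Schwarz for each of the four entries of the product; \<open>cs\<close> is the
  planar case, read off from Lagrange's identity.\<close>

lemma norm_matrix_mult_le:
  fixes A B :: "real^2^2"
  shows "norm (A ** B) \<le> norm A * norm B"
proof -
  obtain a b c d where A: "A = mat2 a b c d" by (rule mat2_cases)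
  obtain e f g h where B: "B = mat2 e f g h" by (rule mat2_cases)
  have cs: "(x * z + y * w)\<^sup>2 \<le> (x\<^sup>2 + y\<^sup>2) * (z\<^sup>2 + w\<^sup>2)" for x y z w :: real
    using zero_le_power2[of "x * w - y * z"] by (simp add: power2_eq_square algebra_simps)
  have "(norm (A ** B))\<^sup>2 \<le> (norm A * norm B)\<^sup>2"
    using cs[of a e b g] cs[of a f b h] cs[of c e d g] cs[of c f d h]
    by (simp add: A B norm_mat2_power2 power_mult_distrib algebra_simps)
  then show ?thesis
    by (rule power2_le_imp_le) simp
qed

lemma bounded_bilinear_matrix_mult2: "bounded_bilinear ((**) :: real^2^2 \<Rightarrow> real^2^2 \<Rightarrow> real^2^2)"
proof
  fix a a' b b' :: "real^2^2" and r :: real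
  show "(a + a') ** b = a ** b + a' ** b" "a ** (b + b') = a ** b + a ** b'"
    "(r *\<^sub>R a) ** b = r *\<^sub>R (a ** b)" "a ** (r *\<^sub>R b) = r *\<^sub>R (a ** b)"
    by (rule mat2_cases[of a], rule mat2_cases[of a'], rule mat2_cases[of b], rule mat2_cases[of b'],
        simp add: algebra_simps)+
  show "\<exists>K. \<forall>(a :: real^2^2) (b :: real^2^2). norm (a ** b) \<le> norm a * norm b * K"
    by (intro exI[of _ 1]) (simp add: norm_matrix_mult_le)
qed

interpretation mm: bounded_bilinear "(**) :: real^2^2 \<Rightarrow> real^2^2 \<Rightarrow> real^2^2"
  by (rule bounded_bilinear_matrix_mult2)

text \<open>The adjugate. On determinant 1 it is the inverse, and unlike \<open>matrix_inv\<close>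
  it is linear on all matrices and isometric for the Frobenius norm, so that limits and estimates of
  inverses come for free.\<close>

definition adj2 :: "real^2^2 \<Rightarrow> real^2^2" where
  "adj2 A = mat2 (A$2$2) (- A$1$2) (- A$2$1) (A$1$1)"

lemma adj2_mat2 [simp]: "adj2 (mat2 a b c d) = mat2 d (-b) (-c) a"
  by (simp add: adj2_def)

lemma norm_adj2 [simp]: "norm (adj2 A) = norm A"
  by (rule mat2_cases[of A]) (simp add: norm_mat2 add_ac)

lemma bounded_linear_adj2: "bounded_linear adj2"
proof (rule bounded_linear_intro[where K = 1])
  fix x y :: "real^2^2" and r :: real
  show "adj2 (x + y) = adj2 x + adj2 y" "adj2 (r *\<^sub>R x) = r *\<^sub>R adj2 x"
    by (rule mat2_cases[of x], rule mat2_cases[of y], simp)+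
qed simp

lemmas tendsto_adj2 = bounded_linear.tendsto[OF bounded_linear_adj2]
  and continuous_on_adj2 = bounded_linear.continuous_on[OF bounded_linear_adj2]

abbreviation SL :: "(real^2^2) set" where
  "SL \<equiv> {A. det A = 1}"

lemma SL_mult [simp]: "g \<in> SL \<Longrightarrow> h \<in> SL \<Longrightarrow> g ** h \<in> SL"
  by (simp add: det_mul)

lemma SL_one [simp]: "mat 1 \<in> SL"
  by simp

lemma det_adj2 [simp]: "det (adj2 g) = det g"
  by (rule mat2_cases[of g]) simp

lemma adj2_mult: "adj2 (g ** h) = adj2 h ** adj2 g"
  by (rule mat2_cases[of g], rule mat2_cases[of h]) simp

lemma adj2_adj2 [simp]: "adj2 (adj2 g) = g"
  by (rule mat2_cases[of g]) simp

lemma adj2_left: "det g = 1 \<Longrightarrow> adj2 g ** g = mat 1"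
  by (rule mat2_cases[of g]) (simp add: mat_1_mat2 algebra_simps)

lemma adj2_right: "det g = 1 \<Longrightarrow> g ** adj2 g = mat 1"
  by (rule mat2_cases[of g]) (simp add: mat_1_mat2 algebra_simps)

lemma adj2_cancel [simp]:
  assumes "det g = 1"
  shows "adj2 g ** (g ** h) = h" "g ** (adj2 g ** h) = h"
    "(h ** g) ** adj2 g = h" "(h ** adj2 g) ** g = h"
proof -
  show "adj2 g ** (g ** h) = h" "g ** (adj2 g ** h) = h"
    unfolding matrix_mul_assoc by (simp_all add: adj2_left adj2_right assms)
  show "(h ** g) ** adj2 g = h" "(h ** adj2 g) ** g = h"
    unfolding matrix_mul_assoc[symmetric] by (simp_all add: adj2_left adj2_right assms)
qed

lemma matrix_inv_SL:
  assumes "det g = 1"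
  shows "matrix_inv (g :: real^2^2) = adj2 g"
proof -
  have "\<exists>h. g ** h = mat 1 \<and> h ** g = mat 1"
    using adj2_left[OF assms] adj2_right[OF assms] by blast
  then have *: "matrix_inv g ** g = mat 1"
    unfolding matrix_inv_def by (rule someI2_ex) simp
  have "matrix_inv g = (matrix_inv g ** g) ** adj2 g"
    using assms by simp
  then show ?thesis
    by (simp add: *)
qed

lemma adj2_eqD:
  assumes "det g = 1" "adj2 g ** h = mat 1"
  shows "h = g"
  using adj2_cancel(2)[OF assms(1), of h] assms(2) by simp

lemma norm_mat_1: "norm (mat 1 :: real^2^2) = sqrt 2"
  by (simp add: mat_1_mat2 norm_mat2)

lemma adj2_mat_1 [simp]: "adj2 (mat 1) = mat 1"
  by (simp add: mat_1_mat2)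

lemma tendsto_entry: "(f \<longlongrightarrow> l) F \<Longrightarrow> ((\<lambda>x. f x $ i $ j) \<longlongrightarrow> (l::real^2^2) $ i $ j) F"
  by (intro tendsto_intros)

lemma tendsto_mat2:
  assumes "(a \<longlongrightarrow> a') F" "(b \<longlongrightarrow> b') F" "(c \<longlongrightarrow> c') F" "(d \<longlongrightarrow> d') F"
  shows "((\<lambda>x. mat2 (a x) (b x) (c x) (d x)) \<longlongrightarrow> mat2 a' b' c' d') F"
proof (rule vec_tendstoI, rule vec_tendstoI)
  fix i j :: 2
  show "((\<lambda>x. mat2 (a x) (b x) (c x) (d x) $ i $ j) \<longlongrightarrow> mat2 a' b' c' d' $ i $ j) F"
    using exhaust_2[of i] exhaust_2[of j] assms by auto
qed

lemma SL_closed: "closed SL"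
proof -
  have "SL = {A :: real^2^2. A$1$1 * A$2$2 - A$1$2 * A$2$1 = 1}"
    by (simp add: det_2)
  then show ?thesis
    by (auto intro!: closed_Collect_eq continuous_intros)
qed

section \<open>The left-invariant distance\<close>

lemma valid_path_has_vector_derivative:
  fixes c :: "real \<Rightarrow> 'a::real_normed_vector"
  assumes "valid_path c"
  obtains S where "finite S"
    "\<And>t. t \<in> {0..1} - S \<Longrightarrow> (c has_vector_derivative vector_derivative c (at t)) (at t)"
proof -
  obtain S where "finite S" and S: "c C1_differentiable_on ({0..1} - S)"
    using assms by (auto simp: valid_path_def piecewise_C1_differentiable_on_def)
  then show ?thesis
    by (intro that[of S]) (auto simp: C1_differentiable_on_eq vector_derivative_works[symmetric])
qed

lemma left_invariant_speed_SL:
  "det (c t) = 1 \<Longrightarrow> left_invariant_speed c t = norm (adj2 (c t) ** vector_derivative c (at t))"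
  by (simp add: left_invariant_speed_def matrix_inv_SL)

text \<open>The length enters through \<open>has_integral\<close>, so integrability of the speed is
  part of the relation and lengths can be added, reversed and translated without touching the
  infimum in \<open>d_G\<close>.\<close>

definition SL2_joined :: "real^2^2 \<Rightarrow> real^2^2 \<Rightarrow> real \<Rightarrow> bool" where
  "SL2_joined g h L \<longleftrightarrow> (\<exists>c. valid_path c \<and> path_image c \<subseteq> SL \<and> pathstart c = g \<and> pathfinish c = h \<and>
     (left_invariant_speed c has_integral L) {0..1})"

lemma SL2_joined_iff_curve:
  "SL2_joined g h L \<longleftrightarrow>
   (\<exists>c. SL2_curve c \<and> pathstart c = g \<and> pathfinish c = h \<and> left_invariant_length c = L)"
  unfolding SL2_joined_def SL2_curve_def left_invariant_length_def SL2_def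
  by (auto simp: has_integral_iff)

lemma SL2_joined_SL:
  assumes "SL2_joined g h L"
  shows "g \<in> SL" "h \<in> SL"
  using assms pathstart_in_path_image pathfinish_in_path_image
  by (fastforce simp: SL2_joined_def)+

lemma SL2_joined_nonneg: "SL2_joined g h L \<Longrightarrow> 0 \<le> L"
  unfolding SL2_joined_def by (auto elim!: has_integral_nonneg simp: left_invariant_speed_def)

text \<open>The constant factor \<open>k\<close> cancels in the product of the inverse of
  \<open>k ** c t\<close> with its derivative; only the finitely many exceptional parameters have to
  be spiked away.\<close>

lemma SL2_joined_left_mult:
  assumes "SL2_joined g h L" "k \<in> SL"
  shows "SL2_joined (k ** g) (k ** h) L"
proof -
  obtain c where c: "valid_path c" "path_image c \<subseteq> SL" "pathstart c = g" "pathfinish c = h"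
    "(left_invariant_speed c has_integral L) {0..1}"
    using assms(1) by (auto simp: SL2_joined_def)
  obtain S where S: "finite S"
    "\<And>t. t \<in> {0..1} - S \<Longrightarrow> (c has_vector_derivative vector_derivative c (at t)) (at t)"
    using valid_path_has_vector_derivative[OF c(1)] by blast
  have der: "((\<lambda>t. k ** c t) has_vector_derivative k ** vector_derivative c (at t)) (at t)"
    if "t \<in> {0..1} - S" for t
    by (rule bounded_linear.has_vector_derivative[OF mm.bounded_linear_right S(2)[OF that]])
  obtain S' where S': "finite S'" "c C1_differentiable_on ({0..1} - S')" "continuous_on {0..1} c"
    using c(1) by (auto simp: valid_path_def piecewise_C1_differentiable_on_def)
  have "(\<lambda>t. k ** c t) C1_differentiable_on ({0..1} - S')"
  proof -
    obtain D where D: "\<forall>x\<in>{0..1} - S'. (c has_vector_derivative D x) (at x)" "continuous_on ({0..1} - S') D"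
      using S'(2) by (auto simp: C1_differentiable_on_def)
    show ?thesis
      unfolding C1_differentiable_on_def
      using D by (intro exI[of _ "\<lambda>t. k ** D t"])
        (auto intro!: bounded_linear.has_vector_derivative[OF mm.bounded_linear_right]
           bounded_linear.continuous_on[OF mm.bounded_linear_right])
  qed
  moreover have "continuous_on {0..1} (\<lambda>t. k ** c t)"
    by (intro bounded_linear.continuous_on[OF mm.bounded_linear_right] S')
  ultimately have "valid_path (\<lambda>t. k ** c t)"
    using S'(1) by (auto simp: valid_path_def piecewise_C1_differentiable_on_def)
  moreover have im: "det (c t) = 1" if "t \<in> {0..1}" for t
    using c(2) that unfolding path_image_def by blast
  moreover have "(left_invariant_speed (\<lambda>t. k ** c t) has_integral L) {0..1}"
  proof (rule has_integral_spike_finite[OF S(1) _ c(5)])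
    fix t assume t: "t \<in> {0..1} - S"
    show "left_invariant_speed (\<lambda>t. k ** c t) t = left_invariant_speed c t"
      using im[of t] t assms(2) vector_derivative_at[OF der[OF t]]
      by (simp add: left_invariant_speed_SL det_mul adj2_mult matrix_mul_assoc[symmetric])
  qed
  ultimately show ?thesis
    unfolding SL2_joined_def using c(3,4) assms(2)
    by (intro exI[of _ "\<lambda>t. k ** c t"]) (auto simp: path_image_def pathstart_def pathfinish_def det_mul)
qed

lemma SL2_joined_sym:
  assumes "SL2_joined g h L"
  shows "SL2_joined h g L"
proof -
  obtain c where c: "valid_path c" "path_image c \<subseteq> SL" "pathstart c = g" "pathfinish c = h"
    "(left_invariant_speed c has_integral L) {0..1}"
    using assms(1) by (auto simp: SL2_joined_def)
  obtain S where S: "finite S"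
    "\<And>t. t \<in> {0..1} - S \<Longrightarrow> (c has_vector_derivative vector_derivative c (at t)) (at t)"
    using valid_path_has_vector_derivative[OF c(1)] by blast
  have "((\<lambda>t. left_invariant_speed c (1 - t)) has_integral L) {0..1}"
    using has_integral_affinity01[OF c(5), where m = "-1" and c = 1] by simp
  then have "(left_invariant_speed (reversepath c) has_integral L) {0..1}"
  proof (rule has_integral_spike_finite[rotated 2])
    show "finite ((\<lambda>t. 1 - t) ` S)" using S(1) by simp
    fix t :: real assume "t \<in> {0..1} - (\<lambda>t. 1 - t) ` S"
    then have t: "1 - t \<in> {0..1} - S"
      by auto (metis diff_diff_cancel image_eqI diff_diff_eq2 add_diff_cancel_left')
    have "(c \<circ> (\<lambda>t. 1 - t) has_vector_derivative -1 *\<^sub>R vector_derivative c (at (1 - t))) (at t)"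
      by (intro vector_diff_chain_within has_vector_derivative_at_within[OF S(2)[OF t]] derivative_eq_intros | simp)+
    then have "vector_derivative (reversepath c) (at t) = - vector_derivative c (at (1 - t))"
      by (simp add: reversepath_def o_def vector_derivative_at)
    then show "left_invariant_speed (reversepath c) t = left_invariant_speed c (1 - t)"
      by (simp add: left_invariant_speed_def reversepath_def mm.minus_right)
  qed
  then show ?thesis
    unfolding SL2_joined_def using c
    by (intro exI[of _ "reversepath c"]) (auto simp: valid_path_imp_reverse)
qed

text \<open>On each half of \<open>c +++ e\<close> the factor 2 of the chain rule is the Jacobian of
  the substitution. The midpoint and the preimages of the exceptional parameters form a finite
  set.\<close>

lemma SL2_joined_trans:
  assumes "SL2_joined g h L" "SL2_joined h k L'"
  shows "SL2_joined g k (L + L')"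
proof -
  obtain c where c: "valid_path c" "path_image c \<subseteq> SL" "pathstart c = g" "pathfinish c = h"
    "(left_invariant_speed c has_integral L) {0..1}"
    using assms(1) by (auto simp: SL2_joined_def)
  obtain S where S: "finite S"
    "\<And>t. t \<in> {0..1} - S \<Longrightarrow> (c has_vector_derivative vector_derivative c (at t)) (at t)"
    using valid_path_has_vector_derivative[OF c(1)] by blast
  obtain e where e: "valid_path e" "path_image e \<subseteq> SL" "pathstart e = h" "pathfinish e = k"
    "(left_invariant_speed e has_integral L') {0..1}"
    using assms(2) by (auto simp: SL2_joined_def)
  obtain S' where S': "finite S'"
    "\<And>t. t \<in> {0..1} - S' \<Longrightarrow> (e has_vector_derivative vector_derivative e (at t)) (at t)"
    using valid_path_has_vector_derivative[OF e(1)] by blast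
  have i1: "((\<lambda>x. 2 * left_invariant_speed c (2 * x)) has_integral L) {0..1/2}"
    and i2: "((\<lambda>x. 2 * left_invariant_speed e (2 * x - 1)) has_integral L') {1/2..1}"
    using has_integral_affinity01[OF c(5), where m = 2 and c = 0, THEN has_integral_cmul[where c = 2]]
      has_integral_affinity01[OF e(5), where m = 2 and c = "-1", THEN has_integral_cmul[where c = 2]]
    by (simp_all only: image_affinity_atLeastAtMost_div_diff, simp_all)
  have d1: "vector_derivative (c +++ e) (at z) = 2 *\<^sub>R vector_derivative c (at (2 * z))"
    if "0 \<le> z" "z < 1/2" "2 * z \<notin> S" for z
    unfolding joinpaths_def
  proof (rule vector_derivative_at[OF has_vector_derivative_transform_within])
    show "0 < \<bar>z - 1/2\<bar>"
      using that by auto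
    have "((*) 2 has_vector_derivative 2) (at z)"
      by (simp add: has_vector_derivative_def has_derivative_def bounded_linear_mult_left)
    moreover have "(c has_vector_derivative vector_derivative c (at (2 * z))) (at (2 * z))"
      using S(2) that by auto
    ultimately
    show "((\<lambda>x. c (2 * x)) has_vector_derivative 2 *\<^sub>R vector_derivative c (at (2 * z))) (at z)"
      by (intro vector_diff_chain_at[simplified o_def])
  qed (use that in \<open>simp_all add: dist_real_def abs_if split: if_split_asm\<close>)
  have d2: "vector_derivative (c +++ e) (at z) = 2 *\<^sub>R vector_derivative e (at (2 * z - 1))"
    if "1/2 < z" "z \<le> 1" "2 * z - 1 \<notin> S'" for z
    unfolding joinpaths_def
  proof (rule vector_derivative_at[OF has_vector_derivative_transform_within])
    show "0 < \<bar>z - 1/2\<bar>"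
      using that by auto
    have "((\<lambda>x. 2 * x - 1) has_vector_derivative 2) (at z)"
      by (simp add: has_vector_derivative_def has_derivative_def bounded_linear_mult_left)
    moreover have "(e has_vector_derivative vector_derivative e (at (2 * z - 1))) (at (2 * z - 1))"
      using S'(2) that by auto
    ultimately
    show "((\<lambda>x. e (2 * x - 1)) has_vector_derivative 2 *\<^sub>R vector_derivative e (at (2 * z - 1))) (at z)"
      by (intro vector_diff_chain_at[simplified o_def])
  qed (use that in \<open>simp_all add: dist_real_def abs_if split: if_split_asm\<close>)
  have j: "(c +++ e) x = (if x \<le> 1/2 then c (2 * x) else e (2 * x - 1))" for x
    by (simp add: joinpaths_def)
  have "(left_invariant_speed (c +++ e) has_integral L) {0..1/2}"
  proof (rule has_integral_spike_finite[OF _ _ i1])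
    show "finite (insert (1/2) ((*) 2 -` S))"
      using S(1) by (force intro: finite_vimageI[where h = "(*) 2"] inj_onI)
  qed (auto simp: left_invariant_speed_def d1 mm.scaleR_right j)
  moreover have "(left_invariant_speed (c +++ e) has_integral L') {1/2..1}"
  proof (rule has_integral_spike_finite[OF _ _ i2])
    show "finite (insert (1/2) ((\<lambda>x. 2 * x - 1) -` S'))"
      using S'(1) by (force intro: finite_vimageI[where h = "\<lambda>x. 2 * x - 1"] inj_onI)
  qed (auto simp: left_invariant_speed_def d2 mm.scaleR_right j)
  ultimately have "(left_invariant_speed (c +++ e) has_integral L + L') {0..1}"
    by (rule has_integral_combine[rotated 2]) auto
  then show ?thesis
    unfolding SL2_joined_def using c e
    by (intro exI[of _ "c +++ e"]) (auto simp: valid_path_join path_image_join)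
qed

lemma has_vector_derivative_mat2:
  assumes "(a has_real_derivative a') (at t)" "(b has_real_derivative b') (at t)"
    "(c has_real_derivative c') (at t)" "(d has_real_derivative d') (at t)"
  shows "((\<lambda>t. mat2 (a t) (b t) (c t) (d t)) has_vector_derivative mat2 a' b' c' d') (at t)"
proof -
  have *: "mat2 a b c d = a *\<^sub>R mat2 1 0 0 0 + b *\<^sub>R mat2 0 1 0 0 + c *\<^sub>R mat2 0 0 1 0 + d *\<^sub>R mat2 0 0 0 1"
    for a b c d by simp
  show ?thesis
    unfolding *[of "a _"] *[of a']
    by (intro has_vector_derivative_add) (rule has_vector_derivative_scaleR[OF _ has_vector_derivative_const, simplified], rule assms)+
qed

text \<open>Meant for one-parameter subgroups, along which the left-invariant speed is constant and
  equals the length over the unit interval.\<close>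

lemma SL2_joined_smooth:
  assumes "\<And>t. (c has_vector_derivative c' t) (at t)" "continuous_on {0..1} c'"
    "\<And>t. det (c t) = 1" "\<And>t. norm (adj2 (c t) ** c' t) = L"
  shows "SL2_joined (c 0) (c 1) L"
proof -
  have "valid_path c"
    unfolding valid_path_def using assms(1,2)
    by (intro C1_differentiable_imp_piecewise) (auto simp: C1_differentiable_on_def)
  moreover have "left_invariant_speed c t = L" for t
    using assms by (simp add: left_invariant_speed_SL vector_derivative_at[OF assms(1)])
  then have "left_invariant_speed c = (\<lambda>_. L)" by blast
  ultimately show ?thesis
    unfolding SL2_joined_def using assms(3) has_integral_const_real[of L 0 1]
    by (intro exI[of _ c]) (auto simp: pathstart_def pathfinish_def path_image_def)
qed

lemma SL2_joined_upper: "SL2_joined (mat 1) (mat2 1 x 0 1) \<bar>x\<bar>"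
proof -
  have "SL2_joined (mat2 1 (x * 0) 0 1) (mat2 1 (x * 1) 0 1) \<bar>x\<bar>"
    by (rule SL2_joined_smooth[where c' = "\<lambda>_. mat2 0 x 0 0"])
      (auto intro!: has_vector_derivative_mat2 derivative_eq_intros simp: norm_mat2)
  then show ?thesis by (simp add: mat_1_mat2)
qed

lemma SL2_joined_lower: "SL2_joined (mat 1) (mat2 1 0 x 1) \<bar>x\<bar>"
proof -
  have "SL2_joined (mat2 1 0 (x * 0) 1) (mat2 1 0 (x * 1) 1) \<bar>x\<bar>"
    by (rule SL2_joined_smooth[where c' = "\<lambda>_. mat2 0 0 x 0"])
      (auto intro!: has_vector_derivative_mat2 derivative_eq_intros simp: norm_mat2)
  then show ?thesis by (simp add: mat_1_mat2)
qed

text \<open>The one-parameter subgroup generated by \<open>ln a\<close> times diag(1, -1). At a =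
  e^(t/2) the length is |t| / sqrt 2, in accordance with the normalization of the metric.\<close>

lemma SL2_joined_diag:
  assumes "a > 0"
  shows "SL2_joined (mat 1) (mat2 a 0 0 (1/a)) (sqrt (2 * (ln a)\<^sup>2))"
proof -
  define l where "l = ln a"
  have "SL2_joined (mat2 (exp (l * 0)) 0 0 (exp (- l * 0))) (mat2 (exp (l * 1)) 0 0 (exp (- l * 1))) (sqrt (2 * l\<^sup>2))"
    by (rule SL2_joined_smooth[where c' = "\<lambda>t. mat2 (l * exp (l * t)) 0 0 (- l * exp (- l * t))"])
      (auto intro!: has_vector_derivative_mat2 derivative_eq_intros tendsto_mat2 tendsto_intros
        simp: continuous_on_def norm_mat2 exp_minus field_simps power2_eq_square)
  then show ?thesis
    using assms by (simp add: mat_1_mat2 l_def exp_minus inverse_eq_divide)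
qed

text \<open>In place of Gronwall's inequality: the maximal distance \<open>M\<close> of the curve from its starting
  point, translated to \<open>mat 1\<close>, satisfies \<open>M \<le> (M + sqrt 2) L\<close>.\<close>

lemma SL2_joined_near:
  assumes "SL2_joined g h L" "L \<le> 1/2"
  shows "norm (adj2 g ** h - mat 1) \<le> 4 * L"
proof -
  have g: "g \<in> SL" using SL2_joined_SL assms by blast
  have "SL2_joined (mat 1) (adj2 g ** h) L"
    using SL2_joined_left_mult[OF assms(1), of "adj2 g"] g by (simp add: adj2_left)
  then obtain c where c: "valid_path c" "path_image c \<subseteq> SL" "pathstart c = mat 1" "pathfinish c = adj2 g ** h"
    "(left_invariant_speed c has_integral L) {0..1}"
    by (auto simp: SL2_joined_def)
  obtain S where S: "finite S"
    "\<And>t. t \<in> {0..1} - S \<Longrightarrow> (c has_vector_derivative vector_derivative c (at t)) (at t)"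
    using valid_path_has_vector_derivative[OF c(1)] by blast
  have cont: "continuous_on {0..1} c"
    using c(1) valid_path_imp_path path_def by blast
  have SL: "det (c t) = 1" if "t \<in> {0..1}" for t
    using c(2) that unfolding path_image_def by blast
  obtain u where u: "u \<in> {0..1}" "\<And>t. t \<in> {0..1} \<Longrightarrow> norm (c t - mat 1) \<le> norm (c u - mat 1)"
  proof -
    have "continuous_on {0..1} (\<lambda>t. norm (c t - mat 1))"
      by (intro continuous_intros cont)
    from continuous_attains_sup[OF _ _ this] show ?thesis
      using that by auto
  qed
  define M where "M = norm (c u - mat 1)"
  have M: "norm (c t) \<le> M + sqrt 2" if "t \<in> {0..1}" for t
    using u(2)[OF that] norm_triangle_ineq[of "c t - mat 1" "mat 1"] norm_mat_1 by (simp add: M_def)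
  \<comment> \<open>At the exceptional parameters \<open>vector_derivative\<close> is arbitrary; the
    value 0 there lets \<open>bd\<close> hold on the whole interval.\<close>
  define v where "v t = (if t \<in> S then 0 else vector_derivative c (at t))" for t
  have bd: "norm (v t) \<le> (M + sqrt 2) * left_invariant_speed c t" if "t \<in> {0..1}" for t
  proof (cases "t \<in> S")
    case True
    then show ?thesis by (simp add: v_def left_invariant_speed_def M_def)
  next
    case False
    have "norm (v t) = norm (c t ** (adj2 (c t) ** vector_derivative c (at t)))"
      using False SL[OF that] by (simp add: v_def)
    also have "\<dots> \<le> norm (c t) * left_invariant_speed c t"
      unfolding left_invariant_speed_SL[of c t, OF SL[OF that]] by (rule norm_matrix_mult_le)
    also have "\<dots> \<le> (M + sqrt 2) * left_invariant_speed c t"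
      by (intro mult_right_mono M that) (simp add: left_invariant_speed_def)
    finally show ?thesis .
  qed
  have "(v has_integral c u - c 0) {0..u}"
    using u(1) S cont
    by (intro fundamental_theorem_of_calculus_strong[of S]) (auto simp: v_def intro: continuous_on_subset)
  moreover have int: "left_invariant_speed c integrable_on {0..1}"
    using c(5) by blast
  then have int': "left_invariant_speed c integrable_on {0..u}"
    using u(1) by (auto intro: integrable_on_subinterval)
  moreover have "norm (integral {0..u} v) \<le> integral {0..u} (\<lambda>t. (M + sqrt 2) * left_invariant_speed c t)"
    using calculation u(1) bd by (intro integral_norm_bound_integral) (auto intro!: integrable_on_mult_right)
  ultimately have "M \<le> (M + sqrt 2) * integral {0..u} (left_invariant_speed c)"
    using c(3) by (simp add: M_def pathstart_def integral_unique)
  also have "\<dots> \<le> (M + sqrt 2) * L"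
  proof (rule mult_left_mono)
    have "integral {0..u} (left_invariant_speed c) \<le> integral {0..1} (left_invariant_speed c)"
      using u(1) int int' by (intro integral_subset_le) (auto simp: left_invariant_speed_def)
    then show "integral {0..u} (left_invariant_speed c) \<le> L"
      using c(5) by (simp add: integral_unique)
  qed (simp add: M_def)
  finally have "M * (1 - L) \<le> sqrt 2 * L" by (simp add: algebra_simps)
  \<comment> \<open>Absorbing \<open>M * L\<close> on the left costs a factor 2 because L \<le> 1/2,
    and sqrt 2 is rounded up to another 2; hence the constant 4.\<close>
  moreover have "M * (1/2) \<le> M * (1 - L)"
    using assms(2) by (intro mult_left_mono) (auto simp: M_def)
  moreover have "sqrt 2 * L \<le> 2 * L"
    using SL2_joined_nonneg[OF assms(1)] real_le_lsqrt[of 2 2] by (intro mult_right_mono) auto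
  ultimately have "M \<le> 4 * L" by simp
  then show ?thesis
    using u(2)[of 1] c(4) by (simp add: M_def pathfinish_def)
qed

lemma SL2_joined_mult:
  assumes "SL2_joined (mat 1) g L" "SL2_joined (mat 1) h L'"
  shows "SL2_joined (mat 1) (g ** h) (L + L')"
  using SL2_joined_trans[OF assms(1)] SL2_joined_left_mult[OF assms(2), of g] SL2_joined_SL[OF assms(1)]
  by (simp only: matrix_mul_rid)

text \<open>Keeps the infimum in \<open>d_G\<close> from ranging over the empty set. A matrix with
  nonzero lower left entry is a product of an upper, a lower and an upper unipotent matrix, each
  joined to \<open>mat 1\<close> by a one-parameter subgroup.\<close>

lemma SL2_joined_ex:
  assumes "g \<in> SL" "h \<in> SL"
  shows "\<exists>L. SL2_joined g h L"
proof -
  have nz: "\<exists>L. SL2_joined (mat 1) k L" if k: "k \<in> SL" "k$2$1 \<noteq> 0" for k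
  proof -
    obtain a b c d where kk: "k = mat2 a b c d" by (rule mat2_cases)
    have "k = mat2 1 ((a - 1) / c) 0 1 ** mat2 1 0 c 1 ** mat2 1 ((d - 1) / c) 0 1"
      using k by (simp add: kk field_simps)
    then show ?thesis
      using SL2_joined_mult[OF SL2_joined_mult[OF SL2_joined_upper SL2_joined_lower] SL2_joined_upper]
      by metis
  qed
  have one: "\<exists>L. SL2_joined (mat 1) k L" if k: "k \<in> SL" for k
  proof (cases "k$2$1 = 0")
    case True
    obtain a b c d where kk: "k = mat2 a b c d" by (rule mat2_cases)
    \<comment> \<open>A lower unipotent factor moves \<open>d\<close> into the lower left corner,
      and \<open>d\<close> is nonzero since a d = 1.\<close>
    have "k ** mat2 1 0 1 1 \<in> SL" "(k ** mat2 1 0 1 1)$2$1 \<noteq> 0"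
      using k True by (auto simp: kk algebra_simps)
    then obtain L where "SL2_joined (mat 1) (k ** mat2 1 0 1 1) L"
      using nz by blast
    from SL2_joined_mult[OF this SL2_joined_lower[of "-1"]] show ?thesis
      by (auto simp: kk)
  qed (use nz k in blast)
  obtain L where "SL2_joined (mat 1) (adj2 g ** h) L"
    using one[of "adj2 g ** h"] assms by (auto simp: det_mul)
  from SL2_joined_left_mult[OF this assms(1)] show ?thesis
    using assms by auto
qed

text \<open>Converse of \<open>SL2_joined_near\<close>. Near the identity a matrix factors as lower
  unipotent, diagonal, upper unipotent, and the length \<open>f\<close> of the resulting path is
  continuous and vanishes at \<open>mat 1\<close>.\<close>

lemma SL2_joined_close:
  assumes "e > 0"
  obtains r where "r > 0" "\<And>g h. g \<in> SL \<Longrightarrow> h \<in> SL \<Longrightarrow> norm (adj2 g ** h - mat 1) < r \<Longrightarrow>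
     \<exists>L<e. SL2_joined g h L"
proof -
  define f :: "real^2^2 \<Rightarrow> real" where
    "f k = \<bar>k$2$1 / k$1$1\<bar> + sqrt (2 * (ln (k$1$1))\<^sup>2) + \<bar>k$1$2 / k$1$1\<bar>" for k
  have "(f \<longlongrightarrow> f (mat 1)) (at (mat 1))"
    unfolding f_def by (intro tendsto_intros) (auto simp: mat_def)
  then have "isCont f (mat 1)" by (simp add: isCont_def)
  moreover have "f (mat 1) = 0" by (simp add: f_def mat_1_mat2)
  ultimately obtain r where r: "r > 0" "\<And>k. norm (k - mat 1) < r \<Longrightarrow> \<bar>f k\<bar> < e"
    using assms unfolding continuous_at_eps_delta dist_norm by force
  show ?thesis
  \<comment> \<open>The bound 1 keeps the upper left entry positive, as the factorization and the
    logarithm require.\<close>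
  proof (rule that[of "min r 1"])
    fix g h :: "real^2^2" assume gh: "g \<in> SL" "h \<in> SL" "norm (adj2 g ** h - mat 1) < min r 1"
    define k where "k = adj2 g ** h"
    have k: "k \<in> SL" using gh by (simp add: k_def det_mul)
    obtain a b c d where kk: "k = mat2 a b c d" by (rule mat2_cases)
    have "\<bar>a - 1\<bar> < 1"
      using abs_entry_le_norm[of "k - mat 1" 1 1] gh(3) by (simp add: kk mat_1_mat2 flip: k_def)
    then have a: "a > 0" by simp
    have "k = mat2 1 0 (c/a) 1 ** mat2 a 0 0 (1/a) ** mat2 1 (b/a) 0 1"
      using k a by (simp add: kk field_simps)
    then have "SL2_joined (mat 1) k (f k)"
      using SL2_joined_mult[OF SL2_joined_mult[OF SL2_joined_lower SL2_joined_diag[OF a]] SL2_joined_upper, of "c/a" "b/a"]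
      by (simp add: f_def kk)
    from SL2_joined_left_mult[OF this gh(1)] have "SL2_joined g h (f k)"
      using gh(1) by (simp add: k_def)
    moreover have "f k < e"
      using r(2)[of k] gh(3) by (simp add: k_def)
    ultimately show "\<exists>L<e. SL2_joined g h L" by blast
  qed (use r in simp)
qed

section \<open>The group PSL(2,R) and its distance\<close>

lemma carrier_SL2: "carrier SL2 = SL"
  and mult_SL2: "g \<otimes>\<^bsub>SL2\<^esub> h = g ** h"
  by (simp_all add: SL2_def)

lemma group_SL2: "group SL2"
proof (rule groupI)
  fix g assume "g \<in> carrier SL2"
  then show "\<exists>h\<in>carrier SL2. h \<otimes>\<^bsub>SL2\<^esub> g = \<one>\<^bsub>SL2\<^esub>"
    by (intro bexI[of _ "adj2 g"]) (auto simp: SL2_def adj2_left)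
qed (auto simp: SL2_def det_mul matrix_mul_assoc)

lemma matrix_mult_minus:
  fixes A B :: "real^2^2"
  shows "(- A) ** B = - (A ** B)" "A ** (- B) = - (A ** B)"
  by (simp_all add: mm.minus_left mm.minus_right)

lemma det_minus2 [simp]: "det (- A :: real^2^2) = det A"
  by (rule mat2_cases[of A]) simp

lemma adj2_minus [simp]: "adj2 (- A) = - adj2 A"
  by (rule mat2_cases[of A]) simp

lemma normal_pm_E2: "pm_E2 \<lhd> SL2"
proof -
  interpret group SL2 by (rule group_SL2)
  have "subgroup pm_E2 SL2"
  proof (rule subgroupI)
    fix a assume "a \<in> pm_E2"
    moreover have "inv\<^bsub>SL2\<^esub> (mat 1) = mat 1" "inv\<^bsub>SL2\<^esub> (- mat 1) = - mat 1"
      by (rule inv_equality; simp add: SL2_def matrix_mult_minus)+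
    ultimately show "inv\<^bsub>SL2\<^esub> a \<in> pm_E2"
      by (auto simp: pm_E2_def)
  qed (auto simp: pm_E2_def SL2_def matrix_mult_minus)
  then show ?thesis
    unfolding normal_def normal_axioms_def
    by (auto simp: pm_E2_def r_coset_def l_coset_def SL2_def matrix_mult_minus group_SL2[unfolded SL2_def])
qed

lemma psl_class_eq: "psl_class A = {A, - A}"
  by (auto simp: psl_class_def r_coset_def pm_E2_def mult_SL2 matrix_mult_minus)

lemma psl_class_eq_iff: "psl_class A = psl_class B \<longleftrightarrow> B = A \<or> B = - A"
  by (auto simp: psl_class_eq doubleton_eq_iff)

lemma psl_class_minus: "psl_class (- A) = psl_class A"
  by (simp add: psl_class_eq_iff)

lemma carrier_PSL2: "carrier PSL2 = psl_class ` SL"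
  by (auto simp: PSL2_def FactGroup_def RCOSETS_def psl_class_def carrier_SL2)

lemma psl_class_in [simp]: "g \<in> SL \<Longrightarrow> psl_class g \<in> carrier PSL2"
  by (simp add: carrier_PSL2)

lemma mult_PSL2:
  "g \<in> SL \<Longrightarrow> h \<in> SL \<Longrightarrow> psl_class g \<otimes>\<^bsub>PSL2\<^esub> psl_class h = psl_class (g ** h)"
  using normal.rcos_sum[OF normal_pm_E2, of g h] by (simp add: PSL2_def FactGroup_def psl_class_def carrier_SL2 mult_SL2)

lemma one_PSL2: "\<one>\<^bsub>PSL2\<^esub> = psl_class (mat 1)"
  by (simp add: PSL2_def FactGroup_def psl_class_eq pm_E2_def)

lemma group_PSL2: "group PSL2"
  unfolding PSL2_def by (rule normal.factorgroup_is_group[OF normal_pm_E2])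

lemma inv_PSL2: "g \<in> SL \<Longrightarrow> inv\<^bsub>PSL2\<^esub> psl_class g = psl_class (adj2 g)"
  by (rule group.inv_equality[OF group_PSL2]) (auto simp: mult_PSL2 one_PSL2 adj2_left)

text \<open>Multiplying a whole curve by \<open>- mat 1\<close> moves a sign from its start to its
  end, so a single choice of sign remains.\<close>

definition psl_joined :: "real^2^2 \<Rightarrow> real^2^2 \<Rightarrow> real \<Rightarrow> bool" where
  "psl_joined g h L \<longleftrightarrow> SL2_joined g h L \<or> SL2_joined g (- h) L"

lemma SL2_joined_minus: "SL2_joined g h L \<Longrightarrow> SL2_joined (- g) (- h) L"
  using SL2_joined_left_mult[of g h L "- mat 1"] by (simp add: matrix_mult_minus)

lemma d_G_psl_class:
  assumes "g \<in> SL" "h \<in> SL"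
  shows "d_G (psl_class g) (psl_class h) = Inf {L. psl_joined g h L}"
proof -
  have "{left_invariant_length c | c. SL2_curve c \<and> pathstart c \<in> psl_class g \<and> pathfinish c \<in> psl_class h}
      = {L. \<exists>g'\<in>{g, - g}. \<exists>h'\<in>{h, - h}. SL2_joined g' h' L}"
    unfolding SL2_joined_iff_curve psl_class_eq by blast
  also have "\<dots> = {L. psl_joined g h L}"
    using SL2_joined_minus[of "- g"] by (auto simp: psl_joined_def) (metis minus_minus)+
  finally show ?thesis
    using assms by (simp add: d_G_def)
qed

text \<open>Strict inequalities trade the infimum for an actual curve, so that no minimizing curve
  has to exist.\<close>

lemma d_G_less_iff:
  assumes "g \<in> SL" "h \<in> SL"
  shows "d_G (psl_class g) (psl_class h) < e \<longleftrightarrow> (\<exists>L<e. psl_joined g h L)"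
proof -
  have "bdd_below {L. psl_joined g h L}"
    by (intro bdd_belowI[of _ 0]) (auto simp: psl_joined_def dest: SL2_joined_nonneg)
  moreover have "{L. psl_joined g h L} \<noteq> {}"
    using SL2_joined_ex[OF assms] by (auto simp: psl_joined_def)
  ultimately show ?thesis
    unfolding d_G_psl_class[OF assms] by (subst cInf_less_iff) auto
qed

lemma psl_joined_sym: "psl_joined g h L \<Longrightarrow> psl_joined h g L"
  using SL2_joined_sym[of g h L] SL2_joined_minus[OF SL2_joined_sym, of g "- h" L]
  by (auto simp: psl_joined_def)

lemma psl_joined_trans:
  assumes "psl_joined g h L" "psl_joined h k L'"
  shows "psl_joined g k (L + L')"
  using assms SL2_joined_trans[of g h L k L'] SL2_joined_trans[of g h L "- k" L']
    SL2_joined_trans[of g "- h" L k L'] SL2_joined_trans[of g "- h" L "- k" L']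
    SL2_joined_minus[of h k L'] SL2_joined_minus[of h "- k" L']
  by (auto simp: psl_joined_def)

lemma d_G_psl_class_nonneg: "0 \<le> d_G p q"
proof (cases "p \<in> carrier PSL2 \<and> q \<in> carrier PSL2")
  case True
  then obtain g h where gh: "g \<in> SL" "h \<in> SL" "p = psl_class g" "q = psl_class h"
    by (auto simp: carrier_PSL2)
  then show ?thesis
    using d_G_less_iff[of g h 0] SL2_joined_nonneg by (force simp: psl_joined_def not_less[symmetric])
qed (auto simp: d_G_def)

lemma d_G_commute: "d_G p q = d_G q p"
proof (cases "p \<in> carrier PSL2 \<and> q \<in> carrier PSL2")
  case True
  then obtain g h where gh: "g \<in> SL" "h \<in> SL" "p = psl_class g" "q = psl_class h"
    by (auto simp: carrier_PSL2)
  have "{L. psl_joined g h L} = {L. psl_joined h g L}"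
    using psl_joined_sym by blast
  then show ?thesis
    unfolding gh(3,4) d_G_psl_class[OF gh(1,2)] d_G_psl_class[OF gh(2,1)] by (rule arg_cong)
qed (auto simp: d_G_def)

lemma d_G_triangle:
  assumes "p \<in> carrier PSL2" "q \<in> carrier PSL2" "r \<in> carrier PSL2"
  shows "d_G p r \<le> d_G p q + d_G q r"
proof (rule field_le_epsilon)
  fix e :: real assume e: "e > 0"
  obtain g h k where gh: "g \<in> SL" "h \<in> SL" "k \<in> SL" "p = psl_class g" "q = psl_class h" "r = psl_class k"
    using assms by (auto simp: carrier_PSL2)
  obtain L where L: "L < d_G p q + e/2" "psl_joined g h L"
    using d_G_less_iff[of g h "d_G p q + e/2"] gh e by auto
  obtain L' where L': "L' < d_G q r + e/2" "psl_joined h k L'"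
    using d_G_less_iff[of h k "d_G q r + e/2"] gh e by auto
  have "d_G p r < d_G p q + d_G q r + e"
    using d_G_less_iff[of g k] psl_joined_trans[OF L(2) L'(2)] L L' gh by force
  then show "d_G p r \<le> d_G p q + d_G q r + e" by simp
qed

text \<open>Together with \<open>d_G_close\<close> this compares balls of \<open>d_G\<close> with
  left translates of norm balls, up to sign. The metric reaches the dynamics only through these two
  comparisons.\<close>

lemma d_G_near:
  assumes "g \<in> SL" "h \<in> SL" "d_G (psl_class g) (psl_class h) < e" "e \<le> 1/2"
  shows "\<exists>h'\<in>{h, - h}. norm (adj2 g ** h' - mat 1) \<le> 4 * e"
proof -
  obtain L where L: "L < e" "psl_joined g h L"
    using assms d_G_less_iff by blast
  then show ?thesis
    using SL2_joined_near[of g _ L] assms(4) by (force simp: psl_joined_def)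
qed

lemma d_G_close:
  assumes "e > 0"
  obtains r where "r > 0" "\<And>g h. g \<in> SL \<Longrightarrow> h \<in> SL \<Longrightarrow> norm (adj2 g ** h - mat 1) < r \<Longrightarrow>
     d_G (psl_class g) (psl_class h) < e"
  by (rule SL2_joined_close[OF assms]) (metis d_G_less_iff psl_joined_def)

lemma d_G_left_mult:
  assumes "p \<in> carrier PSL2" "q \<in> carrier PSL2" "r \<in> carrier PSL2"
  shows "d_G (r \<otimes>\<^bsub>PSL2\<^esub> p) (r \<otimes>\<^bsub>PSL2\<^esub> q) = d_G p q"
proof -
  obtain g h k where gh: "g \<in> SL" "h \<in> SL" "k \<in> SL" "p = psl_class g" "q = psl_class h" "r = psl_class k"
    using assms by (auto simp: carrier_PSL2)
  have j: "psl_joined (k ** g) (k ** h) L" if "psl_joined g h L" "k \<in> SL" for g h k L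
    using that SL2_joined_left_mult[of g h L k] SL2_joined_left_mult[of g "- h" L k]
    unfolding psl_joined_def matrix_mult_minus by blast
  have "{L. psl_joined (k ** g) (k ** h) L} = {L. psl_joined g h L}"
    using j[of g h _ k] j[of "k ** g" "k ** h" _ "adj2 k"] gh(3) by auto
  then show ?thesis
    using gh by (simp add: mult_PSL2 d_G_psl_class det_mul)
qed

lemma d_G_eq_0_iff:
  assumes "p \<in> carrier PSL2" "q \<in> carrier PSL2"
  shows "d_G p q = 0 \<longleftrightarrow> p = q"
proof -
  obtain g h where gh: "g \<in> SL" "h \<in> SL" "p = psl_class g" "q = psl_class h"
    using assms by (auto simp: carrier_PSL2)
  have "d_G p p = 0"
  proof -
    have "d_G p p \<le> e" if "e > 0" for e
    proof (rule d_G_close[OF that])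
      fix r :: real assume "r > 0"
        "\<And>g h. g \<in> SL \<Longrightarrow> h \<in> SL \<Longrightarrow> norm (adj2 g ** h - mat 1) < r \<Longrightarrow> d_G (psl_class g) (psl_class h) < e"
      from this(2)[of g g] this(1) show "d_G p p \<le> e" using gh by (simp add: adj2_left)
    qed
    then show ?thesis
      using d_G_psl_class_nonneg[of p p] by (meson dense_ge dual_order.antisym)
  qed
  moreover have "p = q" if "d_G p q = 0"
  proof (rule ccontr)
    assume "p \<noteq> q"
    then have "adj2 g ** h \<noteq> mat 1" "adj2 g ** (- h) \<noteq> mat 1"
      using gh adj2_eqD[of g h] adj2_eqD[of g "- h"] by (auto simp: psl_class_minus)
    \<comment> \<open>Both signs of \<open>h\<close> have to be excluded; dividing by 8 puts 4 e
      strictly below both norms.\<close>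
    define e where "e = min (1/2) (min (norm (adj2 g ** h - mat 1)) (norm (adj2 g ** (- h) - mat 1)) / 8)"
    have e: "e > 0" "e \<le> 1/2" "e \<le> norm (adj2 g ** h - mat 1) / 8" "e \<le> norm (adj2 g ** (- h) - mat 1) / 8"
      using \<open>adj2 g ** h \<noteq> mat 1\<close> \<open>adj2 g ** (- h) \<noteq> mat 1\<close> by (auto simp: e_def)
    then show False
      using d_G_near[of g h e] gh that by auto
  qed
  ultimately show ?thesis by blast
qed

lemma Metric_space_PSL2: "Metric_space (carrier PSL2) d_G"
  by unfold_locales (auto simp: d_G_psl_class_nonneg d_G_commute d_G_eq_0_iff d_G_triangle)

section \<open>Dynamics of the horocycle flow\<close>

definition unip :: "real \<Rightarrow> real^2^2" where "unip t = mat2 1 t 0 1"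

definition diag :: "real \<Rightarrow> real^2^2" where "diag l = mat2 l 0 0 (1 / l)"

lemma unip_SL [simp]: "unip t \<in> SL" and det_unip [simp]: "det (unip t) = 1"
  by (simp_all add: unip_def)

lemma diag_SL [simp]: "l \<noteq> 0 \<Longrightarrow> diag l \<in> SL" and det_diag [simp]: "l \<noteq> 0 \<Longrightarrow> det (diag l) = 1"
  by (simp_all add: diag_def)

lemma unip_0: "unip 0 = mat 1" and unip_add: "unip s ** unip t = unip (s + t)"
  by (simp_all add: unip_def mat_1_mat2 add.commute)

lemma diag_mult: "l \<noteq> 0 \<Longrightarrow> m \<noteq> 0 \<Longrightarrow> diag l ** diag m = diag (l * m)"
  by (simp add: diag_def)

lemma diag_1: "diag 1 = mat 1"
  by (simp add: diag_def mat_1_mat2)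

text \<open>Diagonal matrices normalize the horocycle subgroup. All rescalings of time by a^2 come
  from here.\<close>

lemma unip_diag: "l \<noteq> 0 \<Longrightarrow> unip t ** diag l = diag l ** unip (t / l\<^sup>2)"
  by (simp add: unip_def diag_def power2_eq_square)

lemma adj2_unip: "adj2 (unip t) = unip (- t)"
  by (simp add: unip_def)

text \<open>An abstract \<open>\<Gamma>\PSL(2,\<real>)\<close>, described through the projection \<open>\<pi>\<close> from \<open>SL(2,\<real>)\<close>, which is only
  relevant on matrices of determinant 1.\<close>

locale homogeneous_space = Metric_space M D for M :: "'a set" and D +
  fixes \<pi> :: "real^2^2 \<Rightarrow> 'a" and R r0 :: real
  assumes lift_bounded: "x \<in> M \<Longrightarrow> \<exists>g\<in>SL. norm g \<le> R \<and> \<pi> g = x"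
    and \<pi>_in: "g \<in> SL \<Longrightarrow> \<pi> g \<in> M"
    and \<pi>_right_mult: "g \<in> SL \<Longrightarrow> h \<in> SL \<Longrightarrow> k \<in> SL \<Longrightarrow> \<pi> g = \<pi> h \<Longrightarrow> \<pi> (g ** k) = \<pi> (h ** k)"
    and \<pi>_near: "g \<in> SL \<Longrightarrow> h \<in> SL \<Longrightarrow> D (\<pi> g) (\<pi> h) < e \<Longrightarrow> e \<le> 1/2 \<Longrightarrow>
       \<exists>h'\<in>SL. \<pi> h' = \<pi> h \<and> norm (adj2 g ** h' - mat 1) \<le> 4 * e"
    and \<pi>_close: "e > 0 \<Longrightarrow> \<exists>r>0. \<forall>g\<in>SL. \<forall>h\<in>SL. norm (adj2 g ** h - mat 1) < r \<longrightarrow> D (\<pi> g) (\<pi> h) < e"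
    and r0_pos: "r0 > 0"
    and \<pi>_inj: "g \<in> SL \<Longrightarrow> h \<in> SL \<Longrightarrow> \<pi> g = \<pi> h \<Longrightarrow> norm (adj2 g ** h - mat 1) < r0 \<Longrightarrow> h = g"
begin

lemma liftE:
  assumes "x \<in> M"
  obtains g where "g \<in> SL" "norm g \<le> R" "x = \<pi> g"
  using lift_bounded[OF assms] by blast

text \<open>Right translation on the quotient. The lift is chosen arbitrarily; by
  \<open>\<pi>_right_mult\<close> the choice does not matter, and \<open>act_\<pi>\<close> is the
  rule actually applied.\<close>

definition act :: "real^2^2 \<Rightarrow> 'a \<Rightarrow> 'a" where
  "act k x = \<pi> ((SOME g. g \<in> SL \<and> \<pi> g = x) ** k)"

lemma act_\<pi>:
  assumes "g \<in> SL" "k \<in> SL"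
  shows "act k (\<pi> g) = \<pi> (g ** k)"
proof -
  have "\<exists>h. h \<in> SL \<and> \<pi> h = \<pi> g"
    using assms by blast
  from someI_ex[OF this] show ?thesis
    unfolding act_def using assms by (intro \<pi>_right_mult) auto
qed

lemma act_in [simp]: "x \<in> M \<Longrightarrow> k \<in> SL \<Longrightarrow> act k x \<in> M"
  by (erule liftE) (simp only: act_\<pi> SL_mult \<pi>_in)

lemma act_mult: "x \<in> M \<Longrightarrow> k \<in> SL \<Longrightarrow> l \<in> SL \<Longrightarrow> act l (act k x) = act (k ** l) x"
  by (erule liftE) (simp only: act_\<pi> SL_mult matrix_mul_assoc)

lemma act_one: "x \<in> M \<Longrightarrow> act (mat 1) x = x"
  by (erule liftE) (simp only: act_\<pi> SL_one matrix_mul_rid)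

definition \<phi> :: "real \<Rightarrow> 'a \<Rightarrow> 'a" where "\<phi> t = act (unip t)"

lemma \<phi>_in [simp]: "x \<in> M \<Longrightarrow> \<phi> t x \<in> M"
  by (simp add: \<phi>_def)

lemma \<phi>_0: "x \<in> M \<Longrightarrow> \<phi> 0 x = x"
  by (simp add: \<phi>_def unip_0 act_one)

lemma \<phi>_add: "x \<in> M \<Longrightarrow> \<phi> (s + t) x = \<phi> s (\<phi> t x)"
  by (simp add: \<phi>_def act_mult unip_add add.commute)

lemma \<phi>_\<pi>: "g \<in> SL \<Longrightarrow> \<phi> t (\<pi> g) = \<pi> (g ** unip t)"
  by (simp add: \<phi>_def act_\<pi>)

lemma act_diag_\<phi>: "x \<in> M \<Longrightarrow> l \<noteq> 0 \<Longrightarrow> act (diag l) (\<phi> t x) = \<phi> (t / l\<^sup>2) (act (diag l) x)"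
  by (simp add: \<phi>_def act_mult unip_diag)

section \<open>Convergence and compactness through lifts\<close>

definition conv :: "(nat \<Rightarrow> 'a) \<Rightarrow> 'a \<Rightarrow> bool" where
  "conv x l \<longleftrightarrow> (\<lambda>n. D (x n) l) \<longlonglongrightarrow> 0"

lemma conv_subseq: "conv x l \<Longrightarrow> strict_mono r \<Longrightarrow> conv (x \<circ> r) l"
  unfolding conv_def using LIMSEQ_subseq_LIMSEQ by (fastforce simp: o_def)

lemma conv_unique:
  assumes "conv x l" "conv x l'" "\<And>n. x n \<in> M" "l \<in> M" "l' \<in> M"
  shows "l = l'"
proof -
  have "(\<lambda>n. D (x n) l + D (x n) l') \<longlonglongrightarrow> 0 + 0"
    using assms(1,2) unfolding conv_def by (rule tendsto_add)
  moreover have "D l l' \<le> D (x n) l + D (x n) l'" for n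
    using triangle[of l "x n" l'] assms by (simp add: commute)
  ultimately have "D l l' \<le> 0"
    by (intro LIMSEQ_le_const[of "\<lambda>n. D (x n) l + D (x n) l'"]) auto
  then show ?thesis
    using assms(4,5) zero[of l l'] nonneg[of l l'] by linarith
qed

lemma limitin_iff_conv:
  assumes "\<And>n. x n \<in> M" "l \<in> M"
  shows "limitin mtopology x l sequentially \<longleftrightarrow> conv x l"
  using assms by (simp add: limitin_metric_dist_null conv_def)

lemma conv_\<pi>:
  assumes "\<And>n. g n \<in> SL" "l \<in> SL" "g \<longlonglongrightarrow> l"
  shows "conv (\<lambda>n. \<pi> (g n)) (\<pi> l)"
  unfolding conv_def
proof (rule LIMSEQ_I)
  fix e :: real assume "e > 0"
  then obtain r where r: "r > 0" "\<And>g h. g \<in> SL \<Longrightarrow> h \<in> SL \<Longrightarrow> norm (adj2 g ** h - mat 1) < r \<Longrightarrow> D (\<pi> g) (\<pi> h) < e"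
    using \<pi>_close by blast
  have "(\<lambda>n. adj2 (g n) ** l) \<longlonglongrightarrow> adj2 l ** l"
    by (intro mm.tendsto tendsto_adj2 assms tendsto_const)
  then have "(\<lambda>n. adj2 (g n) ** l) \<longlonglongrightarrow> mat 1"
    using assms by (simp add: adj2_left)
  from LIMSEQ_D[OF this r(1)] obtain N where "\<And>n. n \<ge> N \<Longrightarrow> norm (adj2 (g n) ** l - mat 1) < r" by blast
  then show "\<exists>N. \<forall>n\<ge>N. norm (D (\<pi> (g n)) (\<pi> l) - 0) < e"
    using r(2) assms by (intro exI[of _ N]) auto
qed

lemma conv_lift:
  assumes "conv x (\<pi> l)" "\<And>n. x n \<in> M" "l \<in> SL"
  obtains g where "\<And>n. g n \<in> SL" "\<And>n. \<pi> (g n) = x n" "g \<longlonglongrightarrow> l"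
proof -
  \<comment> \<open>The summand 1/(n+1) makes the bound on the distance strict, as
    \<open>\<pi>_near\<close> demands. Where \<open>e n\<close> exceeds 1/2 any lift is taken; this
    happens for finitely many \<open>n\<close> only.\<close>
  define e where "e n = D (x n) (\<pi> l) + inverse (real (Suc n))" for n
  have e: "e \<longlonglongrightarrow> 0"
    unfolding e_def using tendsto_add[OF assms(1)[unfolded conv_def] LIMSEQ_inverse_real_of_nat] by simp
  have "\<exists>g\<in>SL. \<pi> g = x n \<and> (e n \<le> 1/2 \<longrightarrow> norm (adj2 l ** g - mat 1) \<le> 4 * e n)" for n
  proof (cases "e n \<le> 1/2")
    case True
    obtain h where h: "h \<in> SL" "x n = \<pi> h" using assms(2) by (rule liftE)
    have "D (\<pi> l) (\<pi> h) < e n"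
      by (simp add: e_def h commute)
    from \<pi>_near[OF assms(3) h(1) this True] show ?thesis by (auto simp: h)
  next
    case False
    then show ?thesis using assms(2)[of n] by (metis liftE)
  qed
  then obtain g where g: "\<And>n. g n \<in> SL" "\<And>n. \<pi> (g n) = x n"
    "\<And>n. e n \<le> 1/2 \<Longrightarrow> norm (adj2 l ** g n - mat 1) \<le> 4 * e n"
    by metis
  have "(\<lambda>n. adj2 l ** g n - mat 1) \<longlonglongrightarrow> 0"
  proof (rule Lim_null_comparison)
    show "\<forall>\<^sub>F n in sequentially. norm (adj2 l ** g n - mat 1) \<le> 4 * e n"
      using order_tendstoD(2)[OF e, of "1/2"] by (auto elim!: eventually_mono intro: g(3))
    show "(\<lambda>n. 4 * e n) \<longlonglongrightarrow> 0"
      using tendsto_mult_left[OF e, of 4] by simp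
  qed
  then have "(\<lambda>n. l ** ((adj2 l ** g n - mat 1) + mat 1)) \<longlonglongrightarrow> l ** (0 + mat 1)"
    by (intro mm.tendsto tendsto_intros)
  then have "g \<longlonglongrightarrow> l" using assms(3) by simp
  then show ?thesis using that g by blast
qed

lemma conv_act:
  assumes "conv x l" "\<And>n. x n \<in> M" "l \<in> M" "\<And>n. k n \<in> SL" "k' \<in> SL" "k \<longlonglongrightarrow> k'"
  shows "conv (\<lambda>n. act (k n) (x n)) (act k' l)"
proof -
  obtain h where h: "h \<in> SL" "l = \<pi> h" using assms(3) by (rule liftE)
  obtain g where g: "\<And>n. g n \<in> SL" "\<And>n. \<pi> (g n) = x n" "g \<longlonglongrightarrow> h"
    using conv_lift[of x h] assms h by auto
  have "conv (\<lambda>n. \<pi> (g n ** k n)) (\<pi> (h ** k'))"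
    by (intro conv_\<pi> mm.tendsto g assms SL_mult h)
  then show ?thesis
    using g h assms by (simp flip: act_\<pi> g(2))
qed

lemma tendsto_unip: "(f \<longlongrightarrow> l) F \<Longrightarrow> ((\<lambda>n. unip (f n)) \<longlongrightarrow> unip l) F"
  unfolding unip_def by (intro tendsto_mat2 tendsto_const)

lemma conv_\<phi>:
  assumes "conv x l" "\<And>n. x n \<in> M" "l \<in> M" "t \<longlonglongrightarrow> t'"
  shows "conv (\<lambda>n. \<phi> (t n) (x n)) (\<phi> t' l)"
  unfolding \<phi>_def by (intro conv_act assms tendsto_unip unip_SL)

text \<open>Compactness of the quotient is always used in this form: lifts of norm at most
  \<open>R\<close> lie in a compact set of matrices, so a subsequence of points has lifts that
  converge.\<close>

lemma compact_lift:
  fixes x :: "nat \<Rightarrow> 'a"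
  assumes "\<And>n. x n \<in> M"
  obtains g l r where "\<And>n. g n \<in> SL" "l \<in> SL" "strict_mono r" "\<And>n. \<pi> (g n) = x (r n)" "g \<longlonglongrightarrow> l"
proof -
  obtain g where g: "\<And>n. g n \<in> SL" "\<And>n. norm (g n) \<le> R" "\<And>n. \<pi> (g n) = x n"
    using lift_bounded[OF assms] by metis
  have "compact (SL \<inter> cball 0 R)"
    by (intro closed_Int_compact SL_closed compact_cball)
  then have "seq_compact (SL \<inter> cball 0 R)"
    by (rule compact_imp_seq_compact)
  moreover have "g n \<in> SL \<inter> cball 0 R" for n
    unfolding Int_iff mem_cball_0 using g(1,2)[of n] by blast
  ultimately obtain l r where l: "l \<in> SL \<inter> cball 0 R" "strict_mono r" "(g \<circ> r) \<longlonglongrightarrow> l"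
    using seq_compactE[of "SL \<inter> cball 0 R" g] by blast
  show ?thesis
    by (rule that[of "g \<circ> r" l r]) (use l g in simp_all)
qed

lemma M_seq_compact:
  fixes x :: "nat \<Rightarrow> 'a"
  assumes "\<And>n. x n \<in> M"
  obtains l r where "l \<in> M" "strict_mono r" "conv (x \<circ> r) l"
proof -
  obtain g l r where g: "\<And>n. g n \<in> SL" "l \<in> SL" "strict_mono r" "\<And>n. \<pi> (g n) = x (r n)" "g \<longlonglongrightarrow> l"
    using compact_lift[of x, OF assms] by blast
  have "conv (\<lambda>n. \<pi> (g n)) (\<pi> l)" using g by (intro conv_\<pi>) auto
  then show ?thesis using g by (intro that[of "\<pi> l" r]) (auto simp: o_def \<pi>_in)
qed

lemma compact_M: "compact_space mtopology"
  unfolding compact_space_sequentially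
proof (intro allI impI)
  fix \<sigma> :: "nat \<Rightarrow> 'a" assume s: "range \<sigma> \<subseteq> M"
  then have \<sigma>: "\<sigma> n \<in> M" for n by blast
  obtain l r where "l \<in> M" "strict_mono r" "conv (\<sigma> \<circ> r) l"
    using M_seq_compact[of \<sigma>, OF \<sigma>] by blast
  then show "\<exists>l r. l \<in> M \<and> strict_mono r \<and> limitin mtopology (\<sigma> \<circ> r) l sequentially"
    using limitin_iff_conv[of "\<sigma> \<circ> r"] \<sigma> by (intro exI[of _ l] exI[of _ r]) auto
qed

lemma \<phi>_continuous:
  assumes "x \<in> M" "e > 0"
  shows "\<exists>d>0. \<forall>s y. y \<in> M \<and> \<bar>s - t\<bar> < d \<and> D x y < d \<longrightarrow> D (\<phi> t x) (\<phi> s y) < e"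
proof (rule ccontr)
  assume "\<not> ?thesis"
  then have "\<exists>s y. y \<in> M \<and> \<bar>s - t\<bar> < d \<and> D x y < d \<and> e \<le> D (\<phi> t x) (\<phi> s y)" if "d > 0" for d
    using that by (meson not_less)
  then have "\<exists>s y. y \<in> M \<and> \<bar>s - t\<bar> < inverse (real (Suc n)) \<and> D x y < inverse (real (Suc n)) \<and> e \<le> D (\<phi> t x) (\<phi> s y)" for n
    by simp
  then obtain s y where y: "\<And>n. y n \<in> M" "\<And>n. \<bar>s n - t\<bar> < inverse (real (Suc n))"
    "\<And>n. D x (y n) < inverse (real (Suc n))" "\<And>n. e \<le> D (\<phi> t x) (\<phi> (s n) (y n))"
    by metis
  have "(\<lambda>n. s n - t) \<longlonglongrightarrow> 0"
    using y(2) by (intro Lim_null_comparison[OF _ LIMSEQ_inverse_real_of_nat]) (auto intro!: always_eventually less_imp_le)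
  then have "s \<longlonglongrightarrow> t" by (simp add: LIM_zero_iff)
  moreover have "conv y x"
    unfolding conv_def using y(3)
    by (intro Lim_null_comparison[OF _ LIMSEQ_inverse_real_of_nat]) (auto intro!: always_eventually less_imp_le simp: commute)
  ultimately have "conv (\<lambda>n. \<phi> (s n) (y n)) (\<phi> t x)"
    by (intro conv_\<phi> y assms)
  then have "e \<le> 0"
    unfolding conv_def by (rule LIMSEQ_le_const) (use y(4) in \<open>auto simp: commute\<close>)
  then show False using assms(2) by simp
qed

lemma continuous_flow_\<phi>: "continuous_flow M D \<phi>"
  unfolding continuous_flow_def
proof (intro conjI ballI allI)
  show "Metric_space M D" ..
  show "continuous_map (prod_topology euclideanreal mtopology) mtopology (\<lambda>(t, x). \<phi> t x)"
    unfolding continuous_map_to_metric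
  proof (intro ballI allI impI)
    fix p and e :: real assume p: "p \<in> topspace (prod_topology euclideanreal mtopology)" and e: "e > 0"
    obtain t x where px: "p = (t, x)" by fastforce
    then have x: "x \<in> M" using p by simp
    obtain d where d: "d > 0" "\<And>s y. y \<in> M \<Longrightarrow> \<bar>s - t\<bar> < d \<Longrightarrow> D x y < d \<Longrightarrow> D (\<phi> t x) (\<phi> s y) < e"
      using \<phi>_continuous[OF x e, of t] by blast
    show "\<exists>U. openin (prod_topology euclideanreal mtopology) U \<and> p \<in> U \<and>
        (\<forall>q\<in>U. (case q of (t, x) \<Rightarrow> \<phi> t x) \<in> mball (case p of (t, x) \<Rightarrow> \<phi> t x) e)"
      using x d by (intro exI[of _ "ball t d \<times> mball x d"])
        (auto simp: px openin_prod_Times_iff dist_real_def abs_minus_commute)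
  qed
qed (simp_all add: \<phi>_0 \<phi>_add)

text \<open>Conjugation by a large diagonal matrix shrinks the upper right entry, so that a nontrivial
  stabilizer of this form would violate the injectivity radius \<open>r0\<close>.\<close>

lemma stabilizer_upper_triangular:
  assumes h: "h \<in> SL" and "a * d = 1" and \<pi>: "\<pi> h = \<pi> (h ** mat2 a v 0 d)"
    and a: "\<bar>a - 1\<bar> < 1/2" "\<bar>a - 1\<bar> < r0/8"
  shows "a = 1" "v = 0"
proof -
  \<comment> \<open>Chosen so that conjugation by \<open>diag l\<close> brings the upper right entry
    below r0/4; the summand 1 keeps \<open>l\<close> positive when \<open>v = 0\<close>.\<close>
  define l where "l = sqrt (4 * \<bar>v\<bar> / r0 + 1)"
  have "4 * \<bar>v\<bar> / r0 + 1 > 0" using r0_pos by (simp add: add_nonneg_pos)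
  then have l: "l > 0" "l\<^sup>2 = 4 * \<bar>v\<bar> / r0 + 1"
    by (simp_all add: l_def)
  have "a > 0" using a by linarith
  then have d: "d = 1 / a" using assms(2) by (simp add: field_simps)
  define p where "p = mat2 a v 0 d"
  have p: "p \<in> SL" using assms(2) by (simp add: p_def)
  have conj: "adj2 (h ** diag l) ** (h ** p ** diag l) = mat2 a (v / l\<^sup>2) 0 d"
  proof -
    have "adj2 (h ** diag l) ** (h ** p ** diag l) = adj2 (diag l) ** (p ** diag l)"
      using h by (simp add: adj2_mult matrix_mul_assoc[symmetric])
    also have "\<dots> = mat2 a (v / l\<^sup>2) 0 d"
      using l(1) by (simp add: p_def diag_def power2_eq_square)
    finally show ?thesis .
  qed
  have "\<bar>v / l\<^sup>2\<bar> \<le> r0 / 4"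
  proof -
    have "\<bar>v\<bar> \<le> (r0 / 4) * l\<^sup>2"
      using r0_pos by (simp add: l(2) field_simps)
    then show ?thesis using l(1) by (simp add: abs_divide divide_le_eq)
  qed
  moreover have "\<bar>d - 1\<bar> \<le> 2 * \<bar>a - 1\<bar>"
  proof -
    have "d - 1 = (1 - a) / a" using \<open>a > 0\<close> by (simp add: d field_simps)
    then have "\<bar>d - 1\<bar> = \<bar>a - 1\<bar> / a" using \<open>a > 0\<close> by (simp add: abs_divide abs_minus_commute)
    also have "\<dots> \<le> \<bar>a - 1\<bar> / (1/2)" using a(1) \<open>a > 0\<close> by (intro divide_left_mono) (linarith | simp)+
    finally show ?thesis by simp
  qed
  ultimately have "\<bar>a - 1\<bar> + \<bar>v / l\<^sup>2\<bar> + \<bar>d - 1\<bar> \<le> \<bar>a - 1\<bar> + r0 / 4 + 2 * \<bar>a - 1\<bar>"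
    by (intro add_mono order_refl)
  also have "\<dots> < r0"
    using mult_strict_left_mono[OF a(2), of 8] r0_pos by simp
  finally have "\<bar>a - 1\<bar> + \<bar>v / l\<^sup>2\<bar> + \<bar>d - 1\<bar> < r0" .
  moreover have "norm (mat2 a (v / l\<^sup>2) 0 d - mat 1) \<le> \<bar>a - 1\<bar> + \<bar>v / l\<^sup>2\<bar> + \<bar>d - 1\<bar>"
    using norm_mat2_le[of "a - 1" "v / l\<^sup>2" 0 "d - 1"] by (simp add: mat_1_mat2)
  ultimately have "norm (adj2 (h ** diag l) ** (h ** p ** diag l) - mat 1) < r0"
    by (simp add: conj)
  moreover have "\<pi> (h ** diag l) = \<pi> (h ** p ** diag l)"
    using h p \<pi> l(1) by (intro \<pi>_right_mult) (auto simp: p_def det_mul)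
  ultimately have "h ** p ** diag l = h ** diag l"
    using h p l(1) by (intro \<pi>_inj) (auto simp: det_mul)
  then have "mat2 a (v / l\<^sup>2) 0 d = mat 1"
    using conj l(1) h adj2_left[of "h ** diag l"] by (simp add: det_mul)
  then show "a = 1" "v = 0"
    using l(1) by (auto simp: mat_1_mat2)
qed

text \<open>The case a = 1 of the stabilizer lemma: there are no periodic horocycles. This is what
  makes the clocks of a time change unique.\<close>

lemma \<phi>_aperiodic:
  assumes "x \<in> M" "\<phi> s x = \<phi> t x"
  shows "s = t"
proof -
  obtain h where h: "h \<in> SL" "x = \<pi> h" using assms(1) by (rule liftE)
  have "\<phi> (- t + s) x = \<phi> (- t + t) x"
    using assms by (simp only: \<phi>_add)
  then have "\<pi> h = \<pi> (h ** mat2 1 (s - t) 0 1)"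
    using h by (simp add: \<phi>_\<pi> unip_0) (simp add: unip_def)
  from stabilizer_upper_triangular(2)[OF h(1) _ this] show ?thesis
    using r0_pos by simp
qed

text \<open>Lifts of the points at integer times subconverge, so consecutive terms are ever closer
  to each other. If their displacement \<open>g n\<close> had lower left entry 0, flowing back by
  the return time \<open>u\<close> would give an upper triangular stabilizer; then a = 1 and b = u,
  which is too large.\<close>

lemma horocycle_returns:
  assumes "y \<in> M"
  obtains k g s t where "\<And>n. k n \<in> SL" "\<And>n. g n \<in> SL" "\<And>n. \<pi> (k n) = \<phi> (s n) y"
    "\<And>n. \<pi> (k n ** g n) = \<phi> (t n) y" "g \<longlonglongrightarrow> mat 1" "\<And>n::nat. g n $ 2 $ 1 \<noteq> 0"
proof -
  have yn: "\<phi> (real n) y \<in> M" for n using assms by simp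
  obtain k l r where k: "\<And>n. k n \<in> SL" "l \<in> SL" "strict_mono r" "\<And>n. \<pi> (k n) = \<phi> (real (r n)) y" "k \<longlonglongrightarrow> l"
    using compact_lift[of "\<lambda>n. \<phi> (real n) y", OF yn] by blast
  define g where "g n = adj2 (k n) ** k (Suc n)" for n
  have g: "g n \<in> SL" for n using k by (simp add: g_def det_mul)
  have kg: "k n ** g n = k (Suc n)" for n using k by (simp add: g_def)
  have "(\<lambda>n. adj2 (k n) ** k (Suc n)) \<longlonglongrightarrow> adj2 l ** l"
    by (intro mm.tendsto tendsto_adj2 k LIMSEQ_Suc)
  then have lim: "g \<longlonglongrightarrow> mat 1"
    using k by (simp add: g_def[abs_def] adj2_left)
  \<comment> \<open>The thresholds of \<open>stabilizer_upper_triangular\<close>; the 1/2 also keeps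
    \<open>b\<close> below the return time, which is at least 1.\<close>
  define e where "e = min (1/2) (r0/8)"
  have "e > 0" using r0_pos by (simp add: e_def)
  from LIMSEQ_D[OF lim this] obtain N where N: "\<And>n. n \<ge> N \<Longrightarrow> norm (g n - mat 1) < e" by blast
  have nz: "g n $ 2 $ 1 \<noteq> 0" if "n \<ge> N" for n
  proof
    assume z: "g n $ 2 $ 1 = 0"
    obtain a b c d where gg: "g n = mat2 a b c d" by (rule mat2_cases)
    have c: "c = 0" and ad: "a * d = 1" using z g[of n] by (auto simp: gg)
    have a: "\<bar>a - 1\<bar> < e" and b: "\<bar>b\<bar> < e"
      using abs_entry_le_norm[of "g n - mat 1" 1 1] abs_entry_le_norm[of "g n - mat 1" 1 2] N[OF that]
      by (auto simp: gg mat_1_mat2)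
    define u where "u = real (r (Suc n)) - real (r n)"
    have "r n < r (Suc n)" using k(3) by (simp add: strict_mono_def)
    then have u: "u \<ge> 1" by (simp add: u_def)
    have "\<phi> (- u) (\<pi> (k n ** g n)) = \<phi> (- u + real (r (Suc n))) y"
      by (simp only: kg k(4) \<phi>_add[OF assms])
    also have "\<dots> = \<pi> (k n)"
      by (simp add: u_def k(4))
    finally have "\<pi> (k n) = \<pi> (k n ** g n ** unip (- u))"
      using k g by (simp add: \<phi>_\<pi> det_mul)
    also have "k n ** g n ** unip (- u) = k n ** mat2 a (b - a * u) 0 d"
      by (simp add: gg c unip_def matrix_mul_assoc[symmetric])
    finally have "\<pi> (k n) = \<pi> (k n ** mat2 a (b - a * u) 0 d)" .
    from stabilizer_upper_triangular[OF k(1) ad this] a have "a = 1" "b = a * u"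
      by (auto simp: e_def)
    then show False using b u by (simp add: e_def)
  qed
  show ?thesis
  proof (rule that[of "\<lambda>n. k (n + N)" "\<lambda>n. g (n + N)" "\<lambda>n. real (r (n + N))" "\<lambda>n. real (r (Suc (n + N)))"])
    show "(\<lambda>n. g (n + N)) \<longlonglongrightarrow> mat 1" using lim by (rule LIMSEQ_ignore_initial_segment)
  qed (use k g nz kg in auto)
qed

section \<open>Minimal sets and their invariance under the diagonal group\<close>

definition seq_closed :: "'a set \<Rightarrow> bool" where
  "seq_closed Y \<longleftrightarrow> Y \<subseteq> M \<and> (\<forall>x l. (\<forall>n. x n \<in> Y) \<longrightarrow> l \<in> M \<longrightarrow> conv x l \<longrightarrow> l \<in> Y)"

lemma seq_closedD: "seq_closed Y \<Longrightarrow> (\<And>n. x n \<in> Y) \<Longrightarrow> l \<in> M \<Longrightarrow> conv x l \<Longrightarrow> l \<in> Y"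
  by (auto simp: seq_closed_def)

text \<open>Bridges two languages: limits are handled by sequences, whereas Zorn's lemma and finite
  intersections are handled by open and closed sets.\<close>

lemma closedin_iff_seq_closed: "closedin mtopology Y \<longleftrightarrow> seq_closed Y"
proof
  assume *: "closedin mtopology Y"
  then have "Y \<subseteq> M" using closedin_subset by fastforce
  show "seq_closed Y"
    unfolding seq_closed_def
  proof (intro conjI allI impI)
    fix x l assume x: "\<forall>n. x n \<in> Y" "l \<in> M" "conv x l"
    have "x n \<in> M" for n using x(1) \<open>Y \<subseteq> M\<close> by blast
    then have "limitin mtopology x l sequentially"
      using limitin_iff_conv[of x l] x(2,3) by blast
    moreover have "range x \<subseteq> Y" using x(1) by blast
    ultimately show "l \<in> Y"
      using * unfolding metric_closedin_iff_sequentially_closed by blast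
  qed fact
next
  assume *: "seq_closed Y"
  then have "Y \<subseteq> M" by (simp add: seq_closed_def)
  show "closedin mtopology Y"
    unfolding metric_closedin_iff_sequentially_closed
  proof (intro conjI allI impI)
    fix \<sigma> l assume s: "range \<sigma> \<subseteq> Y \<and> limitin mtopology \<sigma> l sequentially"
    then have "l \<in> M" using limitin_topspace by fastforce
    moreover have \<sigma>: "\<sigma> n \<in> Y" for n using s by blast
    moreover have "\<sigma> n \<in> M" for n using \<sigma> \<open>Y \<subseteq> M\<close> by blast
    ultimately show "l \<in> Y"
      using limitin_iff_conv[of \<sigma> l] s seq_closedD[OF *, of \<sigma> l] by blast
  qed fact
qed

text \<open>Between nearby points on a common horocycle the transverse displacement grows polynomially, so
  suitably rescaled returns converge to a prescribed element of the diagonal group.\<close>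

lemma returns_along_diag:
  assumes Y: "seq_closed Y" "y \<in> Y" "\<And>t x. x \<in> Y \<Longrightarrow> \<phi> t x \<in> Y" and "\<mu> > 0"
  obtains z where "z \<in> Y" "act (diag (1 / \<mu>)) z \<in> Y"
proof -
  have YM: "Y \<subseteq> M" using Y by (simp add: seq_closed_def)
  then have "y \<in> M" using Y by blast
  obtain k g s t where k: "\<And>n. k n \<in> SL" "\<And>n. g n \<in> SL" "\<And>n. \<pi> (k n) = \<phi> (s n) y"
    "\<And>n. \<pi> (k n ** g n) = \<phi> (t n) y" "g \<longlonglongrightarrow> mat 1" "\<And>n::nat. g n $ 2 $ 1 \<noteq> 0"
    using horocycle_returns[OF \<open>y \<in> M\<close>] by blast
  \<comment> \<open>\<open>u n\<close> is the time at which the lower right entry of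
    \<open>g n ** unip (u n)\<close> equals \<open>\<mu>\<close>; factoring out
    \<open>unip (v n)\<close> on the left then clears the upper right entry. The lower left entry is
    unchanged and tends to 0, so \<open>q n\<close> tends to \<open>diag (1 / \<mu>)\<close>. These
    times may be large and of either sign, hence the invariance of \<open>Y\<close> under all
    times.\<close>
  define u where "u n = (\<mu> - g n $ 2 $ 2) / g n $ 2 $ 1" for n
  define v where "v n = (u n * g n $ 1 $ 1 + g n $ 1 $ 2) / \<mu>" for n
  define q where "q n = mat2 (1 / \<mu>) 0 (g n $ 2 $ 1) \<mu>" for n
  have q: "unip (v n) ** q n = g n ** unip (u n)" for n
  proof -
    obtain a b c d where gg: "g n = mat2 a b c d" by (rule mat2_cases)
    have 1: "a * d - b * c = 1" "c \<noteq> 0" using k(2,6)[of n] by (auto simp: gg)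
    have uc: "u n * c = \<mu> - d" using 1 by (simp add: u_def gg)
    have vm: "v n * \<mu> = u n * a + b" using \<open>\<mu> > 0\<close> by (simp add: v_def gg)
    have "(1 / \<mu> + v n * c) * \<mu> = 1 + (v n * \<mu>) * c"
      using \<open>\<mu> > 0\<close> by (simp add: algebra_simps)
    also have "\<dots> = 1 + (u n * a + b) * c" by (simp only: vm)
    also have "\<dots> = 1 + a * (u n * c) + b * c" by (simp add: algebra_simps)
    also have "\<dots> = 1 + a * (\<mu> - d) + b * c" by (simp only: uc)
    also have "\<dots> = a * \<mu>" using 1(1) by (simp add: algebra_simps)
    finally have "1 / \<mu> + v n * c = a" using \<open>\<mu> > 0\<close> by simp
    then show ?thesis
      using uc vm by (simp add: q_def gg unip_def algebra_simps)
  qed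
  have qSL: "q n \<in> SL" for n using \<open>\<mu> > 0\<close> by (simp add: q_def)
  have xY: "\<pi> (k n ** unip (v n)) \<in> Y" for n
    using k(1) Y(3)[OF Y(3)[OF Y(2)], of "v n" "s n"] by (simp add: k(3)[symmetric] \<phi>_\<pi>)
  have xqY: "\<pi> (k n ** unip (v n) ** q n) \<in> Y" for n
    using k(1,2) Y(3)[OF Y(3)[OF Y(2)], of "u n" "t n"]
    by (simp add: k(4)[symmetric] \<phi>_\<pi> q matrix_mul_assoc[symmetric] det_mul)
  \<comment> \<open>The matrices \<open>k n ** unip (v n)\<close> need not stay bounded. They are
    replaced by convergent lifts \<open>m n\<close> of the same points; \<open>q (r n)\<close> acts
    on the right, so the relation between the two sequences of points survives.\<close>
  have "\<pi> (k n ** unip (v n)) \<in> M" for n using xY YM by blast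
  from compact_lift[of "\<lambda>n. \<pi> (k n ** unip (v n))", OF this]
  obtain m l r where m: "\<And>n. m n \<in> SL" "l \<in> SL" "strict_mono r"
    "\<And>n. \<pi> (m n) = \<pi> (k (r n) ** unip (v (r n)))" "m \<longlonglongrightarrow> l"
    by blast
  have "conv (\<lambda>n. \<pi> (m n)) (\<pi> l)"
    using conv_\<pi>[of m l] m(1,2,5) by blast
  moreover have "\<pi> (m n) \<in> Y" for n
    unfolding m(4) by (rule xY)
  ultimately have l: "\<pi> l \<in> Y"
    using seq_closedD[OF Y(1), of "\<lambda>n. \<pi> (m n)" "\<pi> l"] \<pi>_in[OF m(2)] by blast
  have "(\<lambda>n. g (r n)) \<longlonglongrightarrow> mat 1"
    using LIMSEQ_subseq_LIMSEQ[OF k(5) m(3)] by (simp add: o_def)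
  from tendsto_entry[OF this, of 2 1] have "(\<lambda>n. g (r n) $ 2 $ 1) \<longlonglongrightarrow> 0"
    by (simp add: mat_def)
  then have "(\<lambda>n. q (r n)) \<longlonglongrightarrow> mat2 (1 / \<mu>) 0 0 \<mu>"
    unfolding q_def by (intro tendsto_mat2 tendsto_const)
  then have "(\<lambda>n. q (r n)) \<longlonglongrightarrow> diag (1 / \<mu>)"
    by (simp add: diag_def)
  moreover have d: "diag (1 / \<mu>) \<in> SL" using \<open>\<mu> > 0\<close> by simp
  moreover have "(\<lambda>n. m n ** q (r n)) \<longlonglongrightarrow> l ** diag (1 / \<mu>)"
    by (rule mm.tendsto[OF m(5) calculation(1)])
  moreover have mq: "m n ** q (r n) \<in> SL" for n
    by (rule SL_mult[OF m(1) qSL])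
  moreover have ld: "l ** diag (1 / \<mu>) \<in> SL"
    by (rule SL_mult[OF m(2) d])
  ultimately have "conv (\<lambda>n. \<pi> (m n ** q (r n))) (\<pi> (l ** diag (1 / \<mu>)))"
    using conv_\<pi>[of "\<lambda>n. m n ** q (r n)" "l ** diag (1 / \<mu>)"] by blast
  moreover have "\<pi> (m n ** q (r n)) \<in> Y" for n
  proof -
    have "\<pi> (m n ** q (r n)) = \<pi> (k (r n) ** unip (v (r n)) ** q (r n))"
      by (rule \<pi>_right_mult[OF m(1) SL_mult[OF k(1) unip_SL] qSL m(4)])
    then show ?thesis using xqY by simp
  qed
  ultimately have "\<pi> (l ** diag (1 / \<mu>)) \<in> Y"
    using seq_closedD[OF Y(1), of "\<lambda>n. \<pi> (m n ** q (r n))" "\<pi> (l ** diag (1 / \<mu>))"] \<pi>_in[OF ld]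
    by blast
  then show ?thesis
    using that l act_\<pi>[OF m(2) d] by simp
qed

text \<open>Only forward times, because shadowing and hence the comparison of clocks is known on
  forward orbits only. Backward invariance is recovered for minimal sets.\<close>

definition closed_forward_invariant :: "'a set \<Rightarrow> bool" where
  "closed_forward_invariant Y \<longleftrightarrow> seq_closed Y \<and> Y \<noteq> {} \<and> (\<forall>t\<ge>0. \<forall>x\<in>Y. \<phi> t x \<in> Y)"

definition minimal_set :: "'a set \<Rightarrow> bool" where
  "minimal_set Y \<longleftrightarrow> closed_forward_invariant Y \<and>
     (\<forall>Y'. closed_forward_invariant Y' \<longrightarrow> Y' \<subseteq> Y \<longrightarrow> Y' = Y)"

text \<open>Zorn's lemma for the complements. The union of a chain of complements is not all of
  \<open>M\<close>: otherwise finitely many members would cover \<open>M\<close> by compactness, the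
  largest of them would be \<open>M\<close>, and its invariant set would be empty.\<close>

lemma minimal_set_exists:
  assumes Z: "closed_forward_invariant Z"
  obtains Y where "minimal_set Y" "Y \<subseteq> Z"
proof -
  define P where "P Y \<longleftrightarrow> closed_forward_invariant Y \<and> Y \<subseteq> Z" for Y
  have PM: "Y \<subseteq> M" "Y \<noteq> {}" if "P Y" for Y
    using that by (auto simp: P_def closed_forward_invariant_def seq_closed_def)
  define \<A> where "\<A> = {M - Y | Y. P Y}"
  have "\<exists>U\<in>\<A>. \<forall>X\<in>\<A>. U \<subseteq> X \<longrightarrow> X = U"
  proof (rule subset_Zorn_nonempty)
    show "\<A> \<noteq> {}" using Z by (auto simp: \<A>_def P_def)
    fix \<C> assume ne: "\<C> \<noteq> {}" and ch: "subset.chain \<A> \<C>"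
    then have sub: "\<C> \<subseteq> \<A>" by (simp add: subset.chain_def)
    define W where "W = M - \<Union>\<C>"
    have W: "\<Union>\<C> = M - W" using sub by (auto simp: W_def \<A>_def)
    have C: "\<exists>Y. P Y \<and> C = M - Y" if "C \<in> \<C>" for C
      using that sub by (auto simp: \<A>_def)
    have op: "openin mtopology C" if "C \<in> \<C>" for C
    proof -
      obtain Y where "P Y" "C = M - Y" using C[OF \<open>C \<in> \<C>\<close>] by (elim exE conjE)
      then show ?thesis
        using closedin_iff_seq_closed[of Y]
        unfolding P_def closed_forward_invariant_def closedin_def topspace_mtopology by blast
    qed
    have "W \<noteq> {}"
    proof
      assume "W = {}"
      then have "topspace mtopology \<subseteq> \<Union>\<C>" using W by simp
      then obtain \<F> where F: "finite \<F>" "\<F> \<subseteq> \<C>" "M \<subseteq> \<Union>\<F>"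
        using compact_M[unfolded compact_space_alt, rule_format, of \<C>] op unfolding topspace_mtopology by blast
      have "M \<noteq> {}" using PM[of Z] Z by (auto simp: P_def)
      then have "\<F> \<noteq> {}" using F by auto
      moreover have "subset.chain \<A> \<F>" 
        unfolding subset_chain_def
      proof (intro conjI ballI)
        show "\<F> \<subseteq> \<A>" using F(2) sub by (rule subset_trans)
        show "X \<subseteq> Y \<or> Y \<subseteq> X" if "X \<in> \<F>" "Y \<in> \<F>" for X Y
          using ch[unfolded subset_chain_def] subsetD[OF F(2) that(1)] subsetD[OF F(2) that(2)] by simp
      qed
      ultimately have "\<Union>\<F> \<in> \<F>" by (rule Union_in_chain[OF F(1)])
      then have "\<Union>\<F> \<in> \<C>" by (rule subsetD[OF F(2)])
      from C[OF this] obtain Y where Y: "P Y" "\<Union>\<F> = M - Y" by (elim exE conjE)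
      show False using F(3) PM[OF Y(1)] unfolding Y(2) by blast
    qed
    moreover have "seq_closed W"
      unfolding closedin_iff_seq_closed[symmetric] W_def
      using closedin_diff[OF closedin_topspace[of mtopology] openin_Union[of \<C> mtopology]] op
      unfolding topspace_mtopology by blast
    moreover have "\<phi> t x \<in> W" if "t \<ge> 0" "x \<in> W" for t x
    proof -
      have "\<phi> t x \<notin> C" if "C \<in> \<C>" for C
      proof -
        obtain Y where Y: "P Y" "C = M - Y" using C[OF \<open>C \<in> \<C>\<close>] by (elim exE conjE)
        then have "x \<in> Y" using \<open>x \<in> W\<close> \<open>C \<in> \<C>\<close> by (auto simp: W_def)
        then show ?thesis
          using Y \<open>t \<ge> 0\<close> by (auto simp: P_def closed_forward_invariant_def)
      qed
      then show ?thesis using \<open>x \<in> W\<close> by (auto simp: W_def)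
    qed
    moreover have "W \<subseteq> Z"
    proof -
      obtain C where "C \<in> \<C>" using ne by blast
      from C[OF this] obtain Y where "P Y" "C = M - Y" by (elim exE conjE)
      then show ?thesis using \<open>C \<in> \<C>\<close> by (auto simp: W_def P_def)
    qed
    ultimately show "\<Union>\<C> \<in> \<A>"
      unfolding W by (auto simp: \<A>_def P_def closed_forward_invariant_def)
  qed
  then obtain Y where Y: "P Y" "\<And>X. P X \<Longrightarrow> M - Y \<subseteq> M - X \<Longrightarrow> M - X = M - Y"
    unfolding \<A>_def by blast
  have "Y' = Y" if "closed_forward_invariant Y'" "Y' \<subseteq> Y" for Y'
  proof -
    have "P Y'" using that Y(1) by (auto simp: P_def)
    then show ?thesis using Y(2)[of Y'] that(2) PM[OF \<open>P Y'\<close>] PM[OF Y(1)] by blast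
  qed
  then show ?thesis
    using that[of Y] Y(1) by (auto simp: minimal_set_def P_def)
qed

text \<open>Preimages of a convergent sequence subconverge inside \<open>Y\<close>, and
  \<open>act k\<close> carries their limit to the given one.\<close>

lemma seq_closed_act:
  assumes Y: "seq_closed Y" and k: "k \<in> SL"
  shows "seq_closed (act k ` Y)"
  unfolding seq_closed_def
proof (intro conjI allI impI)
  have YM: "Y \<subseteq> M" using Y by (simp add: seq_closed_def)
  then show "act k ` Y \<subseteq> M" using k by auto
  fix z l assume z: "\<forall>n. z n \<in> act k ` Y" "l \<in> M" "conv z l"
  then have "\<forall>n. \<exists>u. u \<in> Y \<and> z n = act k u" by blast
  from choice[OF this] obtain y where y: "\<And>n. y n \<in> Y" "\<And>n. z n = act k (y n)"
    by blast
  have yM: "y n \<in> M" for n using y YM by blast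
  obtain l' r where l': "l' \<in> M" "strict_mono r" "conv (y \<circ> r) l'"
    using M_seq_compact[of y, OF yM] by blast
  have "l' \<in> Y"
    using seq_closedD[OF Y _ l'(1,3)] y by simp
  moreover have "conv (\<lambda>n. act k ((y \<circ> r) n)) (act k l')"
    using conv_act[OF l'(3) _ l'(1), of "\<lambda>_. k" k] yM k by simp
  moreover have "conv (z \<circ> r) l"
    by (rule conv_subseq[OF z(3) l'(2)])
  moreover have "z \<circ> r = (\<lambda>n. act k ((y \<circ> r) n))"
    using y by auto
  ultimately have "act k l' = l"
    using conv_unique[of "z \<circ> r" "act k l'" l] yM k l' z(2) by simp
  then show "l \<in> act k ` Y" using \<open>l' \<in> Y\<close> by blast
qed

lemma minimal_setD:
  assumes "minimal_set Y"
  shows "seq_closed Y" "Y \<noteq> {}" "Y \<subseteq> M" "\<And>t x. t \<ge> 0 \<Longrightarrow> x \<in> Y \<Longrightarrow> \<phi> t x \<in> Y"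
    "\<And>Y'. closed_forward_invariant Y' \<Longrightarrow> Y' \<subseteq> Y \<Longrightarrow> Y' = Y"
  using assms by (auto simp: minimal_set_def closed_forward_invariant_def seq_closed_def)

text \<open>For negative \<open>t\<close> the image of \<open>Y\<close> under
  \<open>\<phi> (- t)\<close> is again closed and forward invariant and lies in \<open>Y\<close>.
  Minimality makes it equal to \<open>Y\<close>, so every point of \<open>Y\<close> can be flowed
  back inside \<open>Y\<close>.\<close>

lemma minimal_set_invariant:
  assumes Y: "minimal_set Y" and "x \<in> Y"
  shows "\<phi> t x \<in> Y"
proof (cases "t \<ge> 0")
  case False
  have "closed_forward_invariant (\<phi> (- t) ` Y)"
    unfolding closed_forward_invariant_def
  proof (intro conjI allI impI ballI)
    show "seq_closed (\<phi> (- t) ` Y)"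
      unfolding \<phi>_def by (rule seq_closed_act[OF minimal_setD(1)[OF Y] unip_SL])
    fix s z assume s: "0 \<le> (s::real)" "z \<in> \<phi> (- t) ` Y"
    then obtain y where y: "y \<in> Y" "z = \<phi> (- t) y" by blast
    then have "\<phi> s z = \<phi> (- t) (\<phi> s y)"
      using minimal_setD(3)[OF Y] \<phi>_add[of y s "- t"] \<phi>_add[of y "- t" s] by (simp add: add.commute subset_iff)
    then show "\<phi> s z \<in> \<phi> (- t) ` Y" using minimal_setD(4)[OF Y s(1) y(1)] by blast
  qed (use minimal_setD[OF Y] in auto)
  moreover have "\<phi> (- t) ` Y \<subseteq> Y"
    using minimal_setD(4)[OF Y, of "- t"] False by auto
  ultimately have "\<phi> (- t) ` Y = Y" by (rule minimal_setD(5)[OF Y])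
  then obtain y where y: "y \<in> Y" "x = \<phi> (- t) y" using \<open>x \<in> Y\<close> by blast
  have "y \<in> M" using y minimal_setD(3)[OF Y] by blast
  have "\<phi> t x = \<phi> (t + - t) y" unfolding y(2) by (rule \<phi>_add[OF \<open>y \<in> M\<close>, symmetric])
  then show ?thesis using y(1) \<open>y \<in> M\<close> by (simp add: \<phi>_0)
qed (use minimal_setD(4)[OF Y] assms(2) in blast)

text \<open>\<open>W\<close> is closed, and forward invariant because the diagonal group only
  rescales the time of the flow. \<open>returns_along_diag\<close> makes it nonempty, so minimality
  gives W = Y, which says that the inverse of \<open>diag (1 / l)\<close> maps \<open>Y\<close> into
  itself.\<close>

lemma minimal_set_diag:
  assumes Y: "minimal_set Y" and l: "l > 0" and "x \<in> Y"
  shows "act (diag l) x \<in> Y"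
proof -
  note Y' = minimal_setD[OF Y]
  have d: "diag (1 / l) \<in> SL" "diag l \<in> SL" using l by simp_all
  obtain y where "y \<in> Y" using Y' by blast
  obtain z where z: "z \<in> Y" "act (diag (1 / l)) z \<in> Y"
    using returns_along_diag[OF Y'(1) \<open>y \<in> Y\<close> minimal_set_invariant[OF Y] l] by blast
  define W where "W = Y \<inter> act (diag (1 / l)) ` Y"
  have "seq_closed W"
    unfolding W_def closedin_iff_seq_closed[symmetric]
    by (intro closedin_Int; unfold closedin_iff_seq_closed; intro seq_closed_act Y' d)
  moreover have "\<phi> t w \<in> W" if "t \<ge> 0" "w \<in> W" for t w
  proof -
    obtain y where y: "y \<in> Y" "w = act (diag (1 / l)) y" using \<open>w \<in> W\<close> by (auto simp: W_def)
    have "act (diag (1 / l)) (\<phi> (t / l\<^sup>2) y) = \<phi> t w"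
      using act_diag_\<phi>[of y "1 / l" "t / l\<^sup>2"] y Y'(3) l by (auto simp: power_divide)
    moreover have "\<phi> (t / l\<^sup>2) y \<in> Y" by (rule minimal_set_invariant[OF Y y(1)])
    ultimately have "\<phi> t w \<in> act (diag (1 / l)) ` Y" by (metis imageI)
    moreover have "\<phi> t w \<in> Y" using \<open>w \<in> W\<close> by (intro minimal_set_invariant[OF Y]) (simp add: W_def)
    ultimately show ?thesis by (simp add: W_def)
  qed
  moreover have "W \<noteq> {}" using z by (auto simp: W_def)
  ultimately have "closed_forward_invariant W" by (simp add: closed_forward_invariant_def)
  then have "W = Y" by (rule Y'(5)) (simp add: W_def)
  then obtain y where y: "y \<in> Y" "x = act (diag (1 / l)) y" using \<open>x \<in> Y\<close> by (auto simp: W_def)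
  have yM: "y \<in> M" using y Y'(3) by blast
  have "act (diag l) x = y"
    unfolding y(2) act_mult[OF yM d] using l by (simp add: diag_mult diag_1 act_one[OF yM])
  then show ?thesis using y by simp
qed

end

section \<open>Clocks of a time change\<close>

locale horocycle_time_change = homogeneous_space M D \<pi> R r0
  for M :: "'a set" and D and \<pi> :: "real^2^2 \<Rightarrow> 'a" and R r0 :: real +
  fixes \<psi> :: "real \<Rightarrow> 'a \<Rightarrow> 'a"
  assumes time_change_\<psi>: "time_change M D \<phi> \<psi>"
begin

lemma flow_\<psi>: "continuous_flow M D \<psi>"
  using time_change_\<psi> by (simp add: time_change_def)

lemma \<psi>_in [simp]: "x \<in> M \<Longrightarrow> \<psi> t x \<in> M"
  and \<psi>_0: "x \<in> M \<Longrightarrow> \<psi> 0 x = x"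
  and \<psi>_add: "x \<in> M \<Longrightarrow> \<psi> (s + t) x = \<psi> s (\<psi> t x)"
  using flow_\<psi> by (auto simp: continuous_flow_def)

lemma conv_\<psi>:
  assumes "conv x l" "\<And>n. x n \<in> M" "l \<in> M" "t \<longlonglongrightarrow> t'"
  shows "conv (\<lambda>n. \<psi> (t n) (x n)) (\<psi> t' l)"
proof -
  have "continuous_map (prod_topology euclideanreal mtopology) mtopology (\<lambda>(t, x). \<psi> t x)"
    using flow_\<psi> by (simp add: continuous_flow_def)
  moreover have "limitin (prod_topology euclideanreal mtopology) (\<lambda>n. (t n, x n)) (t', l) sequentially"
    unfolding limitin_pairwise using assms limitin_iff_conv[of x l] by (simp add: o_def)
  ultimately have "limitin mtopology ((\<lambda>(t, x). \<psi> t x) \<circ> (\<lambda>n. (t n, x n))) ((\<lambda>(t, x). \<psi> t x) (t', l)) sequentially"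
    by (rule continuous_map_limit)
  then have "limitin mtopology (\<lambda>n. \<psi> (t n) (x n)) (\<psi> t' l) sequentially"
    by (simp add: o_def)
  then show ?thesis
    using limitin_iff_conv[of "\<lambda>n. \<psi> (t n) (x n)" "\<psi> t' l"] assms(2,3) by simp
qed

definition \<sigma> :: "'a \<Rightarrow> real \<Rightarrow> real" where
  "\<sigma> x = (SOME s. strict_mono s \<and> s 0 = 0 \<and> (\<forall>t. \<psi> t x = \<phi> (s t) x))"

text \<open>The clock: the time \<open>\<psi>\<close> takes to cover the horocycle time
  \<open>u\<close> from \<open>x\<close>. It is a cocycle over the explicit flow
  \<open>\<phi>\<close>, whereas \<open>\<sigma>\<close> is one over \<open>\<psi>\<close>, so
  estimates are made with \<open>\<tau>\<close>.\<close>

definition \<tau> :: "'a \<Rightarrow> real \<Rightarrow> real" where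
  "\<tau> x = inv_into UNIV (\<sigma> x)"

text \<open>Surjectivity is where equality of the orbits as sets enters: aperiodicity turns a common
  point of the orbits into a common time.\<close>

lemma
  assumes x: "x \<in> M"
  shows \<sigma>_mono: "strict_mono (\<sigma> x)" and \<sigma>_0: "\<sigma> x 0 = 0" and \<psi>_eq: "\<psi> t x = \<phi> (\<sigma> x t) x"
    and bij_\<sigma>: "bij (\<sigma> x)"
proof -
  have *: "\<exists>s. strict_mono s \<and> s 0 = 0 \<and> (\<forall>t. \<psi> t x = \<phi> (s t) x)"
    using time_change_\<psi> x unfolding time_change_def by blast
  have s: "strict_mono (\<sigma> x) \<and> \<sigma> x 0 = 0 \<and> (\<forall>t. \<psi> t x = \<phi> (\<sigma> x t) x)"
    unfolding \<sigma>_def by (rule someI_ex[OF *])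
  then show "strict_mono (\<sigma> x)" "\<sigma> x 0 = 0" "\<psi> t x = \<phi> (\<sigma> x t) x" by blast+
  have "surj (\<sigma> x)"
    unfolding surj_def
  proof
    fix u
    have "range (\<lambda>t. \<phi> t x) = range (\<lambda>t. \<psi> t x)"
      using time_change_\<psi> x unfolding time_change_def by blast
    then have "\<phi> u x \<in> range (\<lambda>t. \<psi> t x)" by blast
    then obtain t where "\<phi> u x = \<psi> t x" by blast
    then have "\<phi> u x = \<phi> (\<sigma> x t) x" using s by simp
    then have "u = \<sigma> x t" by (rule \<phi>_aperiodic[OF x])
    then show "\<exists>t. u = \<sigma> x t" by blast
  qed
  moreover have "inj (\<sigma> x)" using s strict_mono_eq unfolding inj_def by blast
  ultimately show "bij (\<sigma> x)" by (simp add: bij_def)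
qed

lemma \<sigma>_\<tau>: "x \<in> M \<Longrightarrow> \<sigma> x (\<tau> x u) = u"
  unfolding \<tau>_def using bij_\<sigma> by (simp add: bij_is_surj surj_f_inv_f)

lemma \<tau>_\<sigma>: "x \<in> M \<Longrightarrow> \<tau> x (\<sigma> x t) = t"
  unfolding \<tau>_def using bij_\<sigma> by (simp add: bij_is_inj)

lemma \<psi>_\<tau>: "x \<in> M \<Longrightarrow> \<psi> (\<tau> x u) x = \<phi> u x"
  by (simp add: \<psi>_eq \<sigma>_\<tau>)

lemma \<tau>_unique: "x \<in> M \<Longrightarrow> \<psi> t x = \<phi> u x \<Longrightarrow> t = \<tau> x u"
  using \<phi>_aperiodic[of x "\<sigma> x t" u] \<tau>_\<sigma>[of x t] by (simp add: \<psi>_eq)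

lemma \<tau>_less_iff: "x \<in> M \<Longrightarrow> \<tau> x u < \<tau> x v \<longleftrightarrow> u < v"
  using strict_mono_less[OF \<sigma>_mono, of x "\<tau> x u" "\<tau> x v"] by (simp add: \<sigma>_\<tau>)

lemma \<tau>_le_iff: "x \<in> M \<Longrightarrow> \<tau> x u \<le> \<tau> x v \<longleftrightarrow> u \<le> v"
  using \<tau>_less_iff[of x v u] by (simp add: not_less[symmetric])

lemma \<tau>_0: "x \<in> M \<Longrightarrow> \<tau> x 0 = 0"
  using \<tau>_\<sigma>[of x 0] by (simp add: \<sigma>_0)

lemma \<tau>_add:
  assumes "x \<in> M"
  shows "\<tau> x (u + v) = \<tau> x u + \<tau> (\<phi> u x) v"
proof -
  have "\<psi> (\<tau> (\<phi> u x) v + \<tau> x u) x = \<psi> (\<tau> (\<phi> u x) v) (\<psi> (\<tau> x u) x)"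
    by (rule \<psi>_add[OF assms])
  also have "\<dots> = \<phi> v (\<phi> u x)"
    using assms by (simp add: \<psi>_\<tau>)
  also have "\<dots> = \<phi> (v + u) x"
    by (rule \<phi>_add[OF assms, symmetric])
  finally have "\<tau> (\<phi> u x) v + \<tau> x u = \<tau> x (v + u)"
    by (rule \<tau>_unique[OF assms])
  then show ?thesis by (simp add: add.commute)
qed

text \<open>A monotone function with open range has no jumps; here the range is the whole
  line.\<close>

lemma continuous_\<sigma>:
  assumes "x \<in> M"
  shows "continuous_on A (\<sigma> x)"
proof -
  have "continuous_on UNIV (\<sigma> x)"
  proof (rule continuous_onI_mono)
    show "open (range (\<sigma> x))" using bij_\<sigma>[OF assms] by (simp add: bij_is_surj)
    show "\<And>s t. s \<le> t \<Longrightarrow> \<sigma> x s \<le> \<sigma> x t"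
      using strict_mono_less_eq[OF \<sigma>_mono[OF assms]] by simp
  qed
  then show ?thesis by (rule continuous_on_subset) simp
qed

lemma bounded_real_subseq:
  fixes u :: "nat \<Rightarrow> real"
  assumes "\<And>n. \<bar>u n\<bar> \<le> K"
  obtains l r where "strict_mono r" "(u \<circ> r) \<longlonglongrightarrow> l"
proof -
  have "seq_compact {- K..K}" by (rule compact_imp_seq_compact) simp
  moreover have "\<forall>n. u n \<in> {- K..K}" using assms by (simp add: abs_le_iff minus_le_iff)
  ultimately show ?thesis using that seq_compactE[of "{- K..K}" u] by blast
qed

text \<open>Suppose the clocks of \<open>x n\<close> at horocycle time \<open>K\<close> are
  unbounded, with \<open>x n\<close> subconverging to \<open>l\<close>. Then any fixed time
  \<open>t\<close> eventually moves these points by a horocycle time in [0, K], and in the limit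
  \<open>\<psi> t l = \<phi> v l\<close> with v \<le> |K|. A \<open>t\<close> beyond the clock of
  \<open>l\<close> at |K| + 1 contradicts this.\<close>

lemma \<tau>_upper_bound: "\<exists>C. \<forall>x\<in>M. \<tau> x K \<le> C"
proof (rule ccontr)
  assume "\<not> ?thesis"
  then have "\<forall>n::nat. \<exists>x. x \<in> M \<and> real n < \<tau> x K" by (meson not_le)
  from choice[OF this] obtain x where x: "\<And>n. x n \<in> M" "\<And>n. real n < \<tau> (x n) K" by blast
  obtain l r where l: "l \<in> M" "strict_mono r" "conv (x \<circ> r) l"
    using M_seq_compact[of x, OF x(1)] by blast
  define t where "t = \<bar>\<tau> l (\<bar>K\<bar> + 1)\<bar>"
  have "t \<ge> 0" by (simp add: t_def)
  obtain N :: nat where N: "t \<le> real N" using real_arch_simple by blast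
  define y where "y n = x (r (n + N))" for n
  have y: "y n \<in> M" for n by (simp add: y_def x)
  have yl: "conv y l"
  proof -
    have "strict_mono (\<lambda>n. n + N)" by (simp add: strict_mono_def)
    from conv_subseq[OF l(3) this] show ?thesis by (simp add: o_def y_def[abs_def])
  qed
  have "\<bar>\<sigma> (y n) t\<bar> \<le> \<bar>K\<bar>" for n
  proof -
    have "N \<le> r (n + N)" using seq_suble[OF l(2), of "n + N"] by simp
    then have "t \<le> real (r (n + N))" using N by simp
    then have "t \<le> \<tau> (y n) K" using x(2)[of "r (n + N)"] by (simp add: y_def)
    then have "\<sigma> (y n) t \<le> K"
      using strict_mono_less_eq[OF \<sigma>_mono[OF y[of n]], of t "\<tau> (y n) K"] \<sigma>_\<tau>[OF y[of n]] by simp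
    moreover have "0 \<le> \<sigma> (y n) t"
      using strict_mono_less_eq[OF \<sigma>_mono[OF y[of n]], of 0 t] \<sigma>_0[OF y[of n]] \<open>t \<ge> 0\<close> by simp
    ultimately show ?thesis by simp
  qed
  then obtain v r' where v: "strict_mono r'" "((\<lambda>n. \<sigma> (y n) t) \<circ> r') \<longlonglongrightarrow> v"
    using bounded_real_subseq[of "\<lambda>n. \<sigma> (y n) t" "\<bar>K\<bar>"] by blast
  have "conv (\<lambda>n. \<phi> (((\<lambda>n. \<sigma> (y n) t) \<circ> r') n) ((y \<circ> r') n)) (\<phi> v l)"
    by (rule conv_\<phi>[OF conv_subseq[OF yl v(1)] _ l(1) v(2)]) (simp add: y)
  moreover have "conv (\<lambda>n. \<psi> t ((y \<circ> r') n)) (\<psi> t l)"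
    by (rule conv_\<psi>[OF conv_subseq[OF yl v(1)] _ l(1) tendsto_const]) (simp add: y)
  moreover have "(\<lambda>n. \<phi> (((\<lambda>n. \<sigma> (y n) t) \<circ> r') n) ((y \<circ> r') n)) = (\<lambda>n. \<psi> t ((y \<circ> r') n))"
    by (simp add: \<psi>_eq y)
  ultimately have "\<psi> t l = \<phi> v l"
    using conv_unique[of "\<lambda>n. \<psi> t ((y \<circ> r') n)" "\<psi> t l" "\<phi> v l"] l(1) y by simp
  then have "t = \<tau> l v" by (rule \<tau>_unique[OF l(1)])
  moreover have "v \<le> \<bar>K\<bar>"
  proof (rule LIMSEQ_le_const2[OF v(2)])
    show "\<exists>N. \<forall>n\<ge>N. ((\<lambda>n. \<sigma> (y n) t) \<circ> r') n \<le> \<bar>K\<bar>"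
      using \<open>\<And>n. \<bar>\<sigma> (y n) t\<bar> \<le> \<bar>K\<bar>\<close> by (auto simp: abs_le_iff)
  qed
  ultimately have "t < \<tau> l (\<bar>K\<bar> + 1)" using \<tau>_less_iff[OF l(1)] by simp
  then show False by (simp add: t_def)
qed

lemma \<tau>_bounded:
  obtains C where "\<And>x u. x \<in> M \<Longrightarrow> \<bar>u\<bar> \<le> K \<Longrightarrow> \<bar>\<tau> x u\<bar> \<le> C"
proof -
  obtain C where C: "\<And>x. x \<in> M \<Longrightarrow> \<tau> x K \<le> C"
    using \<tau>_upper_bound[of K] by blast
  have "\<bar>\<tau> x u\<bar> \<le> C" if "x \<in> M" "\<bar>u\<bar> \<le> K" for x u
  proof -
    have "\<tau> x u \<le> \<tau> x K" using that by (simp add: \<tau>_le_iff)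
    moreover have "\<tau> x (- K) \<le> \<tau> x u" using that by (simp add: \<tau>_le_iff)
    \<comment> \<open>The cocycle identity turns a negative time at \<open>x\<close> into a positive
      time at another point, where the uniform upper bound applies.\<close>
    moreover have "\<tau> x (- K + K) = \<tau> x (- K) + \<tau> (\<phi> (- K) x) K" by (rule \<tau>_add[OF that(1)])
    then have "\<tau> x (- K) = - \<tau> (\<phi> (- K) x) K" using \<tau>_0[OF that(1)] by simp
    ultimately show ?thesis using C[OF that(1)] C[OF \<phi>_in[OF that(1)], of "- K"] by linarith
  qed
  then show ?thesis by (rule that)
qed

text \<open>In effect joint continuity of the clock, which the definition of a time change does not
  contain. Boundedness yields a limit \<open>t\<close> of a subsequence; continuity of both flows
  gives \<open>\<psi> t l = \<phi> v l\<close>, and \<open>\<tau>_unique\<close> identifies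
  \<open>t\<close>.\<close>

lemma \<tau>_tendsto_subseq:
  assumes "conv x l" "\<And>n. x n \<in> M" "l \<in> M" "u \<longlonglongrightarrow> v"
  obtains r where "strict_mono r" "(\<lambda>n. \<tau> (x (r n)) (u (r n))) \<longlonglongrightarrow> \<tau> l v"
proof -
  obtain K where K: "\<And>n. \<bar>u n\<bar> \<le> K"
    using convergent_imp_Bseq[OF convergentI[OF assms(4)]] by (auto simp: Bseq_def)
  obtain C where "\<And>x u. x \<in> M \<Longrightarrow> \<bar>u\<bar> \<le> K \<Longrightarrow> \<bar>\<tau> x u\<bar> \<le> C"
    using \<tau>_bounded[of K] by blast
  then have "\<bar>\<tau> (x n) (u n)\<bar> \<le> C" for n using K assms(2) by blast
  then obtain t r where r: "strict_mono r" "((\<lambda>n. \<tau> (x n) (u n)) \<circ> r) \<longlonglongrightarrow> t"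
    using bounded_real_subseq[of "\<lambda>n. \<tau> (x n) (u n)" C] by blast
  have "conv (\<lambda>n. \<psi> (((\<lambda>n. \<tau> (x n) (u n)) \<circ> r) n) ((x \<circ> r) n)) (\<psi> t l)"
    by (rule conv_\<psi>[OF conv_subseq[OF assms(1) r(1)] _ assms(3) r(2)]) (simp add: assms)
  moreover have "conv (\<lambda>n. \<phi> ((u \<circ> r) n) ((x \<circ> r) n)) (\<phi> v l)"
    by (rule conv_\<phi>[OF conv_subseq[OF assms(1) r(1)] _ assms(3) LIMSEQ_subseq_LIMSEQ[OF assms(4) r(1)]])
      (simp add: assms)
  moreover have "(\<lambda>n. \<psi> (((\<lambda>n. \<tau> (x n) (u n)) \<circ> r) n) ((x \<circ> r) n)) = (\<lambda>n. \<phi> ((u \<circ> r) n) ((x \<circ> r) n))"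
    by (simp add: \<psi>_\<tau> assms)
  ultimately have "\<psi> t l = \<phi> v l"
    using conv_unique[of "\<lambda>n. \<phi> ((u \<circ> r) n) ((x \<circ> r) n)" "\<psi> t l" "\<phi> v l"] assms by simp
  then have "t = \<tau> l v" by (rule \<tau>_unique[OF assms(3)])
  then show ?thesis using that[of r] r by (simp add: o_def)
qed

lemma \<tau>_small:
  assumes "e > 0"
  obtains d where "d > 0" "\<And>x u. x \<in> M \<Longrightarrow> \<bar>u\<bar> < d \<Longrightarrow> \<bar>\<tau> x u\<bar> < e"
proof (rule ccontr)
  assume "\<not> thesis"
  then have *: "\<And>d. d > 0 \<Longrightarrow> \<exists>x u. x \<in> M \<and> \<bar>u\<bar> < d \<and> e \<le> \<bar>\<tau> x u\<bar>"
    using that by (meson not_le)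
  have "\<forall>n. \<exists>p. fst p \<in> M \<and> \<bar>snd p\<bar> < inverse (real (Suc n)) \<and> e \<le> \<bar>\<tau> (fst p) (snd p)\<bar>"
    using * by simp
  from choice[OF this] obtain p where
    p: "\<And>n. fst (p n) \<in> M" "\<And>n. \<bar>snd (p n)\<bar> < inverse (real (Suc n))" "\<And>n. e \<le> \<bar>\<tau> (fst (p n)) (snd (p n))\<bar>"
    by blast
  obtain l r where l: "l \<in> M" "strict_mono r" "conv ((\<lambda>n. fst (p n)) \<circ> r) l"
    using M_seq_compact[of "\<lambda>n. fst (p n)", OF p(1)] by blast
  have "(\<lambda>n. snd (p n)) \<longlonglongrightarrow> 0"
    using p(2) by (intro Lim_null_comparison[OF _ LIMSEQ_inverse_real_of_nat]) (auto intro!: always_eventually less_imp_le)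
  from LIMSEQ_subseq_LIMSEQ[OF this l(2)] have u: "((\<lambda>n. snd (p n)) \<circ> r) \<longlonglongrightarrow> 0" .
  have pM: "((\<lambda>n. fst (p n)) \<circ> r) n \<in> M" for n using p(1) by simp
  obtain r' where "strict_mono r'"
    "(\<lambda>n. \<tau> (((\<lambda>n. fst (p n)) \<circ> r) (r' n)) (((\<lambda>n. snd (p n)) \<circ> r) (r' n))) \<longlonglongrightarrow> \<tau> l 0"
    using \<tau>_tendsto_subseq[OF l(3) pM l(1) u] by blast
  then have "(\<lambda>n. \<bar>\<tau> (fst (p (r (r' n)))) (snd (p (r (r' n))))\<bar>) \<longlonglongrightarrow> 0"
    using \<tau>_0[OF l(1)] tendsto_rabs_zero by force
  then have "e \<le> 0"
    by (rule LIMSEQ_le_const) (use p(3) in blast)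
  then show False using assms by simp
qed

lemma \<tau>_1_lower_bound:
  obtains c where "c > 0" "\<And>x. x \<in> M \<Longrightarrow> c \<le> \<tau> x 1"
proof (rule ccontr)
  assume "\<not> thesis"
  then have *: "\<And>d. d > 0 \<Longrightarrow> \<exists>x. x \<in> M \<and> \<tau> x 1 < d"
    using that by (meson not_le)
  have "\<forall>n. \<exists>x. x \<in> M \<and> \<tau> x 1 < inverse (real (Suc n))"
    using * by simp
  from choice[OF this] obtain x where x: "\<And>n. x n \<in> M" "\<And>n. \<tau> (x n) 1 < inverse (real (Suc n))"
    by blast
  obtain l r where l: "l \<in> M" "strict_mono r" "conv (x \<circ> r) l"
    using M_seq_compact[of x, OF x(1)] by blast
  have xM: "(x \<circ> r) n \<in> M" for n using x(1) by simp
  obtain r' where r': "strict_mono r'" "(\<lambda>n. \<tau> ((x \<circ> r) (r' n)) 1) \<longlonglongrightarrow> \<tau> l 1"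
    using \<tau>_tendsto_subseq[OF l(3) xM l(1) tendsto_const] by blast
  have "strict_mono (r \<circ> r')" using l(2) r'(1) by (rule strict_mono_o)
  from LIMSEQ_subseq_LIMSEQ[OF LIMSEQ_inverse_real_of_nat this]
  have "\<tau> l 1 \<le> 0"
    by (rule LIMSEQ_le[OF r'(2)]) (use x(2) in \<open>auto intro: less_imp_le\<close>)
  moreover have "0 < \<tau> l 1" using \<tau>_less_iff[OF l(1), of 0 1] \<tau>_0[OF l(1)] by simp
  ultimately show False by simp
qed

lemma \<tau>_linear_growth:
  obtains c where "c > 0" "\<And>x u. x \<in> M \<Longrightarrow> u \<ge> 0 \<Longrightarrow> c * (u - 1) \<le> \<tau> x u"
proof -
  obtain c where c: "c > 0" "\<And>x. x \<in> M \<Longrightarrow> c \<le> \<tau> x 1"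
    using \<tau>_1_lower_bound by blast
  have n: "c * real n \<le> \<tau> x (real n)" if "x \<in> M" for x n
  proof (induction n)
    case (Suc n)
    have "\<tau> x (real n + 1) = \<tau> x (real n) + \<tau> (\<phi> (real n) x) 1"
      by (rule \<tau>_add[OF that])
    moreover have "c \<le> \<tau> (\<phi> (real n) x) 1" by (rule c(2)[OF \<phi>_in[OF that]])
    ultimately show ?case using Suc by (simp add: algebra_simps)
  qed (simp add: \<tau>_0[OF that])
  have "c * (u - 1) \<le> \<tau> x u" if "x \<in> M" "u \<ge> 0" for x u
  proof -
    \<comment> \<open>Only whole units of horocycle time are counted; the fractional part is the 1
      that is lost in the bound.\<close>
    define k where "k = nat \<lfloor>u\<rfloor>"
    have k: "real k \<le> u" "u - 1 \<le> real k" using that(2) by (auto simp: k_def)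
    have "c * (u - 1) \<le> c * real k" using k c(1) by simp
    also have "\<dots> \<le> \<tau> x (real k)" by (rule n[OF that(1)])
    also have "\<dots> \<le> \<tau> x u" using k by (simp add: \<tau>_le_iff[OF that(1)])
    finally show ?thesis .
  qed
  then show ?thesis by (rule that[OF c(1)])
qed

text \<open>To be applied to the orbit of a point under a diagonal matrix, with \<open>q\<close> the
  ratio of the time scales of two successive horocycles. Starting the iteration from horocycle time
  1 at \<open>x 0\<close> puts it at time \<open>q ^ n\<close> on the horocycle of
  \<open>x n\<close>.\<close>

lemma no_geometric_slowdown:
  fixes x :: "nat \<Rightarrow> 'a"
  assumes x: "\<And>n. x n \<in> M" and "q > 1"
    and le: "\<And>n v. v \<ge> 0 \<Longrightarrow> \<bar>\<tau> (x (Suc n)) (q * v) - \<tau> (x n) v\<bar> \<le> C"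
  shows False
proof -
  obtain c where c: "c > 0" "\<And>x u. x \<in> M \<Longrightarrow> u \<ge> 0 \<Longrightarrow> c * (u - 1) \<le> \<tau> x u"
    using \<tau>_linear_growth by blast
  have up: "\<tau> (x n) (q ^ n) \<le> \<tau> (x 0) 1 + real n * C" for n
  proof (induction n)
    case (Suc n)
    have "\<tau> (x (Suc n)) (q * q ^ n) \<le> \<tau> (x n) (q ^ n) + C"
      using le[of "q ^ n" n] \<open>q > 1\<close> by (simp add: abs_le_iff)
    then show ?case using Suc by (simp add: algebra_simps)
  qed simp
  \<comment> \<open>Division by \<open>q ^ n\<close> turns the two growth rates into limits, with
    the contradiction c \<le> 0.\<close>
  define z where "z = 1 / q"
  have z: "norm z < 1" "\<And>n. q ^ n * z ^ n = 1" "z > 0"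
    using \<open>q > 1\<close> by (auto simp: z_def power_divide)
  have "c * (1 - z ^ n) \<le> \<tau> (x 0) 1 * z ^ n + C * (real n * z ^ n)" for n
  proof -
    have "c * (q ^ n - 1) \<le> \<tau> (x 0) 1 + real n * C"
      using order_trans[OF c(2)[OF x, of "q ^ n" n] up[of n]] \<open>q > 1\<close> by simp
    then have "(c * (q ^ n - 1)) * z ^ n \<le> (\<tau> (x 0) 1 + real n * C) * z ^ n"
      using z(3) by (intro mult_right_mono) auto
    also have "(c * (q ^ n - 1)) * z ^ n = c * (q ^ n * z ^ n - z ^ n)"
      by (simp only: left_diff_distrib right_diff_distrib mult_1_left mult.assoc)
    also have "\<dots> = c * (1 - z ^ n)" by (simp only: z(2))
    finally show ?thesis by (simp add: algebra_simps)
  qed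
  moreover have "(\<lambda>n. c * (1 - z ^ n)) \<longlonglongrightarrow> c * (1 - 0)"
    using z(1) by (intro tendsto_intros LIMSEQ_power_zero)
  moreover have "(\<lambda>n. \<tau> (x 0) 1 * z ^ n + C * (real n * z ^ n)) \<longlonglongrightarrow> \<tau> (x 0) 1 * 0 + C * 0"
    using z(1) powser_times_n_limit_0[of z] by (intro tendsto_intros LIMSEQ_power_zero) simp_all
  ultimately have "c * (1 - 0) \<le> \<tau> (x 0) 1 * 0 + C * 0"
    by (intro LIMSEQ_le) blast+
  then show False using c(1) by simp
qed

lemma no_transverse_synchronization:
  assumes x: "x \<in> M" and a: "a > 0" "a \<noteq> 1"
    and C: "\<And>v. v \<ge> 0 \<Longrightarrow> \<bar>\<tau> (act (diag a) x) (v / a\<^sup>2) - \<tau> x v\<bar> \<le> C"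
  shows False
proof -
  have d: "diag a \<in> SL" using a by simp
  \<comment> \<open>The shift by \<open>u\<close> builds forward invariance into \<open>Z\<close>.
    The constant doubles because a comparison starting at \<open>\<phi> u x\<close> is the
    difference of those from \<open>x\<close> at the horocycle times u + v and u.\<close>
  define Z where "Z = {x \<in> M. \<forall>u\<ge>0. \<forall>v\<ge>0.
    \<bar>\<tau> (act (diag a) (\<phi> u x)) (v / a\<^sup>2) - \<tau> (\<phi> u x) v\<bar> \<le> 2 * C}"
  have "x \<in> Z"
    unfolding Z_def
  proof (intro CollectI conjI allI impI)
    fix u v :: real assume uv: "u \<ge> 0" "v \<ge> 0"
    have "\<tau> (act (diag a) (\<phi> u x)) (v / a\<^sup>2) = \<tau> (act (diag a) x) ((u + v) / a\<^sup>2) - \<tau> (act (diag a) x) (u / a\<^sup>2)"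
      using \<tau>_add[of "act (diag a) x" "u / a\<^sup>2" "v / a\<^sup>2"] a x d
      by (simp add: act_diag_\<phi> add_divide_distrib)
    moreover have "\<tau> (\<phi> u x) v = \<tau> x (u + v) - \<tau> x u"
      using \<tau>_add[OF x, of u v] by simp
    ultimately show "\<bar>\<tau> (act (diag a) (\<phi> u x)) (v / a\<^sup>2) - \<tau> (\<phi> u x) v\<bar> \<le> 2 * C"
      using C[of "u + v"] C[of u] uv unfolding abs_le_iff by linarith
  qed (rule x)
  have "closed_forward_invariant Z"
    unfolding closed_forward_invariant_def
  proof (intro conjI allI impI ballI)
    show "Z \<noteq> {}" using \<open>x \<in> Z\<close> by blast
    show "\<phi> t y \<in> Z" if "t \<ge> 0" "y \<in> Z" for t y
    proof -
      have "y \<in> M" using that by (simp add: Z_def)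
      have "\<phi> u (\<phi> t y) = \<phi> (u + t) y" for u by (rule \<phi>_add[OF \<open>y \<in> M\<close>, symmetric])
      then show ?thesis using that by (simp add: Z_def)
    qed
    show "seq_closed Z"
      unfolding seq_closed_def
    proof (intro conjI allI impI)
      show "Z \<subseteq> M" by (auto simp: Z_def)
      fix y l assume y: "\<forall>n. y n \<in> Z" "l \<in> M" "conv y l"
      have yM: "y n \<in> M" for n using y(1) by (simp add: Z_def)
      have "\<bar>\<tau> (act (diag a) (\<phi> u l)) (v / a\<^sup>2) - \<tau> (\<phi> u l) v\<bar> \<le> 2 * C" if uv: "u \<ge> 0" "v \<ge> 0" for u v
      proof -
        define z where "z n = \<phi> u (y n)" for n
        have zM: "z n \<in> M" for n using yM by (simp add: z_def)
        have z: "conv z (\<phi> u l)"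
          unfolding z_def by (rule conv_\<phi>[OF y(3) yM y(2) tendsto_const])
        \<comment> \<open>Each of the two clocks converges only along a subsequence, so the second
          one is extracted from the first.\<close>
        obtain r where r: "strict_mono r" "(\<lambda>n. \<tau> (z (r n)) v) \<longlonglongrightarrow> \<tau> (\<phi> u l) v"
          using \<tau>_tendsto_subseq[OF z zM \<phi>_in[OF y(2)] tendsto_const[of v]] by blast
        have zr: "conv (z \<circ> r) (\<phi> u l)" by (rule conv_subseq[OF z r(1)])
        have zrM: "(z \<circ> r) n \<in> M" for n using zM by simp
        have "conv (\<lambda>n. act (diag a) ((z \<circ> r) n)) (act (diag a) (\<phi> u l))"
          by (rule conv_act[OF zr zrM \<phi>_in[OF y(2)] d d tendsto_const])
        moreover have "act (diag a) ((z \<circ> r) n) \<in> M" for n by (rule act_in[OF zrM d])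
        moreover have "act (diag a) (\<phi> u l) \<in> M" by (rule act_in[OF \<phi>_in[OF y(2)] d])
        ultimately obtain r' where r': "strict_mono r'"
          "(\<lambda>n. \<tau> (act (diag a) ((z \<circ> r) (r' n))) (v / a\<^sup>2)) \<longlonglongrightarrow> \<tau> (act (diag a) (\<phi> u l)) (v / a\<^sup>2)"
          using \<tau>_tendsto_subseq[of "\<lambda>n. act (diag a) ((z \<circ> r) n)" "act (diag a) (\<phi> u l)" "\<lambda>_. v / a\<^sup>2" "v / a\<^sup>2"]
          by blast
        have "(\<lambda>n. \<tau> (z (r (r' n))) v) \<longlonglongrightarrow> \<tau> (\<phi> u l) v"
          using LIMSEQ_subseq_LIMSEQ[OF r(2) r'(1)] by (simp add: o_def)
        from tendsto_rabs[OF tendsto_diff[OF r'(2) this]] show ?thesis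
        proof (rule LIMSEQ_le_const2)
          have "\<bar>\<tau> (act (diag a) (\<phi> u (y n))) (v / a\<^sup>2) - \<tau> (\<phi> u (y n)) v\<bar> \<le> 2 * C" for n
            using y(1) uv by (simp add: Z_def)
          then show "\<exists>N. \<forall>n\<ge>N. \<bar>\<tau> (act (diag a) ((z \<circ> r) (r' n))) (v / a\<^sup>2) - \<tau> (z (r (r' n))) v\<bar> \<le> 2 * C"
            by (simp add: z_def)
        qed
      qed
      then show "l \<in> Z" using y(2) by (simp add: Z_def)
    qed
  qed
  then obtain Y where Y: "minimal_set Y" "Y \<subseteq> Z" using minimal_set_exists by blast
  obtain p where p: "p \<in> Y" using minimal_setD(2)[OF Y(1)] by blast
  have YM: "y \<in> M" if "y \<in> Y" for y using minimal_setD(3)[OF Y(1)] that by blast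
  have YC: "\<bar>\<tau> (act (diag a) y) (v / a\<^sup>2) - \<tau> y v\<bar> \<le> 2 * C" if "y \<in> Y" "v \<ge> 0" for y v
  proof -
    have "y \<in> Z" using that(1) Y(2) by blast
    then have "\<bar>\<tau> (act (diag a) (\<phi> 0 y)) (v / a\<^sup>2) - \<tau> (\<phi> 0 y) v\<bar> \<le> 2 * C"
      using that(2) by (simp add: Z_def)
    then show ?thesis by (simp add: \<phi>_0[OF YM[OF that(1)]])
  qed
  have it: "((act (diag b)) ^^ n) p \<in> Y" if "b > 0" for b n
    by (induction n) (simp_all add: p minimal_set_diag[OF Y(1) that])
  show False
  \<comment> \<open>The time scale has to be expanded at every step. For a < 1 the translates by
    powers of \<open>diag a\<close> do this with ratio 1/a^2; for a > 1 those by powers of its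
    inverse do, with ratio a^2, and each comparison is read from the later point to the earlier
    one.\<close>
  proof (cases "a < 1")
    case True
    show ?thesis
    proof (rule no_geometric_slowdown[of "\<lambda>n. ((act (diag a)) ^^ n) p" "1 / a\<^sup>2" "2 * C"])
      show "1 < 1 / a\<^sup>2" using a True by (simp add: power_less_one_iff)
      show "\<bar>\<tau> (((act (diag a)) ^^ Suc n) p) (1 / a\<^sup>2 * v) - \<tau> (((act (diag a)) ^^ n) p) v\<bar> \<le> 2 * C"
        if "v \<ge> 0" for n v
        using YC[OF it[OF a(1), of n] that] by simp
    qed (use it[OF a(1)] YM in blast)
  next
    case False
    then have a1: "a > 1" using a by simp
    define b where "b = 1 / a"
    have b: "b > 0" using a by (simp add: b_def)
    have db: "diag b \<in> SL" using b by simp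
    show ?thesis
    proof (rule no_geometric_slowdown[of "\<lambda>n. ((act (diag b)) ^^ n) p" "a\<^sup>2" "2 * C"])
      show "1 < a\<^sup>2" using a1 by simp
      show "\<bar>\<tau> (((act (diag b)) ^^ Suc n) p) (a\<^sup>2 * v) - \<tau> (((act (diag b)) ^^ n) p) v\<bar> \<le> 2 * C"
        if "v \<ge> 0" for n v
      proof -
        have "act (diag a) (((act (diag b)) ^^ Suc n) p) = ((act (diag b)) ^^ n) p"
          using act_mult[OF YM[OF it[OF b, of n]] db d] a act_one[OF YM[OF it[OF b, of n]]]
          by (simp add: diag_mult b_def diag_1)
        then show ?thesis
          using YC[OF it[OF b, of "Suc n"], of "a\<^sup>2 * v"] a that by (simp add: abs_minus_commute)
      qed
    qed (use it[OF b] YM in blast)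
  qed
qed

section \<open>Shadowing pairs and expansivity\<close>

text \<open>At each time \<open>\<pi>_near\<close> provides some lift of \<open>\<psi> t y\<close>
  near \<open>P t\<close>, which need not be the continuation \<open>Q t\<close> of the initial lift
  \<open>h\<close>. As long as f t \<le> 5 d, injectivity of \<open>\<pi>\<close> at small scale
  identifies the two and improves the bound to 4 d. Since \<open>f\<close> is continuous and starts
  below 4 d, it can never cross the forbidden gap between 4 d and 5 d.\<close>

lemma shadowing_lift:
  assumes d: "d > 0" "d \<le> 1/8" "27 * d < r0" and x: "x \<in> M" and y: "y \<in> M"
    and near: "\<And>t. t \<ge> 0 \<Longrightarrow> D (\<psi> t x) (\<psi> t y) < d"
  obtains g h where "g \<in> SL" "h \<in> SL" "x = \<pi> g" "y = \<pi> h"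
    "\<And>t. t \<ge> 0 \<Longrightarrow> norm (adj2 (g ** unip (\<sigma> x t)) ** (h ** unip (\<sigma> y t)) - mat 1) \<le> 4 * d"
proof -
  have d2: "d \<le> 1/2" using d(2) by simp
  obtain g where g: "g \<in> SL" "x = \<pi> g" using x by (rule liftE)
  obtain h0 where h0: "h0 \<in> SL" "y = \<pi> h0" using y by (rule liftE)
  have "D (\<pi> g) (\<pi> h0) < d" using near[of 0] x y g h0 by (simp add: \<psi>_0)
  then obtain h where h: "h \<in> SL" "\<pi> h = \<pi> h0" "norm (adj2 g ** h - mat 1) \<le> 4 * d"
    using \<pi>_near[OF g(1) h0(1) _ d2] by blast
  have hy: "y = \<pi> h" using h h0 by simp
  define P where "P t = g ** unip (\<sigma> x t)" for t
  define Q where "Q t = h ** unip (\<sigma> y t)" for t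
  define f where "f t = norm (adj2 (P t) ** Q t - mat 1)" for t
  have P: "P t \<in> SL" "\<psi> t x = \<pi> (P t)" for t
    unfolding P_def \<psi>_eq[OF x] using \<phi>_\<pi>[OF g(1)] g(2) SL_mult[OF g(1) unip_SL] by simp_all
  have Q: "Q t \<in> SL" "\<psi> t y = \<pi> (Q t)" for t
    unfolding Q_def \<psi>_eq[OF y] using \<phi>_\<pi>[OF h(1)] hy SL_mult[OF h(1) unip_SL] by simp_all
  have step: "f t \<le> 4 * d" if t: "t \<ge> 0" "f t \<le> 5 * d" for t
  proof -
    have "D (\<pi> (P t)) (\<pi> (Q t)) < d" using near[OF t(1)] P(2) Q(2) by simp
    then obtain h' where h': "h' \<in> SL" "\<pi> h' = \<pi> (Q t)" "norm (adj2 (P t) ** h' - mat 1) \<le> 4 * d"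
      using \<pi>_near[OF P(1) Q(1) _ d2] by blast
    define E where "E = adj2 (P t) ** Q t"
    define F where "F = adj2 (P t) ** h'"
    have E: "E \<in> SL" using P(1)[of t] Q(1)[of t] by (simp add: E_def det_mul)
    have E1: "norm (E - mat 1) \<le> 5 * d" using t(2) by (simp add: f_def E_def)
    have F1: "norm (F - mat 1) \<le> 4 * d" using h'(3) by (simp add: F_def)
    have "norm E \<le> norm (E - mat 1) + norm (mat 1 :: real^2^2)"
      using norm_triangle_ineq[of "E - mat 1" "mat 1"] by simp
    also have "\<dots> \<le> 1 + 2"
      using E1 d(2) real_le_lsqrt[of 2 2] by (intro add_mono) (simp_all add: norm_mat_1)
    finally have nE: "norm E \<le> 3" by simp
    have "norm (F - E) \<le> norm (F - mat 1) + norm (E - mat 1)"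
      using norm_triangle_ineq4[of "F - mat 1" "E - mat 1"] by simp
    then have nFE: "norm (F - E) \<le> 9 * d" using E1 F1 by simp
    have "adj2 (Q t) ** h' = adj2 E ** F"
      using P(1)[of t] by (simp add: E_def F_def adj2_mult matrix_mul_assoc[symmetric])
    moreover have "adj2 E ** F - mat 1 = adj2 E ** (F - E)"
      using E by (simp add: mm.diff_right adj2_left)
    ultimately have "norm (adj2 (Q t) ** h' - mat 1) \<le> norm (adj2 E) * norm (F - E)"
      using norm_matrix_mult_le[of "adj2 E" "F - E"] by simp
    also have "\<dots> \<le> 3 * (9 * d)"
      using nE nFE d(1) by (intro mult_mono) auto
    \<comment> \<open>The factor 3 bounds \<open>E\<close>, and 9 d = 4 d + 5 d bounds the distance
      of the two candidates; their product explains the hypothesis 27 d < r0.\<close>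
    finally have "norm (adj2 (Q t) ** h' - mat 1) < r0" using d(3) by simp
    then have "h' = Q t" by (rule \<pi>_inj[OF Q(1) h'(1) h'(2)[symmetric]])
    then show ?thesis using h'(3) by (simp add: f_def)
  qed
  have cont: "continuous_on A f" for A
  proof -
    have u: "continuous_on A (\<lambda>t. unip (\<sigma> z t))" if "z \<in> M" for z
      using continuous_\<sigma>[OF that, of A] unfolding continuous_on_def by (blast intro: tendsto_unip)
    show ?thesis
      unfolding f_def P_def Q_def
      by (intro continuous_on_norm continuous_on_diff mm.continuous_on continuous_on_adj2
          continuous_on_const u x y)
  qed
  have "f t \<le> 4 * d" if "t \<ge> 0" for t
  proof (rule ccontr)
    assume n: "\<not> f t \<le> 4 * d"
    then have 5: "5 * d \<le> f t" using step[OF that] by linarith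
    have "f 0 \<le> 4 * d"
      using h(3) by (simp add: f_def P_def Q_def \<sigma>_0 x y unip_0)
    then have "f 0 \<le> 5 * d" using d(1) by linarith
    from IVT'[OF this 5 that cont] obtain u where "0 \<le> u" "f u = 5 * d" by blast
    then show False using step[of u] d(1) by simp
  qed
  then show ?thesis
    using that[OF g(1) h(1) g(2) hy] by (simp add: f_def P_def Q_def)
qed

lemma positive_kinematic_expansive_\<psi>: "positive_kinematic_expansive M D \<psi>"
  unfolding positive_kinematic_expansive_def
proof (intro conjI allI impI)
  fix \<epsilon> :: real assume "\<epsilon> > 0"
  then obtain d0 where d0: "d0 > 0" "\<And>x u. x \<in> M \<Longrightarrow> \<bar>u\<bar> < d0 \<Longrightarrow> \<bar>\<tau> x u\<bar> < \<epsilon>"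
    using \<tau>_small by blast
  \<comment> \<open>The first two bounds serve \<open>shadowing_lift\<close>. The third makes the
    final displacement, at most 4 d, short enough for the clock to advance by less than
    \<open>\<epsilon>\<close>.\<close>
  define d where "d = min (1/8) (min (r0/28) (d0/8))"
  have d: "d > 0" "d \<le> 1/8" "27 * d < r0" "4 * d < d0"
    using r0_pos d0(1) by (auto simp: d_def min_def)
  show "\<exists>\<delta>>0. \<forall>x\<in>M. \<forall>y\<in>M. (\<forall>t\<in>{0..}. D (\<psi> t x) (\<psi> t y) < \<delta>) \<longrightarrow> (\<exists>\<tau>\<in>{- \<epsilon><..<\<epsilon>}. y = \<psi> \<tau> x)"
  proof (rule exI[of _ d], intro conjI ballI impI)
    fix x y assume x: "x \<in> M" and y: "y \<in> M" and near: "\<forall>t\<in>{0..}. D (\<psi> t x) (\<psi> t y) < d"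
    have near': "D (\<psi> t x) (\<psi> t y) < d" if "t \<ge> 0" for t using near that by simp
    obtain g h where g: "g \<in> SL" "x = \<pi> g" and h: "h \<in> SL" "y = \<pi> h" and
      close: "\<And>t. t \<ge> 0 \<Longrightarrow> norm (adj2 (g ** unip (\<sigma> x t)) ** (h ** unip (\<sigma> y t)) - mat 1) \<le> 4 * d"
      using shadowing_lift[OF d(1-3) x y near'] by blast
    obtain a b c e where m: "adj2 g ** h = mat2 a b c e" by (rule mat2_cases)
    have hm: "h = g ** mat2 a b c e" using g(1) by (simp flip: m)
    have det: "a * e - b * c = 1"
      using g(1) h(1) det_mul[of "adj2 g" h] by (simp add: m)
    \<comment> \<open>The relative position after horocycle times \<open>s\<close> and
      \<open>r\<close>, kept independent since the two clocks are unrelated. The lower right entry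
      involves only \<open>r\<close> and the upper left one only \<open>s\<close>; the upper right
      entry is what ties \<open>r\<close> to \<open>s\<close> once c = 0.\<close>
    have E: "adj2 (g ** unip s) ** (h ** unip r) - mat 1 =
        mat2 (a - s * c - 1) ((a - s * c) * r + (b - s * e)) c (c * r + e - 1)" for s r
    proof -
      have "adj2 (g ** unip s) ** (h ** unip r) = unip (- s) ** (adj2 g ** h) ** unip r"
        by (simp add: adj2_mult adj2_unip matrix_mul_assoc)
      then show ?thesis
        by (simp add: m unip_def mat_1_mat2 algebra_simps)
    qed
    have b12: "\<bar>(a - \<sigma> x t * c) * \<sigma> y t + (b - \<sigma> x t * e)\<bar> \<le> 4 * d"
      and b22: "\<bar>c * \<sigma> y t + e - 1\<bar> \<le> 4 * d"
      and b11: "\<bar>a - \<sigma> x t * c - 1\<bar> \<le> 4 * d" if "t \<ge> 0" for t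
      using order_trans[OF abs_entry_le_norm close[OF that, unfolded E], of 1 2]
        order_trans[OF abs_entry_le_norm close[OF that, unfolded E], of 2 2]
        order_trans[OF abs_entry_le_norm close[OF that, unfolded E], of 1 1]
      by simp_all
    have "c = 0"
    proof (rule ccontr)
      assume c: "c \<noteq> 0"
      \<comment> \<open>The moment at which \<open>y\<close> has moved by 3/|c|, so that
        \<open>c * \<sigma> y t\<close> is 3 in absolute value; the lower right entry can change by
        no more than 8 d \<le> 1.\<close>
      define t where "t = \<tau> y (3 / c * sgn c)"
      have "0 \<le> 3 / c * sgn c" using c by (simp add: sgn_if)
      then have "0 \<le> t" using \<tau>_le_iff[OF y, of 0 "3 / c * sgn c"] \<tau>_0[OF y] by (simp add: t_def)
      then have "\<bar>c * (3 / c * sgn c) + e - 1\<bar> \<le> 4 * d"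
        using b22[of t] \<sigma>_\<tau>[OF y] by (simp add: t_def)
      then have "\<bar>3 * sgn c + e - 1\<bar> \<le> 4 * d" using c by simp
      moreover have "\<bar>e - 1\<bar> \<le> 4 * d" using b22[of 0] \<sigma>_0[OF y] by simp
      ultimately show False using d(2) c by (auto simp: sgn_if split: if_splits)
    qed
    then have ae: "a * e = 1" using det by simp
    have a1: "\<bar>a - 1\<bar> \<le> 4 * d" using b11[of 0] \<sigma>_0[OF x] by simp
    then have a: "a > 0" using d(2) by linarith
    have e: "e = 1 / a" using ae a by (simp add: field_simps)
    have b: "\<bar>b\<bar> \<le> 4 * d" using b12[of 0] \<sigma>_0[OF x] \<sigma>_0[OF y] by simp
    have "a = 1"
    proof (rule ccontr)
      assume "a \<noteq> 1"
      define x' where "x' = act (diag a) x"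
      have da: "diag a \<in> SL" using a by simp
      have x': "x' \<in> M" using x da by (simp add: x'_def)
      \<comment> \<open>An upper triangular matrix splits into a diagonal and a unipotent factor:
        \<open>y\<close> lies on the horocycle orbit of the translate \<open>x'\<close>, so the
        clock of \<open>y\<close> is a shift of that of \<open>x'\<close>.\<close>
      have yx': "y = \<phi> (b / a) x'"
      proof -
        have "mat2 a b c e = diag a ** unip (b / a)"
          using a by (simp add: diag_def unip_def e \<open>c = 0\<close>)
        then have "y = \<pi> (g ** diag a ** unip (b / a))"
          by (simp only: h(2) hm matrix_mul_assoc)
        moreover have "g ** diag a \<in> SL" by (rule SL_mult[OF g(1) da])
        ultimately show ?thesis
          using g da by (simp add: x'_def act_\<pi> \<phi>_\<pi>)
      qed
      obtain C where C: "\<And>x u. x \<in> M \<Longrightarrow> \<bar>u\<bar> \<le> 1 / (2 * a) \<Longrightarrow> \<bar>\<tau> x u\<bar> \<le> C"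
        using \<tau>_bounded[of "1 / (2 * a)"] by blast
      have "\<bar>\<tau> (act (diag a) x) (v / a\<^sup>2) - \<tau> x v\<bar> \<le> \<bar>\<tau> x' (b / a)\<bar> + C" if "v \<ge> 0" for v
      proof -
        define t where "t = \<tau> x v"
        have t: "t \<ge> 0" using \<tau>_le_iff[OF x, of 0 v] \<tau>_0[OF x] that by (simp add: t_def)
        have sx: "\<sigma> x t = v" by (simp add: t_def \<sigma>_\<tau> x)
        define r where "r = \<sigma> y t"
        have r: "\<tau> y r = t" by (simp add: r_def \<tau>_\<sigma> y)
        \<comment> \<open>The horocycle time from \<open>y\<close> to the point of the orbit of
          \<open>x'\<close> at time v/a^2. The bound on the upper right entry says that the time
          \<open>r\<close> actually covered from \<open>y\<close> differs from \<open>w\<close> by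
          at most 1/(2 a), over which clocks are bounded uniformly by \<open>C\<close>.\<close>
        define w where "w = v / a\<^sup>2 - b / a"
        have "(w - r) * a = - (a * r + (b - v * e))"
          using a by (simp add: w_def e field_simps power2_eq_square)
        moreover have "\<bar>a * r + (b - v * e)\<bar> \<le> 1/2"
          using b12[OF t] d(2) by (simp add: sx \<open>c = 0\<close> r_def[symmetric])
        ultimately have "\<bar>(w - r) * a\<bar> \<le> 1/2" by (simp only: abs_minus_cancel)
        then have wr: "\<bar>w - r\<bar> \<le> 1 / (2 * a)"
          using a by (simp add: abs_mult pos_le_divide_eq mult_ac)
        have "\<tau> x' (b / a + w) = \<tau> x' (b / a) + \<tau> y w"
          unfolding yx' by (rule \<tau>_add[OF x'])
        moreover have "\<tau> y (r + (w - r)) = \<tau> y r + \<tau> (\<phi> r y) (w - r)"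
          by (rule \<tau>_add[OF y])
        ultimately have "\<tau> x' (v / a\<^sup>2) - t = \<tau> x' (b / a) + \<tau> (\<phi> r y) (w - r)"
          by (simp add: w_def r)
        then show ?thesis
          using C[OF \<phi>_in[OF y] wr, of r] by (simp add: x'_def t_def)
      qed
      then show False by (rule no_transverse_synchronization[OF x a \<open>a \<noteq> 1\<close>])
    qed
    have "y = \<phi> b x"
    proof -
      have "mat2 a b c e = unip b" by (simp add: unip_def e \<open>c = 0\<close> \<open>a = 1\<close>)
      then show ?thesis unfolding h(2) g(2) hm by (simp only: \<phi>_\<pi>[OF g(1)])
    qed
    also have "\<dots> = \<psi> (\<tau> x b) x" by (simp add: \<psi>_\<tau> x)
    finally have "y = \<psi> (\<tau> x b) x" .
    moreover have "\<bar>\<tau> x b\<bar> < \<epsilon>" using d0(2)[OF x, of b] b d(4) by simp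
    then have "\<tau> x b \<in> {- \<epsilon><..<\<epsilon>}" by (simp add: abs_less_iff)
    ultimately show "\<exists>\<tau>\<in>{- \<epsilon><..<\<epsilon>}. y = \<psi> \<tau> x" by blast
  qed (rule d(1))
qed (rule flow_\<psi> compact_M)+

end

theorem (in homogeneous_space) positive_strong_kinematic_expansive_\<phi>:
  "positive_strong_kinematic_expansive M D \<phi>"
  unfolding positive_strong_kinematic_expansive_def
proof (intro conjI allI impI)
  fix \<psi> assume "time_change M D \<phi> \<psi>"
  then interpret horocycle_time_change M D \<pi> R r0 \<psi>
    by unfold_locales
  show "positive_kinematic_expansive M D \<psi>" by (rule positive_kinematic_expansive_\<psi>)
qed (rule continuous_flow_\<phi>)

section \<open>Time reversal\<close>

text \<open>Flows matter only on \<open>M\<close>. The flows that are identified later are shown to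
  agree there, and nothing is claimed about their values elsewhere.\<close>

lemma continuous_flow_cong:
  assumes "continuous_flow M d \<phi>" and eq: "\<And>t x. x \<in> M \<Longrightarrow> \<phi>' t x = \<phi> t x"
  shows "continuous_flow M d \<phi>'"
proof -
  interpret Metric_space M d using assms(1) by (simp add: continuous_flow_def)
  have "continuous_map (prod_topology euclideanreal mtopology) mtopology (\<lambda>(t, x). \<phi> t x)"
    using assms(1) by (simp add: continuous_flow_def)
  then have "continuous_map (prod_topology euclideanreal mtopology) mtopology (\<lambda>(t, x). \<phi>' t x)"
    by (rule continuous_map_eq) (auto simp: eq)
  then show ?thesis
    using assms(1) by (simp add: continuous_flow_def eq)
qed

lemma continuous_flow_reverse:
  assumes "continuous_flow M d \<phi>"
  shows "continuous_flow M d (\<lambda>t. \<phi> (- t))"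
proof -
  interpret Metric_space M d using assms(1) by (simp add: continuous_flow_def)
  have "continuous_map (prod_topology euclideanreal mtopology) (prod_topology euclideanreal mtopology) (\<lambda>p. (- fst p, snd p))"
    by (intro continuous_map_pairedI continuous_map_minus continuous_map_fst continuous_map_snd)
  moreover have "continuous_map (prod_topology euclideanreal mtopology) mtopology (\<lambda>(t, x). \<phi> t x)"
    using assms(1) by (simp add: continuous_flow_def)
  ultimately have "continuous_map (prod_topology euclideanreal mtopology) mtopology ((\<lambda>(t, x). \<phi> t x) \<circ> (\<lambda>p. (- fst p, snd p)))"
    by (rule continuous_map_compose)
  then have "continuous_map (prod_topology euclideanreal mtopology) mtopology (\<lambda>(t, x). \<phi> (- t) x)"
    by (simp add: o_def case_prod_unfold)
  moreover have "\<phi> (- (s + t)) x = \<phi> (- s) (\<phi> (- t) x)" if "x \<in> M" for s t x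
    using assms that unfolding continuous_flow_def minus_add_distrib by blast
  ultimately show ?thesis
    using assms unfolding continuous_flow_def by simp
qed

lemma time_change_cong:
  assumes "time_change M d \<phi> \<psi>" and eq: "\<And>t x. x \<in> M \<Longrightarrow> \<phi>' t x = \<phi> t x"
  shows "time_change M d \<phi>' \<psi>"
proof -
  have "continuous_flow M d \<phi>'"
    using assms(1) by (intro continuous_flow_cong[OF _ eq]) (simp add: time_change_def)
  then show ?thesis
    using assms(1) by (simp add: time_change_def eq)
qed

lemma time_change_reverse:
  assumes "time_change M d \<phi> \<psi>"
  shows "time_change M d (\<lambda>t. \<phi> (- t)) (\<lambda>t. \<psi> (- t))"
  unfolding time_change_def
proof (intro conjI ballI)
  show "continuous_flow M d (\<lambda>t. \<phi> (- t))" "continuous_flow M d (\<lambda>t. \<psi> (- t))"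
    using assms by (simp_all add: time_change_def continuous_flow_reverse)
  fix x assume "x \<in> M"
  then have r: "range (\<lambda>t. \<phi> t x) = range (\<lambda>t. \<psi> t x)"
    using assms by (simp add: time_change_def)
  have rev: "range (\<lambda>t::real. f (- t)) = range f" for f :: "real \<Rightarrow> 'a"
    by (auto simp: image_iff) (metis minus_minus)
  show "range (\<lambda>t. \<phi> (- t) x) = range (\<lambda>t. \<psi> (- t) x)"
    using r rev[of "\<lambda>t. \<phi> t x"] rev[of "\<lambda>t. \<psi> t x"] by simp
  obtain s where s: "strict_mono s" "s 0 = 0" "\<And>t. \<psi> t x = \<phi> (s t) x"
    using assms \<open>x \<in> M\<close> unfolding time_change_def by blast
  show "\<exists>s. strict_mono s \<and> s 0 = 0 \<and> (\<forall>t. \<psi> (- t) x = \<phi> (- s t) x)"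
    using s by (intro exI[of _ "\<lambda>t. - s (- t)"]) (auto simp: strict_mono_def)
qed

lemma negative_kinematic_expansive_reverse:
  assumes "positive_kinematic_expansive M d (\<lambda>t. \<psi> (- t))"
  shows "negative_kinematic_expansive M d \<psi>"
  unfolding negative_kinematic_expansive_def
proof (intro conjI allI impI)
  show "continuous_flow M d \<psi>"
    using assms continuous_flow_reverse[of M d "\<lambda>t. \<psi> (- t)"]
    by (simp add: positive_kinematic_expansive_def)
  show "compact_space (Metric_space.mtopology M d)"
    using assms by (simp add: positive_kinematic_expansive_def)
  fix \<epsilon> :: real assume "\<epsilon> > 0"
  then obtain \<delta> where \<delta>: "\<delta> > 0"
    "\<And>x y. x \<in> M \<Longrightarrow> y \<in> M \<Longrightarrow> \<forall>t\<in>{0..}. d (\<psi> (- t) x) (\<psi> (- t) y) < \<delta> \<Longrightarrow> \<exists>\<tau>\<in>{-\<epsilon><..<\<epsilon>}. y = \<psi> (- \<tau>) x"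
    using assms unfolding positive_kinematic_expansive_def by blast
  show "\<exists>\<delta>>0. \<forall>x\<in>M. \<forall>y\<in>M. (\<forall>t\<in>{..0}. d (\<psi> t x) (\<psi> t y) < \<delta>) \<longrightarrow> (\<exists>\<tau>\<in>{-\<epsilon><..<\<epsilon>}. y = \<psi> \<tau> x)"
  proof (intro exI[of _ \<delta>] conjI ballI impI \<delta>(1))
    fix x y assume xy: "x \<in> M" "y \<in> M" "\<forall>t\<in>{..0}. d (\<psi> t x) (\<psi> t y) < \<delta>"
    then have "\<forall>t\<in>{0..}. d (\<psi> (- t) x) (\<psi> (- t) y) < \<delta>" by simp
    from \<delta>(2)[OF xy(1,2) this] obtain \<tau> where "\<tau> \<in> {-\<epsilon><..<\<epsilon>}" "y = \<psi> (- \<tau>) x" by blast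
    then show "\<exists>\<tau>\<in>{-\<epsilon><..<\<epsilon>}. y = \<psi> \<tau> x" by (intro bexI[of _ "- \<tau>"]) auto
  qed
qed

lemma positive_strong_kinematic_expansive_cong:
  assumes "positive_strong_kinematic_expansive M d \<phi>" and eq: "\<And>t x. x \<in> M \<Longrightarrow> \<phi>' t x = \<phi> t x"
  shows "positive_strong_kinematic_expansive M d \<phi>'"
  using assms(1) continuous_flow_cong[of M d \<phi> \<phi>'] time_change_cong[of M d \<phi>' _ \<phi>]
  unfolding positive_strong_kinematic_expansive_def by (simp add: eq)

lemma negative_strong_kinematic_expansive_cong:
  assumes "negative_strong_kinematic_expansive M d \<phi>" and eq: "\<And>t x. x \<in> M \<Longrightarrow> \<phi>' t x = \<phi> t x"
  shows "negative_strong_kinematic_expansive M d \<phi>'"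
  using assms(1) continuous_flow_cong[of M d \<phi> \<phi>'] time_change_cong[of M d \<phi>' _ \<phi>]
  unfolding negative_strong_kinematic_expansive_def by (simp add: eq)

lemma negative_strong_kinematic_expansive_reverse:
  assumes "positive_strong_kinematic_expansive M d (\<lambda>t. \<phi> (- t))"
  shows "negative_strong_kinematic_expansive M d \<phi>"
  unfolding negative_strong_kinematic_expansive_def
proof (intro conjI allI impI)
  show "continuous_flow M d \<phi>"
    using assms continuous_flow_reverse[of M d "\<lambda>t. \<phi> (- t)"]
    by (simp add: positive_strong_kinematic_expansive_def)
  fix \<psi> assume "time_change M d \<phi> \<psi>"
  then show "negative_kinematic_expansive M d \<psi>"
    using assms time_change_reverse[of M d \<phi> \<psi>] negative_kinematic_expansive_reverse[of M d \<psi>]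
    by (simp add: positive_strong_kinematic_expansive_def)
qed

text \<open>Conjugation by \<open>diag(1, -1)\<close>, which reverses the horocycle flow.\<close>

definition flip :: "real^2^2 \<Rightarrow> real^2^2" where
  "flip A = mat2 (A$1$1) (- A$1$2) (- A$2$1) (A$2$2)"

lemma flip_mat2 [simp]: "flip (mat2 a b c d) = mat2 a (- b) (- c) d"
  by (simp add: flip_def)

lemma flip_mult: "flip (g ** h) = flip g ** flip h"
  by (rule mat2_cases[of g], rule mat2_cases[of h]) simp

lemma flip_flip [simp]: "flip (flip g) = g"
  by (rule mat2_cases[of g]) simp

lemma det_flip [simp]: "det (flip g) = det g"
  by (rule mat2_cases[of g]) simp

lemma norm_flip [simp]: "norm (flip g) = norm g"
  by (rule mat2_cases[of g]) (simp add: norm_mat2)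

lemma flip_unip: "flip (unip t) = unip (- t)"
  by (simp add: unip_def)

lemma norm_flip_diff: "norm (adj2 (flip g) ** flip h - mat 1) = norm (adj2 g ** h - mat 1)"
proof -
  have "adj2 (flip g) ** flip h - mat 1 = flip (adj2 g ** h - mat 1)"
    by (rule mat2_cases[of g], rule mat2_cases[of h]) (simp add: mat_1_mat2)
  then show ?thesis by simp
qed

context homogeneous_space
begin

text \<open>\<open>flip\<close> is an automorphism that preserves the norm and commutes with
  inversion, so precomposing the projection with it describes the same metric space \<open>M\<close>
  with the horocycle flow run backwards. The positive theorem then applies to the new
  projection.\<close>

lemma homogeneous_space_flip: "homogeneous_space M D (\<lambda>g. \<pi> (flip g)) R r0"
proof (unfold_locales, goal_cases)
  case (1 x)
  then obtain g where "g \<in> SL" "norm g \<le> R" "x = \<pi> g" by (rule liftE)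
  then show ?case by (intro bexI[of _ "flip g"]) auto
next
  case (2 g)
  then show ?case by (intro \<pi>_in) simp
next
  case (3 g h k)
  then show ?case unfolding flip_mult by (intro \<pi>_right_mult) auto
next
  case (4 g h e)
  have "flip g \<in> SL" "flip h \<in> SL" using 4 by auto
  from \<pi>_near[OF this 4(3,4)] obtain h' where
    h': "h' \<in> SL" "\<pi> h' = \<pi> (flip h)" "norm (adj2 (flip g) ** h' - mat 1) \<le> 4 * e" by blast
  then show ?case
    using norm_flip_diff[of g "flip h'"] by (intro bexI[of _ "flip h'"]) auto
next
  case (5 e)
  obtain r where r: "r > 0" "\<And>g h. g \<in> SL \<Longrightarrow> h \<in> SL \<Longrightarrow> norm (adj2 g ** h - mat 1) < r \<Longrightarrow> D (\<pi> g) (\<pi> h) < e"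
    using \<pi>_close[OF 5] by blast
  show ?case
  proof (intro exI[of _ r] conjI ballI impI r(1))
    fix g h assume "g \<in> SL" "h \<in> SL" "norm (adj2 g ** h - mat 1) < r"
    then show "D (\<pi> (flip g)) (\<pi> (flip h)) < e"
      by (intro r(2)) (simp_all add: norm_flip_diff)
  qed
next
  case 6
  show ?case by (rule r0_pos)
next
  case (7 g h)
  have "flip h = flip g"
    using 7 by (intro \<pi>_inj) (simp_all add: norm_flip_diff)
  then show ?case by (metis flip_flip)
qed

theorem negative_strong_kinematic_expansive_\<phi>: "negative_strong_kinematic_expansive M D \<phi>"
proof (rule negative_strong_kinematic_expansive_reverse)
  interpret rev: homogeneous_space M D "\<lambda>g. \<pi> (flip g)" R r0
    by (rule homogeneous_space_flip)
  show "positive_strong_kinematic_expansive M D (\<lambda>t. \<phi> (- t))"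
  proof (rule positive_strong_kinematic_expansive_cong[OF rev.positive_strong_kinematic_expansive_\<phi>])
    fix t x assume "x \<in> M"
    then obtain g where g: "g \<in> SL" "x = \<pi> (flip g)" by (rule rev.liftE)
    then have "flip g \<in> SL" by simp
    then show "\<phi> (- t) x = rev.\<phi> t x"
      unfolding g(2) by (simp only: rev.\<phi>_\<pi>[OF g(1)] \<phi>_\<pi> flip_mult flip_unip)
  qed
qed

end

section \<open>The quotient by a cocompact group\<close>

text \<open>The automorphy factor: its inverse square is the derivative of \<open>mobius A\<close>,
  and \<open>den_mult\<close> is its cocycle rule.\<close>

definition den :: "real^2^2 \<Rightarrow> complex \<Rightarrow> complex" where
  "den A z = of_real (A$2$1) * z + of_real (A$2$2)"

lemma den_nz:
  assumes "det A = 1" "Im z > 0"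
  shows "den A z \<noteq> 0"
proof
  assume 0: "den A z = 0"
  obtain a b c d where A: "A = mat2 a b c d" by (rule mat2_cases)
  have "Im (den A z) = 0" "Re (den A z) = 0" by (simp_all add: 0)
  then have "c = 0" "d = 0" using assms(2) by (auto simp: den_def A)
  then show False using assms(1) by (simp add: A)
qed

lemma mobius_minus: "mobius (- A) = mobius A"
proof
  fix z
  obtain a b c d where A: "A = mat2 a b c d" by (rule mat2_cases)
  have "mobius (- A) z = (- (of_real a * z + of_real b)) / (- (of_real c * z + of_real d))"
    by (simp add: mobius_def A)
  also have "\<dots> = mobius A z"
    unfolding minus_divide_left[symmetric] minus_divide_right[symmetric] by (simp add: mobius_def A)
  finally show "mobius (- A) z = mobius A z" .
qed

lemma psl_mobius_class [simp]: "psl_mobius (psl_class A) = mobius A"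
proof -
  have "\<exists>B. B \<in> psl_class A" by (auto simp: psl_class_eq)
  then have "(SOME B. B \<in> psl_class A) \<in> psl_class A" by (rule someI_ex)
  then have "(SOME B. B \<in> psl_class A) = A \<or> (SOME B. B \<in> psl_class A) = - A"
    by (simp only: psl_class_eq insert_iff empty_iff) simp
  then show ?thesis unfolding psl_mobius_def using mobius_minus by auto
qed

lemma den_mult:
  assumes "det B = 1" "Im z > 0"
  shows "den (A ** B) z = den A (mobius B z) * den B z"
  using den_nz[OF assms]
  by (rule_tac mat2_cases[of A], rule_tac mat2_cases[of B])
    (simp add: den_def mobius_def field_simps)

lemma mobius_mult:
  assumes "det A = 1" "det B = 1" "Im z > 0" "Im (mobius B z) > 0"
  shows "mobius (A ** B) z = mobius A (mobius B z)"
proof -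
  obtain a b c d where A: "A = mat2 a b c d" by (rule mat2_cases)
  have nz: "den B z \<noteq> 0" "den A (mobius B z) \<noteq> 0" using den_nz assms by auto
  have "(of_real a * mobius B z + of_real b) * den B z =
      of_real ((A ** B)$1$1) * z + of_real ((A ** B)$1$2)"
    using nz(1) by (rule_tac mat2_cases[of B]) (simp add: A den_def mobius_def field_simps)
  then have "mobius (A ** B) z = ((of_real a * mobius B z + of_real b) * den B z) / (den A (mobius B z) * den B z)"
    using den_mult[OF assms(2,3), of A] by (simp add: mobius_def den_def)
  also have "\<dots> = mobius A (mobius B z)"
    using nz(1) by (simp add: mobius_def den_def A)
  finally show ?thesis .
qed

lemma Im_mobius:
  assumes "det A = 1"
  shows "Im (mobius A z) = Im z / (cmod (den A z))\<^sup>2"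
proof -
  obtain a b c d where A: "A = mat2 a b c d" by (rule mat2_cases)
  have ad: "a * d - b * c = 1" using assms by (simp add: A)
  have "Im (mobius A z) = ((a * Im z) * (c * Re z + d) - (a * Re z + b) * (c * Im z)) / (cmod (den A z))\<^sup>2"
    by (simp add: mobius_def den_def A Im_divide cmod_power2)
  also have "(a * Im z) * (c * Re z + d) - (a * Re z + b) * (c * Im z) = (a * d - b * c) * Im z"
    by (simp add: algebra_simps)
  finally show ?thesis by (simp add: ad)
qed

lemma Im_mobius_pos: "det A = 1 \<Longrightarrow> Im z > 0 \<Longrightarrow> Im (mobius A z) > 0"
  by (simp add: Im_mobius den_nz)

lemma mobius_has_derivative:
  assumes "det A = 1" "Im z > 0"
  shows "(mobius A has_field_derivative 1 / (den A z)\<^sup>2) (at z)"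
proof -
  obtain a b c d where A: "A = mat2 a b c d" by (rule mat2_cases)
  have nz: "of_real c * z + of_real d \<noteq> (0::complex)"
    using den_nz[OF assms] by (simp add: den_def A)
  have ad: "of_real a * of_real d - of_real b * of_real c = (1::complex)"
    using assms(1) by (simp add: A flip: of_real_mult of_real_diff)
  have "((\<lambda>z. (of_real a * z + of_real b) / (of_real c * z + of_real d)) has_field_derivative
      (of_real a * (of_real c * z + of_real d) - (of_real a * z + of_real b) * of_real c)
        / ((of_real c * z + of_real d) * (of_real c * z + of_real d))) (at z)"
    using nz by (auto intro!: derivative_eq_intros)
  moreover have "of_real a * (of_real c * z + of_real d) - (of_real a * z + of_real b) * of_real c
      = of_real a * of_real d - of_real b * (of_real c :: complex)"
    by (simp add: algebra_simps)
  ultimately show ?thesis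
    unfolding ad by (simp add: mobius_def[abs_def] den_def A power2_eq_square)
qed

lemma psl_tangent_class:
  assumes "det A = 1" "Im z > 0"
  shows "psl_tangent (psl_class A) (z, v) = (mobius A z, v / (den A z)\<^sup>2)"
  using DERIV_imp_deriv[OF mobius_has_derivative[OF assms]] by (simp add: psl_tangent_def)

lemma psl_tangent_mult:
  assumes "det A = 1" "det B = 1" "Im z > 0"
  shows "psl_tangent (psl_class (A ** B)) (z, v) = psl_tangent (psl_class A) (psl_tangent (psl_class B) (z, v))"
  using assms Im_mobius_pos[OF assms(2,3)]
  by (simp add: psl_tangent_class det_mul mobius_mult den_mult power_mult_distrib)

lemma psl_tangent_unit:
  assumes "det A = 1" "w \<in> unit_tangent_H"
  shows "psl_tangent (psl_class A) w \<in> unit_tangent_H"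
proof -
  obtain z v where w: "w = (z, v)" by fastforce
  have z: "Im z > 0" "cmod v = Im z"
    using assms(2) by (auto simp: w unit_tangent_H_def upper_half_plane_def)
  then show ?thesis
    using assms(1) den_nz[OF assms(1) z(1)]
    by (simp add: w psl_tangent_class unit_tangent_H_def upper_half_plane_def Im_mobius norm_divide norm_power)
qed

text \<open>The vertical vector at \<open>\<i>\<close> has trivial stabilizer in PSL(2,R): fixing
  the direction forces \<open>den C \<i>\<close> to be 1 or -1, hence c = 0, and fixing the base
  point then forces a = d and b = 0.\<close>

lemma psl_tangent_eq_imp:
  assumes "A \<in> SL" "B \<in> SL" "psl_tangent (psl_class A) (\<i>, \<i>) = psl_tangent (psl_class B) (\<i>, \<i>)"
  shows "psl_class A = psl_class B"
proof -
  define C where "C = adj2 A ** B"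
  have C: "det C = 1" using assms by (simp add: C_def det_mul)
  have "psl_tangent (psl_class C) (\<i>, \<i>) = psl_tangent (psl_class (adj2 A)) (psl_tangent (psl_class A) (\<i>, \<i>))"
    unfolding C_def assms(3) using assms by (intro psl_tangent_mult) auto
  also have "\<dots> = psl_tangent (psl_class (adj2 A ** A)) (\<i>, \<i>)"
    using assms by (intro psl_tangent_mult[symmetric]) auto
  also have "\<dots> = (\<i>, \<i>)"
    using assms(1) by (simp add: adj2_left psl_tangent_class mobius_def den_def mat_1_mat2)
  finally have "mobius C \<i> = \<i>" "\<i> / (den C \<i>)\<^sup>2 = \<i>"
    using C by (simp_all add: psl_tangent_class)
  obtain a b c d where CC: "C = mat2 a b c d" by (rule mat2_cases)
  have nz: "den C \<i> \<noteq> 0" using C by (simp add: den_nz)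
  then have "(den C \<i>)\<^sup>2 = 1"
    using \<open>\<i> / (den C \<i>)\<^sup>2 = \<i>\<close> by (simp add: field_simps)
  then have "den C \<i> = 1 \<or> den C \<i> = - 1" by (rule power2_eq_1_iff[THEN iffD1])
  then have c: "c = 0" "d = 1 \<or> d = - 1"
    by (auto simp: den_def CC complex_eq_iff)
  have "of_real a * \<i> + of_real b = \<i> * den C \<i>"
    using \<open>mobius C \<i> = \<i>\<close> nz by (simp add: mobius_def den_def CC field_simps)
  then have "a = d" "b = 0" using c(1) by (auto simp: den_def CC complex_eq_iff)
  then have "C = mat 1 \<or> C = - mat 1" using c by (auto simp: CC mat_1_mat2)
  moreover have "B = A ** C" using assms(1) by (simp add: C_def)
  ultimately show ?thesis by (auto simp: psl_class_eq_iff matrix_mult_minus)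
qed

text \<open>Iwasawa decomposition: the rotation \<open>K\<close> fixes \<open>\<i>\<close> and turns
  the vertical vector into the direction of \<open>v\<close>, and the upper triangular
  \<open>N\<close> carries \<open>\<i>\<close> to \<open>z\<close>, stretching by Im z without
  turning.\<close>

lemma psl_tangent_transitive:
  assumes "w \<in> unit_tangent_H"
  obtains A where "A \<in> SL" "psl_tangent (psl_class A) (\<i>, \<i>) = w"
proof -
  obtain z v where w: "w = (z, v)" by fastforce
  have z: "Im z > 0" "cmod v = Im z"
    using assms by (auto simp: w unit_tangent_H_def upper_half_plane_def)
  define u where "u = v / of_real (Im z) / \<i>"
  have u: "cmod u = 1" using z by (simp add: u_def norm_divide norm_mult)
  \<comment> \<open>Half the angle, since tangent vectors are multiplied by the inverse square of
    \<open>den K \<i> = cis (- t)\<close>.\<close>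
  define t where "t = Arg u / 2"
  have t: "cis t * cis t = u"
    using u by (simp add: t_def cis_mult cis_Arg sgn_eq)
      (metis cis_Arg div_by_1 norm_zero of_real_1 sgn_eq zero_neq_one)
  define r where "r = sqrt (Im z)"
  have r: "r > 0" "r * r = Im z" using z by (simp_all add: r_def)
  define K where "K = mat2 (cos t) (sin t) (- sin t) (cos t)"
  define N where "N = mat2 r (Re z / r) 0 (1 / r)"
  have K: "det K = 1" using sin_cos_squared_add3[of t] by (simp add: K_def power2_eq_square add.commute)
  have N: "det N = 1" using r by (simp add: N_def)
  have dK: "den K \<i> = cis (- t)" by (simp add: den_def K_def complex_eq_iff)
  have "mobius K \<i> = \<i> * cis (- t) / cis (- t)"
    unfolding dK[symmetric] by (simp add: mobius_def den_def K_def algebra_simps) 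
  then have mK: "mobius K \<i> = \<i>" by simp
  have "\<i> / (cis (- t))\<^sup>2 = \<i> * u"
  proof -
    have "(cis (- t))\<^sup>2 * u = 1"
      by (simp add: power2_eq_square cis_mult flip: t)
    then show ?thesis by (simp add: field_simps)
  qed
  then have TK: "psl_tangent (psl_class K) (\<i>, \<i>) = (\<i>, \<i> * u)"
    using K by (simp add: psl_tangent_class mK dK)
  have "mobius N \<i> = (of_real r * \<i> + of_real (Re z / r)) * of_real r"
    using r by (simp add: mobius_def N_def)
  also have "\<dots> = of_real (r * r) * \<i> + of_real (Re z)"
    using r(1) by (simp add: algebra_simps)
  also have "\<dots> = z" unfolding r(2) by (simp add: complex_eq_iff)
  finally have mN: "mobius N \<i> = z" .
  have "\<i> * u / (den N \<i>)\<^sup>2 = \<i> * u * of_real (r * r)"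
    using r(1) by (simp add: den_def N_def power2_eq_square)
  also have "\<dots> = v" unfolding r(2) using z by (simp add: u_def)
  finally have "psl_tangent (psl_class N) (\<i>, \<i> * u) = w"
    using N by (simp add: psl_tangent_class mN w)
  then have "psl_tangent (psl_class (N ** K)) (\<i>, \<i>) = w"
    using psl_tangent_mult[OF N K, of \<i> \<i>] TK by simp
  then show ?thesis using that[of "N ** K"] N K by (simp add: det_mul)
qed

text \<open>The Frobenius norm is invariant under right multiplication by rotations, the stabilizer
  of \<open>\<i>\<close>, so it depends on \<open>mobius g \<i>\<close> alone. This converts
  compactness of the surface into bounds on matrices.\<close>

lemma norm_eq_mobius:
  assumes "g \<in> SL"
  shows "(norm g)\<^sup>2 = ((cmod (mobius g \<i>))\<^sup>2 + 1) / Im (mobius g \<i>)"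
proof -
  obtain a b c d where g: "g = mat2 a b c d" by (rule mat2_cases)
  have nz: "den g \<i> \<noteq> 0" using assms by (simp add: den_nz)
  have dg: "(cmod (den g \<i>))\<^sup>2 = c\<^sup>2 + d\<^sup>2"
    by (simp add: den_def g cmod_power2 add.commute)
  have "(cmod (mobius g \<i>))\<^sup>2 = (a\<^sup>2 + b\<^sup>2) / (c\<^sup>2 + d\<^sup>2)"
    unfolding dg[symmetric] by (simp add: mobius_def den_def g norm_divide power_divide cmod_power2 add.commute)
  moreover have "Im (mobius g \<i>) = 1 / (c\<^sup>2 + d\<^sup>2)"
    using Im_mobius[of g \<i>] assms by (simp add: dg)
  moreover have "c\<^sup>2 + d\<^sup>2 > 0" using nz dg[symmetric] by (simp add: zero_less_power)
  moreover have "(P / Q + 1) / (1 / Q) = P + Q" if "Q > 0" for P Q :: real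
    using that by (simp add: field_simps)
  ultimately show ?thesis by (simp add: g norm_mat2_power2)
qed

text \<open>\<open>topology\<close> returns the intended open sets only for a family that satisfies
  the axioms, which is what has to be verified.\<close>

lemma openin_quotient_surface:
  "openin (quotient_surface \<Gamma>) U \<longleftrightarrow> U \<subseteq> point_orbit \<Gamma> ` upper_half_plane \<and>
     openin (top_of_set upper_half_plane) {z \<in> upper_half_plane. point_orbit \<Gamma> z \<in> U}"
proof -
  have "istopology (\<lambda>U. U \<subseteq> point_orbit \<Gamma> ` upper_half_plane \<and>
     openin (top_of_set upper_half_plane) {z \<in> upper_half_plane. point_orbit \<Gamma> z \<in> U})"
    unfolding istopology_def
  proof (rule conjI; intro allI impI; (elim conjE)?; intro conjI)
    fix S T :: "complex set set"
    assume "openin (top_of_set upper_half_plane) {z \<in> upper_half_plane. point_orbit \<Gamma> z \<in> S}"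
      "openin (top_of_set upper_half_plane) {z \<in> upper_half_plane. point_orbit \<Gamma> z \<in> T}"
    from openin_Int[OF this]
    show "openin (top_of_set upper_half_plane) {z \<in> upper_half_plane. point_orbit \<Gamma> z \<in> S \<inter> T}"
      by (rule back_subst[of "openin _"]) auto
  next
    fix \<K> :: "complex set set set"
    assume *: "\<forall>K\<in>\<K>. K \<subseteq> point_orbit \<Gamma> ` upper_half_plane \<and>
      openin (top_of_set upper_half_plane) {z \<in> upper_half_plane. point_orbit \<Gamma> z \<in> K}"
    have "openin (top_of_set upper_half_plane) (\<Union>K\<in>\<K>. {z \<in> upper_half_plane. point_orbit \<Gamma> z \<in> K})"
      using * by (intro openin_Union) auto
    then show "openin (top_of_set upper_half_plane) {z \<in> upper_half_plane. point_orbit \<Gamma> z \<in> \<Union>\<K>}"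
      by (rule back_subst[of "openin _"]) auto
    show "\<Union>\<K> \<subseteq> point_orbit \<Gamma> ` upper_half_plane" using * by blast
  qed blast
  then show ?thesis
    unfolding quotient_surface_def by (simp add: topology_inverse')
qed

lemma topspace_quotient_surface: "topspace (quotient_surface \<Gamma>) = point_orbit \<Gamma> ` upper_half_plane"
proof
  show "topspace (quotient_surface \<Gamma>) \<subseteq> point_orbit \<Gamma> ` upper_half_plane"
    using openin_topspace[of "quotient_surface \<Gamma>"] unfolding openin_quotient_surface by blast
  have "{z \<in> upper_half_plane. point_orbit \<Gamma> z \<in> point_orbit \<Gamma> ` upper_half_plane} = upper_half_plane"
    by blast
  then have "openin (quotient_surface \<Gamma>) (point_orbit \<Gamma> ` upper_half_plane)"
    unfolding openin_quotient_surface by simp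
  then show "point_orbit \<Gamma> ` upper_half_plane \<subseteq> topspace (quotient_surface \<Gamma>)"
    by (rule openin_subset)
qed

section \<open>Cocompact groups: bounded lifts and injectivity radius\<close>

locale cocompact_group =
  fixes \<Gamma> :: "(real^2^2) set set"
  assumes discrete: "discrete_subgroup \<Gamma>"
    and cocompact: "compact_space (quotient_surface \<Gamma>)"
begin

lemma subgroup_\<Gamma>: "subgroup \<Gamma> PSL2"
  using discrete by (simp add: discrete_subgroup_def)

lemma \<Gamma>_carrier: "\<gamma> \<in> \<Gamma> \<Longrightarrow> \<gamma> \<in> carrier PSL2"
  using subgroup.mem_carrier[OF subgroup_\<Gamma>] .

lemma \<Gamma>_cases:
  assumes "\<gamma> \<in> \<Gamma>"
  obtains c where "c \<in> SL" "\<gamma> = psl_class c"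
  using \<Gamma>_carrier[OF assms] by (auto simp: carrier_PSL2)

text \<open>The full preimage in SL(2,R). It contains \<open>- mat 1\<close>, so the sign ambiguity
  of representatives is absorbed into the group.\<close>

definition \<Gamma>SL :: "(real^2^2) set" where
  "\<Gamma>SL = {c \<in> SL. psl_class c \<in> \<Gamma>}"

lemma \<Gamma>SL_SL: "c \<in> \<Gamma>SL \<Longrightarrow> c \<in> SL"
  by (simp add: \<Gamma>SL_def)

lemma \<Gamma>SL_mult: "c \<in> \<Gamma>SL \<Longrightarrow> e \<in> \<Gamma>SL \<Longrightarrow> c ** e \<in> \<Gamma>SL"
  using subgroup.m_closed[OF subgroup_\<Gamma>, of "psl_class c" "psl_class e"]
  by (simp add: \<Gamma>SL_def mult_PSL2 det_mul)

lemma \<Gamma>SL_adj2: "c \<in> \<Gamma>SL \<Longrightarrow> adj2 c \<in> \<Gamma>SL"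
  using subgroup.m_inv_closed[OF subgroup_\<Gamma>, of "psl_class c"]
  by (simp add: \<Gamma>SL_def inv_PSL2)

lemma \<Gamma>SL_one: "mat 1 \<in> \<Gamma>SL"
  using subgroup.one_closed[OF subgroup_\<Gamma>] by (simp add: \<Gamma>SL_def one_PSL2)

lemma \<Gamma>SL_minus: "c \<in> \<Gamma>SL \<Longrightarrow> - c \<in> \<Gamma>SL"
  by (simp add: \<Gamma>SL_def psl_class_minus)

lemma \<Gamma>_eq: "\<Gamma> = psl_class ` \<Gamma>SL"
proof
  show "psl_class ` \<Gamma>SL \<subseteq> \<Gamma>" by (auto simp: \<Gamma>SL_def)
  show "\<Gamma> \<subseteq> psl_class ` \<Gamma>SL"
  proof
    fix \<gamma> assume \<gamma>: "\<gamma> \<in> \<Gamma>"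
    then obtain c where c: "c \<in> SL" "\<gamma> = psl_class c" by (rule \<Gamma>_cases)
    then have "c \<in> \<Gamma>SL" using \<gamma> by (simp add: \<Gamma>SL_def)
    then show "\<gamma> \<in> psl_class ` \<Gamma>SL" using c(2) by (rule rev_image_eqI)
  qed
qed

lemma image_\<Gamma>: "f ` \<Gamma> = (\<lambda>c. f (psl_class c)) ` \<Gamma>SL"
proof -
  have "f ` (psl_class ` \<Gamma>SL) = (\<lambda>c. f (psl_class c)) ` \<Gamma>SL" by (rule image_image)
  then show ?thesis by (simp only: \<Gamma>_eq[symmetric])
qed

lemma point_orbit_eq: "point_orbit \<Gamma> z = (\<lambda>c. mobius c z) ` \<Gamma>SL"
  by (simp add: point_orbit_def image_\<Gamma>)

lemma point_orbit_self: "z \<in> point_orbit \<Gamma> z"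
  unfolding point_orbit_eq using \<Gamma>SL_one by (intro image_eqI[of _ _ "mat 1"]) (simp_all add: mobius_def mat_1_mat2)

lemma point_orbit_mobius:
  assumes "c \<in> \<Gamma>SL" "Im z > 0"
  shows "point_orbit \<Gamma> (mobius c z) = point_orbit \<Gamma> z"
proof -
  have sub: "point_orbit \<Gamma> (mobius c z) \<subseteq> point_orbit \<Gamma> z" if "c \<in> \<Gamma>SL" "Im z > 0" for c z
  proof -
    have "mobius e (mobius c z) = mobius (e ** c) z" if "e \<in> \<Gamma>SL" for e
      using \<Gamma>SL_SL[OF that] \<Gamma>SL_SL[OF \<open>c \<in> \<Gamma>SL\<close>] \<open>Im z > 0\<close> Im_mobius_pos[of c z]
      by (simp add: mobius_mult)
    then show ?thesis
      unfolding point_orbit_eq using \<Gamma>SL_mult that(1) by auto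
  qed
  have cS: "det c = 1" using \<Gamma>SL_SL[OF assms(1)] by simp
  have "mobius (adj2 c) (mobius c z) = mobius (adj2 c ** c) z"
    using cS assms Im_mobius_pos[of c z] by (simp add: mobius_mult)
  also have "\<dots> = z" using cS by (simp add: adj2_left) (simp add: mobius_def mat_1_mat2)
  finally have "mobius (adj2 c) (mobius c z) = z" .
  then show ?thesis
    using sub[OF assms] sub[OF \<Gamma>SL_adj2[OF assms(1)] Im_mobius_pos[OF cS assms(2)]] by simp
qed

text \<open>The sets \<open>B n\<close> exhaust the half plane by open sets on which |z| is bounded
  and Im z is bounded below. Their images are an open cover of the surface; a finite subcover shows
  that every orbit meets a single \<open>B N\<close>, on which \<open>norm_eq_mobius\<close> bounds
  the norm.\<close>

lemma bounded_representative:
  obtains R where "\<And>g. g \<in> SL \<Longrightarrow> \<exists>c\<in>\<Gamma>SL. norm (c ** g) \<le> R"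
proof -
  define B where "B n = {z. Im z > inverse (real (Suc n)) \<and> cmod z < real (Suc n)}" for n
  define U where "U n = point_orbit \<Gamma> ` B n" for n
  have BH: "B n \<subseteq> upper_half_plane" for n
  proof
    fix z assume "z \<in> B n"
    then have "inverse (real (Suc n)) < Im z" by (simp add: B_def)
    then have "0 < Im z" by (rule less_trans[rotated]) simp
    then show "z \<in> upper_half_plane" by (simp add: upper_half_plane_def)
  qed
  \<comment> \<open>The saturation of \<open>B n\<close> is the union of its preimages under the
    group, which are open by continuity of the Moebius maps.\<close>
  have pre: "{z \<in> upper_half_plane. point_orbit \<Gamma> z \<in> U n} = (\<Union>c\<in>\<Gamma>SL. upper_half_plane \<inter> mobius c -` B n)" for n
  proof (intro equalityI subsetI)
    fix z assume z: "z \<in> {z \<in> upper_half_plane. point_orbit \<Gamma> z \<in> U n}"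
    then obtain w where w: "w \<in> B n" "point_orbit \<Gamma> z = point_orbit \<Gamma> w" by (auto simp: U_def)
    then have "w \<in> point_orbit \<Gamma> z" using point_orbit_self by simp
    then show "z \<in> (\<Union>c\<in>\<Gamma>SL. upper_half_plane \<inter> mobius c -` B n)"
      using z w(1) by (auto simp: point_orbit_eq)
  next
    fix z assume "z \<in> (\<Union>c\<in>\<Gamma>SL. upper_half_plane \<inter> mobius c -` B n)"
    then obtain c where c: "c \<in> \<Gamma>SL" "z \<in> upper_half_plane" "mobius c z \<in> B n" by blast
    then have "point_orbit \<Gamma> (mobius c z) = point_orbit \<Gamma> z"
      by (intro point_orbit_mobius) (simp_all add: upper_half_plane_def)
    then show "z \<in> {z \<in> upper_half_plane. point_orbit \<Gamma> z \<in> U n}"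
      using c by (metis (mono_tags, lifting) U_def imageI mem_Collect_eq)
  qed
  have "openin (quotient_surface \<Gamma>) (U n)" for n
    unfolding openin_quotient_surface pre
  proof (intro conjI openin_Union)
    show "U n \<subseteq> point_orbit \<Gamma> ` upper_half_plane" using BH by (auto simp: U_def)
    have "open (B n)"
      unfolding B_def by (intro open_Collect_conj open_Collect_less continuous_intros)
    moreover have "continuous_on upper_half_plane (mobius c)" if "c \<in> \<Gamma>SL" for c
    proof (intro continuous_at_imp_continuous_on ballI)
      fix z assume "z \<in> upper_half_plane"
      then show "isCont (mobius c) z"
        using mobius_has_derivative[of c z] \<Gamma>SL_SL[OF that] DERIV_isCont by (auto simp: upper_half_plane_def)
    qed
    ultimately have "openin (top_of_set upper_half_plane) (upper_half_plane \<inter> mobius c -` B n)" if "c \<in> \<Gamma>SL" for c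
      using that by (intro continuous_openin_preimage_gen)
    then show "\<And>S. S \<in> (\<lambda>c. upper_half_plane \<inter> mobius c -` B n) ` \<Gamma>SL \<Longrightarrow> openin (top_of_set upper_half_plane) S"
      by blast
  qed
  moreover have "topspace (quotient_surface \<Gamma>) \<subseteq> \<Union> (range U)"
    unfolding topspace_quotient_surface
  proof
    fix q assume "q \<in> point_orbit \<Gamma> ` upper_half_plane"
    then obtain z where z: "Im z > 0" "q = point_orbit \<Gamma> z" by (auto simp: upper_half_plane_def)
    obtain m where m: "inverse (real (Suc m)) < Im z" using reals_Archimedean[OF z(1)] by blast
    obtain k where k: "cmod z < real k" using reals_Archimedean2 by blast
    have "inverse (real (Suc (m + k))) \<le> inverse (real (Suc m))" by (simp add: field_simps)
    then have "inverse (real (Suc (m + k))) < Im z" using m by (rule le_less_trans)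
    moreover have "cmod z < real (Suc (m + k))" using k by simp
    ultimately have "z \<in> B (m + k)" unfolding B_def by blast
    then show "q \<in> \<Union> (range U)" using z by (auto simp: U_def)
  qed
  ultimately have "\<exists>\<F>. finite \<F> \<and> \<F> \<subseteq> range U \<and> topspace (quotient_surface \<Gamma>) \<subseteq> \<Union>\<F>"
    using cocompact[unfolded compact_space_alt, rule_format, of "range U"] by simp
  then obtain \<F> where F: "finite \<F>" "\<F> \<subseteq> range U" "topspace (quotient_surface \<Gamma>) \<subseteq> \<Union>\<F>"
    by (elim exE conjE)
  obtain I where I: "finite I" "\<F> = U ` I" using finite_subset_image[OF F(1,2)] by (elim exE conjE)
  obtain N where "\<forall>n\<in>I. n \<le> N" using I(1)[unfolded finite_nat_set_iff_bounded_le] by (elim exE)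
  then have N: "n \<le> N" if "n \<in> I" for n using that by simp
  have mono: "B n \<subseteq> B N" if "n \<le> N" for n
  proof
    fix z assume "z \<in> B n"
    then have z: "inverse (real (Suc n)) < Im z" "cmod z < real (Suc n)" by (simp_all add: B_def)
    have "inverse (real (Suc N)) \<le> inverse (real (Suc n))" using that by (simp add: field_simps)
    from le_less_trans[OF this z(1)] have "inverse (real (Suc N)) < Im z" .
    moreover have "cmod z < real (Suc N)" using z(2) that by simp
    ultimately show "z \<in> B N" unfolding B_def by blast
  qed
  \<comment> \<open>Read off from \<open>norm_eq_mobius\<close>: on \<open>B N\<close> both |z| and
    1/Im z are below N + 1.\<close>
  define R where "R = sqrt ((real (Suc N))\<^sup>2 + 1) * sqrt (real (Suc N))"
  have "\<exists>c\<in>\<Gamma>SL. norm (c ** g) \<le> R" if g: "g \<in> SL" for g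
  proof -
    define z where "z = mobius g \<i>"
    have z: "Im z > 0" using g by (simp add: z_def Im_mobius_pos)
    then have "point_orbit \<Gamma> z \<in> topspace (quotient_surface \<Gamma>)"
      unfolding topspace_quotient_surface by (simp add: upper_half_plane_def)
    then obtain n where n: "n \<in> I" "point_orbit \<Gamma> z \<in> U n" using F(3) I(2) by blast
    have "z \<in> (\<Union>c\<in>\<Gamma>SL. upper_half_plane \<inter> mobius c -` B n)"
      unfolding pre[symmetric] using n z by (simp add: upper_half_plane_def)
    then obtain c where c: "c \<in> \<Gamma>SL" "mobius c z \<in> B n" by blast
    have cS: "c \<in> SL" by (rule \<Gamma>SL_SL[OF c(1)])
    have cg: "mobius (c ** g) \<i> = mobius c z"
      unfolding z_def using g cS z by (intro mobius_mult) (simp_all add: z_def)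
    have b: "Im (mobius c z) > inverse (real (Suc N))" "cmod (mobius c z) < real (Suc N)"
      using c(2) mono[OF N[OF n(1)]] by (auto simp: B_def)
    have "(norm (c ** g))\<^sup>2 = ((cmod (mobius c z))\<^sup>2 + 1) / Im (mobius c z)"
      using norm_eq_mobius[of "c ** g"] g cS by (simp add: cg det_mul)
    also have "\<dots> \<le> ((real (Suc N))\<^sup>2 + 1) / inverse (real (Suc N))"
      using b by (intro frac_le add_mono power_mono) (auto simp del: of_nat_Suc)
    also have "\<dots> = R\<^sup>2"
      by (simp add: R_def power_mult_distrib field_simps del: of_nat_Suc)
    finally have "norm (c ** g) \<le> R"
      by (rule power2_le_imp_le) (simp add: R_def)
    then show ?thesis using c(1) by blast
  qed
  then show ?thesis by (rule that)
qed

lemma discrete_SL: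
  obtains \<rho> where "\<rho> > 0" "\<And>c. c \<in> \<Gamma>SL \<Longrightarrow> norm (c - mat 1) < \<rho> \<Longrightarrow> c = mat 1"
proof -
  interpret G: Metric_space "carrier PSL2" d_G by (rule Metric_space_PSL2)
  have one: "psl_class (mat 1) \<in> \<Gamma>" using \<Gamma>SL_one by (simp add: \<Gamma>SL_def)
  have "openin (discrete_topology \<Gamma>) {psl_class (mat 1)}" using one by simp
  then have "openin (subtopology G.mtopology \<Gamma>) {psl_class (mat 1)}"
    using discrete by (simp add: discrete_subgroup_def)
  then obtain T where T: "openin G.mtopology T" "{psl_class (mat 1)} = T \<inter> \<Gamma>"
    by (auto simp: openin_subtopology)
  then have "psl_class (mat 1) \<in> T" by blast
  then obtain e where e: "e > 0" "G.mball (psl_class (mat 1)) e \<subseteq> T"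
    using T(1) unfolding G.openin_mtopology by blast
  obtain r where r: "r > 0" "\<And>g h. g \<in> SL \<Longrightarrow> h \<in> SL \<Longrightarrow> norm (adj2 g ** h - mat 1) < r \<Longrightarrow>
     d_G (psl_class g) (psl_class h) < e"
    using d_G_close[OF e(1)] by blast
  \<comment> \<open>Discreteness in PSL(2,R) only gives c up to sign; a radius of at most 1 excludes
    \<open>- mat 1\<close>, which has an entry at distance 2.\<close>
  have "c = mat 1" if c: "c \<in> \<Gamma>SL" "norm (c - mat 1) < min r 1" for c
  proof -
    have cS: "c \<in> SL" by (rule \<Gamma>SL_SL[OF c(1)])
    have "d_G (psl_class (mat 1)) (psl_class c) < e"
      using r(2)[of "mat 1" c] cS c(2) by simp
    then have "psl_class c \<in> T"
      using e(2) cS by auto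
    then have "psl_class c \<in> {psl_class (mat 1)}"
      unfolding T(2) using c(1) by (simp add: \<Gamma>SL_def)
    then have "c = mat 1 \<or> c = - mat 1" by (auto simp: psl_class_eq_iff)
    moreover have "c \<noteq> - mat 1"
    proof
      assume "c = - mat 1"
      then have "\<bar>(c - mat 1) $ 1 $ 1\<bar> = 2" by (simp add: mat_1_mat2)
      then show False using abs_entry_le_norm[of "c - mat 1" 1 1] c(2) by simp
    qed
    ultimately show ?thesis by blast
  qed
  then show ?thesis using that[of "min r 1"] r(1) by simp
qed

text \<open>Discreteness controls group elements near \<open>mat 1\<close>, while \<open>g\<close>
  is arbitrary. Replacing \<open>g\<close> by a bounded representative \<open>k = e ** g\<close>
  conjugates \<open>c\<close> to \<open>e ** c ** adj2 e\<close>, whose distance from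
  \<open>mat 1\<close> is at most R^2 times the given one. The 1 in the denominator keeps it
  positive.\<close>

lemma uniform_injectivity:
  obtains r where "r > 0" "\<And>c g. c \<in> \<Gamma>SL \<Longrightarrow> g \<in> SL \<Longrightarrow> norm (adj2 g ** (c ** g) - mat 1) < r \<Longrightarrow> c = mat 1"
proof -
  obtain R where R: "\<And>g. g \<in> SL \<Longrightarrow> \<exists>c\<in>\<Gamma>SL. norm (c ** g) \<le> R" using bounded_representative by blast
  obtain \<rho> where \<rho>: "\<rho> > 0" "\<And>c. c \<in> \<Gamma>SL \<Longrightarrow> norm (c - mat 1) < \<rho> \<Longrightarrow> c = mat 1" using discrete_SL by blast
  have R0: "R \<ge> 0" using R[OF SL_one] norm_ge_zero order_trans by blast
  have "c = mat 1" if c: "c \<in> \<Gamma>SL" and g: "g \<in> SL" and n: "norm (adj2 g ** (c ** g) - mat 1) < \<rho> / (R * R + 1)" for c g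
  proof -
    obtain e where e: "e \<in> \<Gamma>SL" "norm (e ** g) \<le> R" using R[OF g] by blast
    have eS: "det e = 1" using \<Gamma>SL_SL[OF e(1)] by simp
    define k where "k = e ** g"
    have k: "det k = 1" using eS g by (simp add: k_def det_mul)
    define E where "E = adj2 g ** (c ** g)"
    have E: "k ** E ** adj2 k = e ** c ** adj2 e"
      using eS g by (simp add: k_def E_def adj2_mult matrix_mul_assoc[symmetric])
    have "e ** c ** adj2 e - mat 1 = k ** (E - mat 1) ** adj2 k"
      using k by (simp add: E mm.diff_left mm.diff_right adj2_right)
    then have "norm (e ** c ** adj2 e - mat 1) \<le> norm (k ** (E - mat 1)) * norm (adj2 k)"
      using norm_matrix_mult_le by metis
    also have "\<dots> \<le> norm k * norm (E - mat 1) * norm k"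
      by (simp add: mult_right_mono norm_matrix_mult_le)
    also have "\<dots> \<le> R * norm (E - mat 1) * R"
      using e(2) R0 by (intro mult_mono) (auto simp: k_def)
    also have "\<dots> = (R * R) * norm (E - mat 1)" by simp
    also have "\<dots> \<le> (R * R + 1) * norm (E - mat 1)" by (intro mult_right_mono) auto
    also have "\<dots> < \<rho>"
    proof -
      have "R * R + 1 > 0" by (simp add: add_nonneg_pos)
      then show ?thesis using n by (simp add: E_def pos_less_divide_eq mult.commute)
    qed
    finally have "e ** c ** adj2 e = mat 1"
      using e(1) c by (intro \<rho>(2) \<Gamma>SL_mult \<Gamma>SL_adj2)
    then have "adj2 e ** (e ** c ** adj2 e) ** e = adj2 e ** mat 1 ** e" by simp
    then show ?thesis using eS by (simp add: matrix_mul_assoc[symmetric] adj2_left)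
  qed
  moreover have "\<rho> / (R * R + 1) > 0" using \<rho>(1) by (simp add: add_nonneg_pos)
  ultimately show ?thesis using that by blast
qed

section \<open>Cosets as unit tangent vectors, and the quotient distance\<close>

definition coset :: "real^2^2 \<Rightarrow> (real^2^2) set set" where
  "coset g = \<Gamma> #>\<^bsub>PSL2\<^esub> psl_class g"

definition \<pi> :: "real^2^2 \<Rightarrow> (complex \<times> complex) set" where
  "\<pi> g = Xi_inv (coset g)"

lemma coset_eq:
  assumes "g \<in> SL"
  shows "coset g = (\<lambda>c. psl_class (c ** g)) ` \<Gamma>SL"
proof -
  have "coset g = (\<lambda>\<gamma>. \<gamma> \<otimes>\<^bsub>PSL2\<^esub> psl_class g) ` \<Gamma>"
    by (auto simp: coset_def r_coset_def)
  also have "\<dots> = (\<lambda>c. psl_class (c ** g)) ` \<Gamma>SL"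
    unfolding image_\<Gamma> by (intro image_cong refl mult_PSL2 \<Gamma>SL_SL assms)
  finally show ?thesis .
qed

lemma X_space_eq: "X_space \<Gamma> = coset ` SL"
  by (auto simp: X_space_def RCOSETS_def carrier_PSL2 coset_def)

lemma \<pi>_eq:
  assumes "g \<in> SL"
  shows "\<pi> g = (\<lambda>c. psl_tangent (psl_class (c ** g)) (\<i>, \<i>)) ` \<Gamma>SL"
  unfolding \<pi>_def coset_eq[OF assms] Xi_inv_def by (rule image_image)

text \<open>Without it \<open>Xi\<close>, an \<open>inv_into\<close>, would not recover the coset.
  It follows from the trivial stabilizer of the vertical vector, as cosets are subsets of the
  group.\<close>

lemma inj_on_Xi_inv: "inj_on Xi_inv (X_space \<Gamma>)"
proof (rule inj_onI)
  fix S T assume ST: "S \<in> X_space \<Gamma>" "T \<in> X_space \<Gamma>" "Xi_inv S = Xi_inv T"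
  have sub: "S \<subseteq> carrier PSL2" if S: "S \<in> X_space \<Gamma>" for S
  proof -
    obtain g where g: "g \<in> SL" "S = coset g" using S by (auto simp: X_space_eq)
    show ?thesis
      unfolding g(2) coset_eq[OF g(1)] using \<Gamma>SL_SL g(1) by (auto simp: det_mul carrier_PSL2)
  qed
  have "inj_on (\<lambda>h. psl_tangent h (\<i>, \<i>)) (carrier PSL2)"
  proof (rule inj_onI)
    fix p q assume pq: "p \<in> carrier PSL2" "q \<in> carrier PSL2" "psl_tangent p (\<i>, \<i>) = psl_tangent q (\<i>, \<i>)"
    then obtain A B where "A \<in> SL" "B \<in> SL" "p = psl_class A" "q = psl_class B" by (auto simp: carrier_PSL2)
    then show "p = q" using psl_tangent_eq_imp[of A B] pq(3) by blast
  qed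
  then show "S = T"
    using ST(3) inj_on_image_eq_iff[OF _ sub[OF ST(1)] sub[OF ST(2)]] unfolding Xi_inv_def by blast
qed

lemma Xi_\<pi>: "g \<in> SL \<Longrightarrow> Xi \<Gamma> (\<pi> g) = coset g"
  unfolding Xi_def \<pi>_def by (intro inv_into_f_f inj_on_Xi_inv) (simp add: X_space_eq)

lemma unit_tangent_quotient_eq: "unit_tangent_quotient \<Gamma> = \<pi> ` SL"
proof -
  have orb: "(\<lambda>\<gamma>. psl_tangent \<gamma> (psl_tangent (psl_class g) (\<i>, \<i>))) ` \<Gamma> = \<pi> g" if "g \<in> SL" for g
    unfolding image_\<Gamma> \<pi>_eq[OF that] using that \<Gamma>SL_SL
    by (intro image_cong refl psl_tangent_mult[symmetric]) auto
  have base: "(\<i>, \<i>) \<in> unit_tangent_H"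
    by (simp add: unit_tangent_H_def upper_half_plane_def)
  show ?thesis
  proof (intro equalityI subsetI)
    fix x assume "x \<in> unit_tangent_quotient \<Gamma>"
    then obtain w where w: "w \<in> unit_tangent_H" "x = (\<lambda>\<gamma>. psl_tangent \<gamma> w) ` \<Gamma>"
      by (auto simp: unit_tangent_quotient_def)
    obtain g where "g \<in> SL" "psl_tangent (psl_class g) (\<i>, \<i>) = w"
      using psl_tangent_transitive[OF w(1)] by blast
    then show "x \<in> \<pi> ` SL" using orb[of g] w(2) by blast
  next
    fix x assume "x \<in> \<pi> ` SL"
    then obtain g where g: "g \<in> SL" "x = \<pi> g" by blast
    have "psl_tangent (psl_class g) (\<i>, \<i>) \<in> unit_tangent_H"
      using g(1) by (intro psl_tangent_unit base) simp
    then show "x \<in> unit_tangent_quotient \<Gamma>"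
      unfolding unit_tangent_quotient_def g(2) orb[OF g(1), symmetric] by blast
  qed
qed

lemma \<pi>_eq_iff:
  assumes g: "g \<in> SL" and h: "h \<in> SL"
  shows "\<pi> g = \<pi> h \<longleftrightarrow> (\<exists>c\<in>\<Gamma>SL. h = c ** g)"
proof
  assume "\<pi> g = \<pi> h"
  moreover have "psl_tangent (psl_class (mat 1 ** h)) (\<i>, \<i>) \<in> \<pi> h"
    unfolding \<pi>_eq[OF h] using \<Gamma>SL_one by blast
  ultimately obtain c where c: "c \<in> \<Gamma>SL" "psl_tangent (psl_class (mat 1 ** h)) (\<i>, \<i>) = psl_tangent (psl_class (c ** g)) (\<i>, \<i>)"
    unfolding \<pi>_eq[OF g] by auto
  have "psl_class h = psl_class (c ** g)"
    using psl_tangent_eq_imp[of "mat 1 ** h" "c ** g"] c(2) h SL_mult[OF \<Gamma>SL_SL[OF c(1)] g] by simp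
  then have "h = c ** g \<or> h = (- c) ** g"
    by (auto simp: psl_class_eq_iff matrix_mult_minus)
  then show "\<exists>c\<in>\<Gamma>SL. h = c ** g" using c(1) \<Gamma>SL_minus by blast
next
  assume "\<exists>c\<in>\<Gamma>SL. h = c ** g"
  then obtain c where c: "c \<in> \<Gamma>SL" "h = c ** g" by blast
  have cS: "det c = 1" using \<Gamma>SL_SL[OF c(1)] by simp
  have "(\<lambda>e. e ** c) ` \<Gamma>SL = \<Gamma>SL"
  proof (intro equalityI subsetI)
    fix e assume "e \<in> \<Gamma>SL"
    then have "e ** adj2 c \<in> \<Gamma>SL" by (intro \<Gamma>SL_mult \<Gamma>SL_adj2 c)
    then show "e \<in> (\<lambda>e. e ** c) ` \<Gamma>SL"
      by (rule rev_image_eqI) (simp add: cS)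
  qed (auto intro: \<Gamma>SL_mult c)
  then have "\<pi> g = (\<lambda>e. psl_tangent (psl_class (e ** g)) (\<i>, \<i>)) ` ((\<lambda>e. e ** c) ` \<Gamma>SL)"
    by (simp add: \<pi>_eq[OF g])
  also have "\<dots> = \<pi> h"
    by (simp only: \<pi>_eq[OF h]) (simp only: c(2) image_image matrix_mul_assoc)
  finally show "\<pi> g = \<pi> h" .
qed

abbreviation "M \<equiv> unit_tangent_quotient \<Gamma>"
abbreviation "D \<equiv> d_unit_tangent \<Gamma>"

lemma \<pi>_in_M: "g \<in> SL \<Longrightarrow> \<pi> g \<in> M"
  by (simp add: unit_tangent_quotient_eq)

lemma M_cases:
  assumes "x \<in> M"
  obtains g where "g \<in> SL" "x = \<pi> g"
  using assms unfolding unit_tangent_quotient_eq by blast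

lemma some_in_coset:
  assumes "g \<in> SL"
  obtains c where "c \<in> \<Gamma>SL" "(SOME p. p \<in> coset g) = psl_class (c ** g)"
proof -
  have "\<exists>p. p \<in> coset g" unfolding coset_eq[OF assms] using \<Gamma>SL_one by blast
  from someI_ex[OF this] show ?thesis using that unfolding coset_eq[OF assms] by blast
qed

text \<open>The representatives picked by \<open>SOME\<close> are \<open>a ** g\<close> and
  \<open>b ** h\<close> up to sign, with \<open>a\<close> and \<open>b\<close> in the group. Left
  invariance moves \<open>a\<close> to the other side, and the map from \<open>c\<close> to
  \<open>adj2 a ** c ** b\<close> only permutes the group.\<close>

lemma dist_\<pi>_less_iff:
  assumes g: "g \<in> SL" and h: "h \<in> SL"
  shows "D (\<pi> g) (\<pi> h) < e \<longleftrightarrow> (\<exists>c\<in>\<Gamma>SL. d_G (psl_class g) (psl_class (c ** h)) < e)"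
proof -
  obtain a where a: "a \<in> \<Gamma>SL" "(SOME p. p \<in> coset g) = psl_class (a ** g)" using some_in_coset[OF g] by blast
  obtain b where b: "b \<in> \<Gamma>SL" "(SOME p. p \<in> coset h) = psl_class (b ** h)" using some_in_coset[OF h] by blast
  have S: "det a = 1" "det b = 1" "det g = 1" "det h = 1" using \<Gamma>SL_SL[OF a(1)] \<Gamma>SL_SL[OF b(1)] g h by auto
  have "D (\<pi> g) (\<pi> h) = (INF \<gamma>\<in>\<Gamma>. d_G (psl_class (a ** g)) (\<gamma> \<otimes>\<^bsub>PSL2\<^esub> psl_class (b ** h)))"
    using g h unfolding d_unit_tangent_def d_X_def Xi_\<pi>[OF g] Xi_\<pi>[OF h] a(2) b(2)
    by (simp add: \<pi>_in_M X_space_eq)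
  also have "\<dots> = (INF c\<in>\<Gamma>SL. d_G (psl_class g) (psl_class (adj2 a ** c ** b ** h)))"
    unfolding image_\<Gamma>
  proof (intro arg_cong[where f = Inf] image_cong refl)
    fix c assume "c \<in> \<Gamma>SL"
    then have c: "det c = 1" using \<Gamma>SL_SL by auto
    have "d_G (psl_class (a ** g)) (psl_class c \<otimes>\<^bsub>PSL2\<^esub> psl_class (b ** h)) =
      d_G (psl_class a \<otimes>\<^bsub>PSL2\<^esub> psl_class g) (psl_class a \<otimes>\<^bsub>PSL2\<^esub> psl_class (adj2 a ** c ** b ** h))"
      using S c by (simp add: mult_PSL2 det_mul matrix_mul_assoc[symmetric])
    also have "\<dots> = d_G (psl_class g) (psl_class (adj2 a ** c ** b ** h))"
      using S c by (intro d_G_left_mult) (auto simp: det_mul)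
    finally show "d_G (psl_class (a ** g)) (psl_class c \<otimes>\<^bsub>PSL2\<^esub> psl_class (b ** h)) =
      d_G (psl_class g) (psl_class (adj2 a ** c ** b ** h))" .
  qed
  also have "\<dots> < e \<longleftrightarrow> (\<exists>c\<in>\<Gamma>SL. d_G (psl_class g) (psl_class (adj2 a ** c ** b ** h)) < e)"
    using \<Gamma>SL_one by (subst cInf_less_iff) (auto intro!: bdd_belowI2[of _ 0] d_G_psl_class_nonneg)
  also have "\<dots> \<longleftrightarrow> (\<exists>c\<in>\<Gamma>SL. d_G (psl_class g) (psl_class (c ** h)) < e)"
  proof
    assume "\<exists>c\<in>\<Gamma>SL. d_G (psl_class g) (psl_class (adj2 a ** c ** b ** h)) < e"
    then show "\<exists>c\<in>\<Gamma>SL. d_G (psl_class g) (psl_class (c ** h)) < e"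
      using \<Gamma>SL_mult[OF \<Gamma>SL_mult[OF \<Gamma>SL_adj2[OF a(1)]] b(1)] by blast
  next
    assume "\<exists>c\<in>\<Gamma>SL. d_G (psl_class g) (psl_class (c ** h)) < e"
    then obtain c where c: "c \<in> \<Gamma>SL" "d_G (psl_class g) (psl_class (c ** h)) < e" by blast
    have "adj2 a ** (a ** c ** adj2 b) ** b ** h = c ** h"
      using S by (simp add: matrix_mul_assoc[symmetric])
    moreover have "a ** c ** adj2 b \<in> \<Gamma>SL" by (intro \<Gamma>SL_mult \<Gamma>SL_adj2 a b c)
    ultimately show "\<exists>c\<in>\<Gamma>SL. d_G (psl_class g) (psl_class (adj2 a ** c ** b ** h)) < e"
      using c(2) by (intro bexI[of _ "a ** c ** adj2 b"]) simp_all
  qed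
  finally show ?thesis .
qed

lemma dist_nonneg: "0 \<le> D x y"
proof (cases "x \<in> M \<and> y \<in> M")
  case True
  then obtain g h where gh: "g \<in> SL" "x = \<pi> g" "h \<in> SL" "y = \<pi> h"
    unfolding unit_tangent_quotient_eq by blast
  have "\<not> D x y < 0"
    unfolding gh(2,4) dist_\<pi>_less_iff[OF gh(1,3)] using d_G_psl_class_nonneg by (simp add: not_less)
  then show ?thesis by simp
qed (auto simp: d_unit_tangent_def)

lemma dist_commute_less:
  assumes g: "g \<in> SL" and h: "h \<in> SL" and "D (\<pi> g) (\<pi> h) < e"
  shows "D (\<pi> h) (\<pi> g) < e"
proof -
  obtain c where c: "c \<in> \<Gamma>SL" "d_G (psl_class g) (psl_class (c ** h)) < e"
    using assms(3) unfolding dist_\<pi>_less_iff[OF g h] by blast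
  have S: "det c = 1" "det g = 1" "det h = 1" using \<Gamma>SL_SL[OF c(1)] g h by auto
  have "d_G (psl_class h) (psl_class (adj2 c ** g)) =
    d_G (psl_class (adj2 c) \<otimes>\<^bsub>PSL2\<^esub> psl_class (c ** h)) (psl_class (adj2 c) \<otimes>\<^bsub>PSL2\<^esub> psl_class g)"
    using S by (simp add: mult_PSL2 det_mul)
  also have "\<dots> = d_G (psl_class (c ** h)) (psl_class g)"
    using S by (intro d_G_left_mult) (auto simp: det_mul)
  also have "\<dots> = d_G (psl_class g) (psl_class (c ** h))" by (rule d_G_commute)
  finally show ?thesis
    unfolding dist_\<pi>_less_iff[OF h g] using c \<Gamma>SL_adj2[OF c(1)] by (intro bexI[of _ "adj2 c"]) simp_all
qed

lemma dist_commute: "D x y = D y x"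
proof (cases "x \<in> M \<and> y \<in> M")
  case True
  then obtain g h where gh: "g \<in> SL" "x = \<pi> g" "h \<in> SL" "y = \<pi> h"
    unfolding unit_tangent_quotient_eq by blast
  have "\<not> D x y < D y x" "\<not> D y x < D x y"
    using dist_commute_less[OF gh(1,3), of "D y x"] dist_commute_less[OF gh(3,1), of "D x y"]
    unfolding gh(2,4) by auto
  then show ?thesis by simp
qed (auto simp: d_unit_tangent_def)

lemma dist_triangle:
  assumes "x \<in> M" "y \<in> M" "z \<in> M"
  shows "D x z \<le> D x y + D y z"
proof (rule field_le_epsilon)
  fix e :: real assume e: "e > 0"
  obtain g where g: "g \<in> SL" "x = \<pi> g" using assms(1) by (rule M_cases)
  obtain h where h: "h \<in> SL" "y = \<pi> h" using assms(2) by (rule M_cases)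
  obtain k where k: "k \<in> SL" "z = \<pi> k" using assms(3) by (rule M_cases)
  have "D x y < D x y + e / 2" "D y z < D y z + e / 2" using e by simp_all
  then obtain a b where a: "a \<in> \<Gamma>SL" "d_G (psl_class g) (psl_class (a ** h)) < D x y + e / 2"
    and b: "b \<in> \<Gamma>SL" "d_G (psl_class h) (psl_class (b ** k)) < D y z + e / 2"
    using dist_\<pi>_less_iff[OF g(1) h(1), of "D x y + e / 2"] dist_\<pi>_less_iff[OF h(1) k(1), of "D y z + e / 2"]
    unfolding g(2) h(2) k(2) by blast
  have S: "det a = 1" "det b = 1" "det g = 1" "det h = 1" "det k = 1"
    using \<Gamma>SL_SL[OF a(1)] \<Gamma>SL_SL[OF b(1)] g h k by auto
  have "d_G (psl_class (a ** h)) (psl_class (a ** b ** k)) =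
    d_G (psl_class a \<otimes>\<^bsub>PSL2\<^esub> psl_class h) (psl_class a \<otimes>\<^bsub>PSL2\<^esub> psl_class (b ** k))"
    using S by (simp add: mult_PSL2 det_mul matrix_mul_assoc)
  also have "\<dots> = d_G (psl_class h) (psl_class (b ** k))"
    using S by (intro d_G_left_mult) (auto simp: det_mul)
  finally have "d_G (psl_class g) (psl_class (a ** b ** k)) \<le>
      d_G (psl_class g) (psl_class (a ** h)) + d_G (psl_class h) (psl_class (b ** k))"
    using d_G_triangle[of "psl_class g" "psl_class (a ** h)" "psl_class (a ** b ** k)"] S by (simp add: det_mul)
  also have "\<dots> < D x y + D y z + e" using a(2) b(2) by linarith
  finally have "D x z < D x y + D y z + e"
    unfolding g(2) k(2) dist_\<pi>_less_iff[OF g(1) k(1)] using \<Gamma>SL_mult[OF a(1) b(1)] by blast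
  then show "D x z \<le> D x y + D y z + e" by simp
qed

lemma \<pi>_dist_near:
  assumes g: "g \<in> SL" and h: "h \<in> SL" and "D (\<pi> g) (\<pi> h) < e" "e \<le> 1/2"
  shows "\<exists>h'\<in>SL. \<pi> h' = \<pi> h \<and> norm (adj2 g ** h' - mat 1) \<le> 4 * e"
proof -
  obtain c where c: "c \<in> \<Gamma>SL" "d_G (psl_class g) (psl_class (c ** h)) < e"
    using assms(3) unfolding dist_\<pi>_less_iff[OF g h] by blast
  have ch: "c ** h \<in> SL" by (rule SL_mult[OF \<Gamma>SL_SL[OF c(1)] h])
  obtain h' where h': "h' = c ** h \<or> h' = (- c) ** h" "norm (adj2 g ** h' - mat 1) \<le> 4 * e"
    using d_G_near[OF g ch c(2) assms(4)] unfolding matrix_mult_minus by blast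
  obtain c' where c': "c' \<in> \<Gamma>SL" "h' = c' ** h" using h'(1) c(1) \<Gamma>SL_minus by blast
  have "h' \<in> SL" unfolding c'(2) by (rule SL_mult[OF \<Gamma>SL_SL[OF c'(1)] h])
  then have "\<pi> h' = \<pi> h" using \<pi>_eq_iff[OF h, of h'] c' by blast
  then show ?thesis using h'(2) \<open>h' \<in> SL\<close> by blast
qed

lemma homogeneous_space: "\<exists>R r0. homogeneous_space M D \<pi> R r0"
proof -
  obtain R where R: "\<And>g. g \<in> SL \<Longrightarrow> \<exists>c\<in>\<Gamma>SL. norm (c ** g) \<le> R" using bounded_representative by blast
  obtain r where r: "r > 0"
    "\<And>c g. c \<in> \<Gamma>SL \<Longrightarrow> g \<in> SL \<Longrightarrow> norm (adj2 g ** (c ** g) - mat 1) < r \<Longrightarrow> c = mat 1"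
    using uniform_injectivity by blast
  have inj: "h = g" if g: "g \<in> SL" and h: "h \<in> SL" and eq: "\<pi> g = \<pi> h"
    and n: "norm (adj2 g ** h - mat 1) < r" for g h
  proof -
    obtain c where c: "c \<in> \<Gamma>SL" "h = c ** g" using eq \<pi>_eq_iff[OF g h] by blast
    then have "c = mat 1" using r(2)[OF c(1) g] n by simp
    then show ?thesis using c(2) by simp
  qed
  have refl: "D (\<pi> g) (\<pi> g) = 0" if g: "g \<in> SL" for g
  proof -
    have "D (\<pi> g) (\<pi> g) < e" if "e > 0" for e
      unfolding dist_\<pi>_less_iff[OF g g] using \<Gamma>SL_one g that d_G_eq_0_iff[of "psl_class g" "psl_class g"]
      by (intro bexI[of _ "mat 1"]) auto
    from this[of "D (\<pi> g) (\<pi> g)"] show ?thesis using dist_nonneg[of "\<pi> g" "\<pi> g"] by fastforce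
  qed
  \<comment> \<open>The infimum defining the distance might be approached without being attained.
    Two lifts of \<open>\<pi> h\<close> close to \<open>g\<close> are close to each other, hence
    equal by injectivity, so one lift would have to lie at all small distances from
    \<open>g\<close>.\<close>
  have sep: "\<pi> g = \<pi> h" if g: "g \<in> SL" and h: "h \<in> SL" and z: "D (\<pi> g) (\<pi> h) = 0" for g h
  proof (rule ccontr)
    assume ne: "\<pi> g \<noteq> \<pi> h"
    have near: "\<exists>h'\<in>SL. \<pi> h' = \<pi> h \<and> norm (adj2 g ** h' - mat 1) \<le> 4 * e" if "e > 0" "e \<le> 1/2" for e
      using \<pi>_dist_near[OF g h _ that(2)] z that(1) by simp
    \<comment> \<open>The lifts differ from \<open>g\<close> by at most 4 e1 each; with the bound 3
      for \<open>E\<close> this gives 3 * 8 e1 < r.\<close>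
    define e1 where "e1 = min (1/8) (r / 36)"
    have e1: "e1 > 0" "e1 \<le> 1/8" "24 * e1 < r" using r(1) by (auto simp: e1_def min_def)
    then obtain h1 where h1: "h1 \<in> SL" "\<pi> h1 = \<pi> h" "norm (adj2 g ** h1 - mat 1) \<le> 4 * e1"
      using near[of e1] by auto
    have "adj2 g ** h1 \<noteq> mat 1" using adj2_eqD[of g h1] g h1(2) ne by auto
    \<comment> \<open>A scale so fine that \<open>h1\<close> itself is too far from
      \<open>g\<close>, so the second lift must be a different one.\<close>
    define e2 where "e2 = min e1 (norm (adj2 g ** h1 - mat 1) / 8)"
    have e2: "e2 > 0" "e2 \<le> 1/2" "e2 \<le> e1" "4 * e2 < norm (adj2 g ** h1 - mat 1)"
      using e1 \<open>adj2 g ** h1 \<noteq> mat 1\<close> by (auto simp: e2_def min_def)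
    then obtain h2 where h2: "h2 \<in> SL" "\<pi> h2 = \<pi> h" "norm (adj2 g ** h2 - mat 1) \<le> 4 * e2"
      using near[of e2] by auto
    define E where "E = adj2 g ** h1"
    define F where "F = adj2 g ** h2"
    have E: "det E = 1" using g h1(1) by (simp add: E_def det_mul)
    have "adj2 h1 ** h2 = adj2 E ** F"
      using g by (simp add: E_def F_def adj2_mult matrix_mul_assoc[symmetric])
    then have "adj2 h1 ** h2 - mat 1 = adj2 E ** (F - E)"
      using E by (simp add: mm.diff_right adj2_left)
    then have "norm (adj2 h1 ** h2 - mat 1) \<le> norm E * norm (F - E)"
      using norm_matrix_mult_le[of "adj2 E" "F - E"] by simp
    also have "\<dots> \<le> 3 * (8 * e1)"
    proof (rule mult_mono)
      have "norm E \<le> norm (E - mat 1) + norm (mat 1 :: real^2^2)"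
        using norm_triangle_ineq[of "E - mat 1" "mat 1"] by simp
      also have "\<dots> \<le> 1 + 2"
        using h1(3) e1(2) real_le_lsqrt[of 2 2] by (intro add_mono) (simp_all add: norm_mat_1 E_def)
      finally show "norm E \<le> 3" by simp
      have "norm (F - E) \<le> norm (F - mat 1) + norm (E - mat 1)"
        using norm_triangle_ineq4[of "F - mat 1" "E - mat 1"] by simp
      then show "norm (F - E) \<le> 8 * e1" using h1(3) h2(3) e2(3) by (simp add: E_def F_def)
    qed auto
    finally have "norm (adj2 h1 ** h2 - mat 1) < r" using e1(3) by simp
    then have "h2 = h1" using inj[OF h1(1) h2(1)] h1(2) h2(2) by simp
    then show False using h2(3) e2(4) by simp
  qed
  have "homogeneous_space M D \<pi> R r"
  proof (unfold_locales, goal_cases)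
    case (1 x y)
    show ?case by (rule dist_nonneg)
  next
    case (2 x y)
    show ?case by (rule dist_commute)
  next
    case (3 x y)
    obtain g where g: "g \<in> SL" "x = \<pi> g" using 3(1) by (rule M_cases)
    obtain h where h: "h \<in> SL" "y = \<pi> h" using 3(2) by (rule M_cases)
    show ?case using refl[OF g(1)] sep[OF g(1) h(1)] unfolding g(2) h(2) by metis
  next
    case (4 x y z)
    then show ?case by (rule dist_triangle)
  next
    case (5 x)
    then obtain g where g: "g \<in> SL" "x = \<pi> g" by (rule M_cases)
    obtain c where c: "c \<in> \<Gamma>SL" "norm (c ** g) \<le> R" using R[OF g(1)] by blast
    have "c ** g \<in> SL" by (rule SL_mult[OF \<Gamma>SL_SL[OF c(1)] g(1)])
    moreover have "\<pi> (c ** g) = x" using \<pi>_eq_iff[OF g(1) calculation] c(1) g(2) by blast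
    ultimately show ?case using c(2) by blast
  next
    case (6 g)
    then show ?case by (rule \<pi>_in_M)
  next
    case (7 g h k)
    obtain c where c: "c \<in> \<Gamma>SL" "h = c ** g" using 7(4) \<pi>_eq_iff[OF 7(1,2)] by blast
    have "h ** k = c ** (g ** k)" by (simp add: c(2) matrix_mul_assoc)
    then show ?case using \<pi>_eq_iff[OF SL_mult[OF 7(1,3)] SL_mult[OF 7(2,3)]] c(1) by blast
  next
    case (8 g h e)
    then show ?case by (rule \<pi>_dist_near)
  next
    case (9 e)
    obtain q where q: "q > 0" "\<And>g h. g \<in> SL \<Longrightarrow> h \<in> SL \<Longrightarrow> norm (adj2 g ** h - mat 1) < q \<Longrightarrow>
       d_G (psl_class g) (psl_class h) < e"
      using d_G_close[OF 9] by blast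
    show ?case
    proof (intro exI[of _ q] conjI ballI impI q(1))
      fix g h assume gh: "g \<in> SL" "h \<in> SL" "norm (adj2 g ** h - mat 1) < q"
      then have "d_G (psl_class g) (psl_class (mat 1 ** h)) < e"
        using q(2)[OF gh] by simp
      then show "D (\<pi> g) (\<pi> h) < e"
        unfolding dist_\<pi>_less_iff[OF gh(1,2)] using \<Gamma>SL_one by blast
    qed
  next
    case 10
    show ?case by (rule r(1))
  next
    case (11 g h)
    then show ?case by (rule inj)
  qed
  then show ?thesis by blast
qed

text \<open>\<open>Xi\<close> and \<open>Xi_inv\<close> cancel, leaving right multiplication of a
  coset. This identifies the concrete flow with the abstract \<open>\<phi>\<close> on
  \<open>M\<close>.\<close>

lemma horocycle_flow_\<pi>:
  assumes "g \<in> SL"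
  shows "horocycle_flow \<Gamma> t (\<pi> g) = \<pi> (g ** unip t)"
proof -
  have b: "b_elem t = psl_class (unip t)"
    by (simp add: b_elem_def unip_def mat2_def)
  have "coset g #>\<^bsub>PSL2\<^esub> psl_class (unip t) = \<Gamma> #>\<^bsub>PSL2\<^esub> (psl_class g \<otimes>\<^bsub>PSL2\<^esub> psl_class (unip t))"
    unfolding coset_def
    by (rule group.coset_mult_assoc[OF group_PSL2 _ psl_class_in[OF assms] psl_class_in[OF unip_SL]])
      (use \<Gamma>_carrier in blast)
  then have "coset g #>\<^bsub>PSL2\<^esub> b_elem t = coset (g ** unip t)"
    by (simp only: b coset_def mult_PSL2[OF assms unip_SL])
  then show ?thesis
    by (simp add: horocycle_flow_def horocycle_X_def Xi_\<pi>[OF assms] \<pi>_def[of "g ** unip t"])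
qed

end

theorem theorem3p8:
  fixes \<Gamma> :: "(real^2^2) set set"
  assumes "discrete_subgroup \<Gamma>"
    and "acts_freely \<Gamma>"
    and "compact_space (quotient_surface \<Gamma>)"
  shows "positive_strong_kinematic_expansive
           (unit_tangent_quotient \<Gamma>) (d_unit_tangent \<Gamma>) (horocycle_flow \<Gamma>) \<and>
         negative_strong_kinematic_expansive
           (unit_tangent_quotient \<Gamma>) (d_unit_tangent \<Gamma>) (horocycle_flow \<Gamma>)"
proof -
  interpret cocompact_group \<Gamma>
    using assms by unfold_locales
  obtain R r0 where "homogeneous_space M D \<pi> R r0"
    using homogeneous_space by blast
  then interpret H: homogeneous_space M D \<pi> R r0 .
  have eq: "horocycle_flow \<Gamma> t x = H.\<phi> t x" if x: "x \<in> M" for t x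
  proof -
    obtain g where "g \<in> SL" "x = \<pi> g" using x by (rule M_cases)
    then show ?thesis by (simp only: horocycle_flow_\<pi> H.\<phi>_\<pi>)
  qed
  show ?thesis
    using positive_strong_kinematic_expansive_cong[OF H.positive_strong_kinematic_expansive_\<phi> eq]
      negative_strong_kinematic_expansive_cong[OF H.negative_strong_kinematic_expansive_\<phi> eq]
    by blast
qed

end
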